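(* Let $(R,\mathfrak{m})$ be a Cohen-Macaulay local ring, let $\mathfrak{p}$ be a prime ideal of $R$ of height $g$ such that $R_{\mathfrak{p}}$ is not a regular local ring, and let $J=(x_1,\dots,x_g)\subseteq\mathfrak{p}$ be an ideal generated by a regular sequence $x_1,\dots,x_g$. Set $I=J:\mathfrak{p}$. Then the associated graded ring $G_I(R)$ satisfies Serre's condition $S_1$.
   Context: Rings are commutative and Noetherian. $J:\mathfrak p=\{a\in R: a\mathfrak p\subseteq J\}$, and $G_I(R)=\bigoplus_{n\ge0}I^n/I^{n+1}$. *)

theory Defs
  imports "HOL-Algebra.Ring_Divisibility" "HOL-Algebra.Ideal_Product" "HOL-Library.Extended_Nat"
begin

section \<open>Local rings, height and dimension\<close>

definition noetherian_local_ring :: "('a, 'b) ring_scheme \<Rightarrow> 'a set \<Rightarrow> bool" where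
  "noetherian_local_ring R m \<longleftrightarrow>
     cring R \<and> noetherian_ring R \<and> maximalideal m R \<and> (\<forall>n. maximalideal n R \<longrightarrow> n = m)"

text \<open>The height of \<open>P\<close> is the supremum of the lengths \<open>n\<close> of chains
  \<open>c 0 \<subset> \<dots> \<subset> c n = P\<close> of prime ideals.\<close>

definition ideal_height :: "('a, 'b) ring_scheme \<Rightarrow> 'a set \<Rightarrow> enat" where
  "ideal_height R P = Sup {enat n | n. \<exists>c :: nat \<Rightarrow> 'a set.
     (\<forall>i\<le>n. primeideal (c i) R) \<and> (\<forall>i<n. c i \<subset> c (Suc i)) \<and> c n = P}"

definition krull_dim :: "('a, 'b) ring_scheme \<Rightarrow> enat" where
  "krull_dim R = (SUP P \<in> {P. primeideal P R}. ideal_height R P)"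

section \<open>Regular sequences and depth\<close>

text \<open>Each \<open>x\<^sub>i\<close> is a nonzerodivisor modulo the ideal generated by the preceding elements, and
  the whole sequence generates a proper ideal. The empty sequence generates the zero ideal.\<close>

definition regular_sequence :: "('a, 'b) ring_scheme \<Rightarrow> 'a list \<Rightarrow> bool" where
  "regular_sequence R xs \<longleftrightarrow>
     set xs \<subseteq> carrier R \<and>
     (\<forall>i < length xs. \<forall>r \<in> carrier R.
        r \<otimes>\<^bsub>R\<^esub> xs ! i \<in> genideal R (set (take i xs)) \<longrightarrow> r \<in> genideal R (set (take i xs))) \<and>
     genideal R (set xs) \<noteq> carrier R"

text \<open>In the next three definitions \<open>m\<close> is meant to be the maximal ideal of the local ring \<open>R\<close>.\<close>

definition depth :: "('a, 'b) ring_scheme \<Rightarrow> 'a set \<Rightarrow> enat" where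
  "depth R m = Sup {enat (length xs) | xs. regular_sequence R xs \<and> set xs \<subseteq> m}"

definition cohen_macaulay_local_ring :: "('a, 'b) ring_scheme \<Rightarrow> 'a set \<Rightarrow> bool" where
  "cohen_macaulay_local_ring R m \<longleftrightarrow> noetherian_local_ring R m \<and> depth R m = krull_dim R"

definition regular_local_ring :: "('a, 'b) ring_scheme \<Rightarrow> 'a set \<Rightarrow> bool" where
  "regular_local_ring R m \<longleftrightarrow> noetherian_local_ring R m \<and>
     (\<exists>xs. set xs \<subseteq> carrier R \<and> genideal R (set xs) = m \<and> enat (length xs) = krull_dim R)"

section \<open>Localization\<close>

definition frac_rel :: "('a, 'b) ring_scheme \<Rightarrow> 'a set \<Rightarrow> (('a \<times> 'a) \<times> ('a \<times> 'a)) set" where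
  "frac_rel R S = {((a, s), (b, t)). a \<in> carrier R \<and> s \<in> S \<and> b \<in> carrier R \<and> t \<in> S \<and>
     (\<exists>u\<in>S. u \<otimes>\<^bsub>R\<^esub> (a \<otimes>\<^bsub>R\<^esub> t \<ominus>\<^bsub>R\<^esub> b \<otimes>\<^bsub>R\<^esub> s) = \<zero>\<^bsub>R\<^esub>)}"

definition frac_class :: "('a, 'b) ring_scheme \<Rightarrow> 'a set \<Rightarrow> 'a \<Rightarrow> 'a \<Rightarrow> ('a \<times> 'a) set" where
  "frac_class R S a s = frac_rel R S `` {(a, s)}"

text \<open>The ring of fractions of \<open>R\<close> with denominators in the multiplicative set \<open>S\<close>. As for
  \<^const>\<open>rcoset_mult\<close>, an operation on classes is the union of its values over all representatives,
  all of which are the same class.\<close>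

definition localization :: "('a, 'b) ring_scheme \<Rightarrow> 'a set \<Rightarrow> ('a \<times> 'a) set ring" where
  "localization R S =
     \<lparr>carrier = (carrier R \<times> S) // frac_rel R S,
      mult = (\<lambda>U V. \<Union>(a, s)\<in>U. \<Union>(b, t)\<in>V. frac_class R S (a \<otimes>\<^bsub>R\<^esub> b) (s \<otimes>\<^bsub>R\<^esub> t)),
      one = frac_class R S \<one>\<^bsub>R\<^esub> \<one>\<^bsub>R\<^esub>,
      zero = frac_class R S \<zero>\<^bsub>R\<^esub> \<one>\<^bsub>R\<^esub>,
      add = (\<lambda>U V. \<Union>(a, s)\<in>U. \<Union>(b, t)\<in>V.
               frac_class R S ((a \<otimes>\<^bsub>R\<^esub> t) \<oplus>\<^bsub>R\<^esub> (b \<otimes>\<^bsub>R\<^esub> s)) (s \<otimes>\<^bsub>R\<^esub> t))\<rparr>"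

definition local_at :: "('a, 'b) ring_scheme \<Rightarrow> 'a set \<Rightarrow> ('a \<times> 'a) set ring" where
  "local_at R P = localization R (carrier R - P)"

text \<open>The maximal ideal \<open>P R\<^sub>P\<close> of \<open>R\<^sub>P\<close>.\<close>

definition local_at_max :: "('a, 'b) ring_scheme \<Rightarrow> 'a set \<Rightarrow> ('a \<times> 'a) set set" where
  "local_at_max R P = {frac_class R (carrier R - P) a s | a s. a \<in> P \<and> s \<in> carrier R - P}"

section \<open>Serre's condition\<close>

text \<open>Serre's \<open>(S\<^sub>k)\<close> for the Noetherian ring \<open>A\<close>, as a module over itself.\<close>

definition serre_condition :: "('a, 'b) ring_scheme \<Rightarrow> nat \<Rightarrow> bool" where
  "serre_condition A k \<longleftrightarrow>
     (\<forall>P. primeideal P A \<longrightarrow>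
        min (enat k) (krull_dim (local_at A P)) \<le> depth (local_at A P) (local_at_max A P))"

section \<open>Colon ideals and the associated graded ring\<close>

definition colon_ideal :: "('a, 'b) ring_scheme \<Rightarrow> 'a set \<Rightarrow> 'a set \<Rightarrow> 'a set" where
  "colon_ideal R J K = {a \<in> carrier R. \<forall>b\<in>K. a \<otimes>\<^bsub>R\<^esub> b \<in> J}"

primrec ideal_power :: "('a, 'b) ring_scheme \<Rightarrow> 'a set \<Rightarrow> nat \<Rightarrow> 'a set" where
  "ideal_power R I 0 = carrier R"
| "ideal_power R I (Suc n) = ideal_prod R I (ideal_power R I n)"

text \<open>The subset \<open>I\<^sup>n / I\<^sup>n\<^sup>+\<^sup>1\<close> of \<open>R / I\<^sup>n\<^sup>+\<^sup>1\<close>.\<close>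

definition graded_piece :: "('a, 'b) ring_scheme \<Rightarrow> 'a set \<Rightarrow> nat \<Rightarrow> 'a set set" where
  "graded_piece R I n = {ideal_power R I (Suc n) +>\<^bsub>R\<^esub> a | a. a \<in> ideal_power R I n}"

text \<open>An element of \<open>G\<^sub>I(R)\<close> is the family \<open>f\<close> of its homogeneous components, finitely many of which
  are nonzero; the zero of \<open>I\<^sup>n / I\<^sup>n\<^sup>+\<^sup>1\<close> is the coset \<open>I\<^sup>n\<^sup>+\<^sup>1\<close>. The product of the classes of
  \<open>a \<in> I\<^sup>i\<close> and \<open>b \<in> I\<^sup>n\<^sup>-\<^sup>i\<close> is the class of \<open>a b\<close> modulo \<open>I\<^sup>n\<^sup>+\<^sup>1\<close>; since the two factors are cosets
  of larger ideals, \<^const>\<open>rcoset_mult\<close> is used here modulo \<open>I\<^sup>n\<^sup>+\<^sup>1\<close> on cosets of \<open>I\<^sup>i\<^sup>+\<^sup>1\<close>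
  and \<open>I\<^sup>n\<^sup>-\<^sup>i\<^sup>+\<^sup>1\<close>.\<close>

definition assoc_graded_ring :: "('a, 'b) ring_scheme \<Rightarrow> 'a set \<Rightarrow> (nat \<Rightarrow> 'a set) ring" where
  "assoc_graded_ring R I =
     \<lparr>carrier = {f. (\<forall>n. f n \<in> graded_piece R I n) \<and> finite {n. f n \<noteq> ideal_power R I (Suc n)}},
      mult = (\<lambda>f g n. finsum (R Quot (ideal_power R I (Suc n)))
               (\<lambda>i. rcoset_mult R (ideal_power R I (Suc n)) (f i) (g (n - i))) {..n}),
      one = (\<lambda>n. ideal_power R I (Suc n) +>\<^bsub>R\<^esub> (if n = 0 then \<one>\<^bsub>R\<^esub> else \<zero>\<^bsub>R\<^esub>)),
      zero = (\<lambda>n. ideal_power R I (Suc n)),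
      add = (\<lambda>f g n. f n <+>\<^bsub>R\<^esub> g n)\<rparr>"

end

theory Submission
  imports Defs "HOL-Algebra.Subrings" "HOL-Algebra.UnivPoly"
begin

text \<open>
  Since \<open>R\<^sub>p\<close> is not regular, \<open>p I = p J\<close>, and from this \<open>I\<^sup>2 = J I\<close>, that is, \<open>I\<^sup>n\<^sup>+\<^sup>1 = J\<^sup>n I\<close>. Hence
  \<open>G\<^sub>I(R)\<close> is a finite module over the polynomial ring \<open>B = (R/J)[T\<^sub>1,\<dots>,T\<^sub>g]\<close>, and it has a filtration
  with factors \<open>(R/I)[T]\<close> and a shift of \<open>(I/J)[T]\<close>. Both \<open>R/I\<close> and \<open>I/J\<close> embed into powers of the
  unmixed ring \<open>R/J\<close>, so the elements of \<open>B\<close> outside the minimal primes of \<open>B\<close> are nonzerodivisors on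
  \<open>G\<^sub>I(R)\<close>. By incomparability for the finite extension, a nonminimal prime of \<open>G\<^sub>I(R)\<close> contracts to a
  nonminimal prime of \<open>B\<close>.

  The polynomial ring is only used implicitly: that \<open>J\<close> is generated by a regular sequence enters through
  the two properties \<open>(J\<^sup>nK : A) \<inter> J\<^sup>n = J\<^sup>n(K : A)\<close> for ideals \<open>K \<supseteq> J\<close>, and that \<open>\<Oplus> J\<^sup>n/qJ\<^sup>n\<close> is a
  domain for primes \<open>q \<supseteq> J\<close>; both are proved by adjoining one generator at a time.
\<close>

text \<open>Nonregularity at \<open>p\<close> is used in the form that no \<open>g\<close> elements
  generate \<open>p\<close> locally. If a product a b with a in \<open>p\<close> and b in
  \<open>I\<close> were outside \<open>p J\<close>, it would locally belong to a minimal generating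
  set of \<open>J\<close>, and trading it for a would give \<open>g\<close> local generators of
  \<open>p\<close>. So p I lies in p J; for b, d in \<open>I\<close> the set p b d lies in (p J) d,
  hence in J^2, so b d is in J (J : p) = J I. Denominators at \<open>p\<close> are carried as an
  explicit factor \<open>r\<close> outside \<open>p\<close>.

  Primes of the graded ring need not be homogeneous, which dictates the nonzerodivisor: a constant
  when the degree-zero contraction contains a nonzerodivisor modulo \<open>J\<close>, and otherwise
  an element of the subring coming from \<open>J\<close>, found by incomparability. The latter is
  cancelled up to a constant outside the contraction, a unit in the localization concerned.

  Cohen-Macaulayness shows that associated primes of a regular sequence are minimal over it; this
  rests on the invariance of the length of regular sequences, obtained by exchanging
  elements.\<close>

lemma (in ring) idl_carr: "ideal I R \<Longrightarrow> a \<in> I \<Longrightarrow> a \<in> carrier R"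
  by (rule ideal.Icarr)

lemma (in ring) idl_sub: "ideal I R \<Longrightarrow> I \<subseteq> carrier R"
  by (simp add: additive_subgroup.a_subset ideal.axioms(1))

lemma (in ring) idl_zero: "ideal I R \<Longrightarrow> \<zero> \<in> I"
  by (simp add: additive_subgroup.zero_closed ideal.axioms(1))

lemma (in ring) idl_add: "ideal I R \<Longrightarrow> a \<in> I \<Longrightarrow> b \<in> I \<Longrightarrow> a \<oplus> b \<in> I"
  by (simp add: additive_subgroup.a_closed ideal.axioms(1))

lemma (in ring) idl_neg: "ideal I R \<Longrightarrow> a \<in> I \<Longrightarrow> \<ominus> a \<in> I"
  by (simp add: additive_subgroup.a_inv_closed ideal.axioms(1))

lemma (in ring) idl_minus: "ideal I R \<Longrightarrow> a \<in> I \<Longrightarrow> b \<in> I \<Longrightarrow> a \<ominus> b \<in> I"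
  by (simp add: a_minus_def idl_add idl_neg)

lemma (in ring) idl_l: "ideal I R \<Longrightarrow> a \<in> I \<Longrightarrow> r \<in> carrier R \<Longrightarrow> r \<otimes> a \<in> I"
  by (rule ideal.I_l_closed)

lemma (in ring) idl_r: "ideal I R \<Longrightarrow> a \<in> I \<Longrightarrow> r \<in> carrier R \<Longrightarrow> a \<otimes> r \<in> I"
  by (rule ideal.I_r_closed)

lemma (in ring) idl_add_cancel:
  assumes "ideal I R" "a \<in> I" "b \<in> carrier R" "a \<oplus> b \<in> I" shows "b \<in> I"
proof -
  have a: "a \<in> carrier R" using assms idl_carr by blast
  have "\<ominus> a \<oplus> (a \<oplus> b) \<in> I" using assms idl_add idl_neg by blast
  thus ?thesis using a assms(3) by (simp add: r_neg1)
qed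

lemma (in ring) idl_add_cancel':
  assumes "ideal I R" "b \<in> I" "a \<in> carrier R" "a \<oplus> b \<in> I" shows "a \<in> I"
  using idl_add_cancel[of I b a] assms by (metis a_comm idl_carr)

lemma (in ring) idl_minus_cancel:
  assumes "ideal I R" "a \<ominus> b \<in> I" "b \<in> I" "a \<in> carrier R" shows "a \<in> I"
proof -
  have b: "b \<in> carrier R" using assms idl_carr by blast
  have "a \<ominus> b \<oplus> b \<in> I" using assms idl_add by blast
  thus ?thesis using b assms(4) by (simp add: a_minus_def a_assoc l_neg)
qed

lemma (in cring) prime_multD:
  "primeideal P R \<Longrightarrow> a \<in> carrier R \<Longrightarrow> b \<in> carrier R \<Longrightarrow> a \<otimes> b \<in> P \<Longrightarrow> a \<in> P \<or> b \<in> P"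
  by (rule primeideal.I_prime)

lemma (in ring) prime_ideal: "primeideal P R \<Longrightarrow> ideal P R"
  by (simp add: primeideal_def)

lemma (in ring) prime_one: "primeideal P R \<Longrightarrow> \<one> \<notin> P"
  using primeideal.I_notcarr ideal.one_imp_carrier prime_ideal by metis

lemma (in cring) primeI:
  assumes "ideal P R" "\<one> \<notin> P"
    "\<And>a b. a \<in> carrier R \<Longrightarrow> b \<in> carrier R \<Longrightarrow> a \<otimes> b \<in> P \<Longrightarrow> a \<in> P \<or> b \<in> P"
  shows "primeideal P R"
  by (rule primeidealI[OF assms(1) is_cring]) (use assms in auto)

text \<open>Regular sequences are handled below as iterated \<open>adj\<close>, so that properties
  of the ideal they generate are proved by adjoining one generator.\<close>

definition (in ring) adj :: "'a set \<Rightarrow> 'a \<Rightarrow> 'a set" where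
  "adj K y = K <+> PIdl y"

lemma (in cring) mem_adj:
  "z \<in> adj K y \<longleftrightarrow> (\<exists>k\<in>K. \<exists>r\<in>carrier R. z = k \<oplus> r \<otimes> y)"
  unfolding adj_def set_add_def' cgenideal_def by blast

lemma (in cring) adjI: "k \<in> K \<Longrightarrow> r \<in> carrier R \<Longrightarrow> k \<oplus> r \<otimes> y \<in> adj K y"
  unfolding mem_adj by blast

lemma (in cring) adj_ideal: "ideal K R \<Longrightarrow> y \<in> carrier R \<Longrightarrow> ideal (adj K y) R"
  unfolding adj_def by (simp add: add_ideals cgenideal_ideal)

lemma (in cring) adj_supset: "ideal K R \<Longrightarrow> y \<in> carrier R \<Longrightarrow> K \<subseteq> adj K y"
proof
  fix k assume "ideal K R" "y \<in> carrier R" "k \<in> K"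
  thus "k \<in> adj K y" using adjI[of k K \<zero> y] idl_carr[of K k] by simp
qed

lemma (in cring) adj_mem: "ideal K R \<Longrightarrow> y \<in> carrier R \<Longrightarrow> y \<in> adj K y"
  using adjI[of \<zero> K \<one> y] idl_zero[of K] by simp

lemma (in cring) adj_least:
  "ideal L R \<Longrightarrow> K \<subseteq> L \<Longrightarrow> y \<in> L \<Longrightarrow> adj K y \<subseteq> L"
  unfolding mem_adj subset_iff by (auto intro!: idl_add idl_l)

lemma (in cring) adj_mono: "K \<subseteq> L \<Longrightarrow> adj K y \<subseteq> adj L y"
  unfolding mem_adj subset_iff by blast

lemma (in cring) adj_swap:
  assumes "ideal K R" "x \<in> carrier R" "y \<in> carrier R"
  shows "adj (adj K x) y = adj (adj K y) x"
proof -
  have *: "adj (adj K a) b \<subseteq> adj (adj K b) a" if "a \<in> carrier R" "b \<in> carrier R" for a b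
    using assms that adj_least adj_supset adj_mem adj_ideal adj_mono by (metis subset_iff)
  show ?thesis using *[of x y] *[of y x] assms by blast
qed

lemma (in cring) adj_eq_genideal:
  assumes "A \<subseteq> carrier R" "y \<in> carrier R"
  shows "adj (Idl A) y = Idl (insert y A)"
proof
  have 1: "ideal (Idl A) R" "ideal (Idl (insert y A)) R" using assms by (auto intro: genideal_ideal)
  show "adj (Idl A) y \<subseteq> Idl (insert y A)"
    using 1 assms adj_least genideal_self[of "insert y A"] genideal_minimal by (metis insert_subset)
  show "Idl (insert y A) \<subseteq> adj (Idl A) y"
    using adj_supset[OF 1(1) assms(2)] adj_mem[OF 1(1) assms(2)] adj_ideal[OF 1(1) assms(2)]
      genideal_self[OF assms(1)]
    by (intro genideal_minimal) auto
qed

lemma (in ring) Idl_empty: "Idl {} = {\<zero>}"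
proof
  show "Idl {} \<subseteq> {\<zero>}" using genideal_minimal[OF zeroideal] by simp
  show "{\<zero>} \<subseteq> Idl {}" using idl_zero genideal_ideal[of "{}"] by simp
qed

section \<open>Colon ideals\<close>

lemma (in cring) mem_colon:
  "a \<in> colon_ideal R K A \<longleftrightarrow> a \<in> carrier R \<and> (\<forall>b\<in>A. a \<otimes> b \<in> K)"
  by (simp add: colon_ideal_def)

lemma (in cring) colon_ideal_ideal:
  assumes "ideal K R" "A \<subseteq> carrier R" shows "ideal (colon_ideal R K A) R"
proof (rule idealI[OF ring_axioms])
  show "subgroup (colon_ideal R K A) (add_monoid R)"
  proof (rule add.subgroupI)
    show "colon_ideal R K A \<subseteq> carrier R" by (auto simp: mem_colon)
    have "\<zero> \<in> colon_ideal R K A" using assms idl_zero by (auto simp: mem_colon)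
    thus "colon_ideal R K A \<noteq> {}" by blast
  next
    fix a assume "a \<in> colon_ideal R K A"
    thus "\<ominus> a \<in> colon_ideal R K A" using assms by (auto simp: mem_colon l_minus subset_iff intro: idl_neg)
  next
    fix a b assume "a \<in> colon_ideal R K A" "b \<in> colon_ideal R K A"
    thus "a \<oplus> b \<in> colon_ideal R K A" using assms by (auto simp: mem_colon l_distr subset_iff intro: idl_add)
  qed
next
  fix a x assume "a \<in> colon_ideal R K A" "x \<in> carrier R"
  thus "x \<otimes> a \<in> colon_ideal R K A" using assms by (auto simp: mem_colon m_assoc subset_iff intro: idl_l)
next
  fix a x assume "a \<in> colon_ideal R K A" "x \<in> carrier R"
  moreover from this have "a \<otimes> x = x \<otimes> a" by (auto simp: mem_colon m_comm)
  ultimately show "a \<otimes> x \<in> colon_ideal R K A" using assms by (auto simp: mem_colon m_assoc subset_iff intro: idl_l)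
qed

lemma (in cring) colon_supset:
  assumes "ideal K R" "A \<subseteq> carrier R" shows "K \<subseteq> colon_ideal R K A"
  using assms idl_r idl_carr by (auto simp: mem_colon subset_iff)

section \<open>Noetherian rings\<close>

locale noetherian_cring = cring + noetherian_ring

context noetherian_cring begin

text \<open>In a Noetherian ring the union of a nonempty chain of ideals already belongs to the
  chain, so Zorn's lemma applies to any nonempty family of ideals.\<close>

lemma ideal_maximal:
  assumes "S \<noteq> {}" "\<And>I. I \<in> S \<Longrightarrow> ideal I R"
  obtains M where "M \<in> S" "\<And>I. I \<in> S \<Longrightarrow> M \<subseteq> I \<Longrightarrow> I = M"
proof -
  have "\<exists>M\<in>S. \<forall>X\<in>S. M \<subseteq> X \<longrightarrow> X = M"
  proof (rule subset_Zorn_nonempty[OF assms(1)])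
    fix C assume C: "C \<noteq> {}" "subset.chain S C"
    have "subset.chain {I. ideal I R} C"
      using C(2) assms(2) unfolding subset_chain_def by auto
    thus "\<Union>C \<in> S" using ideal_chain_is_trivial[OF C(1)] C(2) unfolding subset_chain_def by auto
  qed
  thus ?thesis using that by blast
qed

lemma ideal_noetherian_induct [consumes 1, case_names step]:
  assumes "ideal K R"
    and step: "\<And>K. ideal K R \<Longrightarrow> (\<And>K'. ideal K' R \<Longrightarrow> K \<subset> K' \<Longrightarrow> P K') \<Longrightarrow> P K"
  shows "P K"
proof (rule ccontr)
  assume "\<not> P K"
  hence "{K. ideal K R \<and> \<not> P K} \<noteq> {}" using assms(1) by blast
  then obtain M where M: "M \<in> {K. ideal K R \<and> \<not> P K}"
    "\<And>I. I \<in> {K. ideal K R \<and> \<not> P K} \<Longrightarrow> M \<subseteq> I \<Longrightarrow> I = M"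
    using ideal_maximal by (metis (mono_tags, lifting) mem_Collect_eq)
  show False using step[of M] M by blast
qed

text \<open>A maximal member among the annihilators of nonzero elements of R/K is prime. Restricting
  the family to those above \<open>K : w\<close> enlarges a given annihilator to an associated
  prime.\<close>

lemma exists_colon_prime:
  assumes K: "ideal K R" and w: "w \<in> carrier R" "w \<notin> K"
  obtains c where "c \<in> carrier R" "primeideal (colon_ideal R K {c}) R"
    "colon_ideal R K {w} \<subseteq> colon_ideal R K {c}"
proof -
  define S where "S = {colon_ideal R K {c} | c. c \<in> carrier R - K \<and> colon_ideal R K {w} \<subseteq> colon_ideal R K {c}}"
  have 1: "S \<noteq> {}" using w by (auto simp: S_def)
  have 2: "ideal I R" if "I \<in> S" for I using that K colon_ideal_ideal by (auto simp: S_def)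
  obtain M where M: "M \<in> S" "\<And>I. I \<in> S \<Longrightarrow> M \<subseteq> I \<Longrightarrow> I = M"
    using ideal_maximal[OF 1 2] by blast
  then obtain c where c: "c \<in> carrier R" "c \<notin> K" "M = colon_ideal R K {c}"
    "colon_ideal R K {w} \<subseteq> colon_ideal R K {c}" by (auto simp: S_def)
  have "primeideal (colon_ideal R K {c}) R"
  proof (rule primeI)
    show "ideal (colon_ideal R K {c}) R" using c K colon_ideal_ideal by simp
    show "\<one> \<notin> colon_ideal R K {c}" using c by (simp add: mem_colon)
    fix a b assume ab: "a \<in> carrier R" "b \<in> carrier R" "a \<otimes> b \<in> colon_ideal R K {c}"
    show "a \<in> colon_ideal R K {c} \<or> b \<in> colon_ideal R K {c}"
    proof (rule disjCI)
      assume "b \<notin> colon_ideal R K {c}"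
      hence nb: "b \<otimes> c \<notin> K" using ab by (simp add: mem_colon)
      have sub: "colon_ideal R K {c} \<subseteq> colon_ideal R K {b \<otimes> c}"
      proof
        fix r assume r: "r \<in> colon_ideal R K {c}"
        hence "b \<otimes> (r \<otimes> c) \<in> K" using K ab idl_l by (auto simp: mem_colon)
        moreover have "b \<otimes> (r \<otimes> c) = r \<otimes> (b \<otimes> c)" using r ab c by (auto simp: mem_colon m_lcomm)
        ultimately show "r \<in> colon_ideal R K {b \<otimes> c}" using r by (simp add: mem_colon)
      qed
      \<comment> \<open>As \<open>b c\<close> is nonzero modulo \<open>K\<close>, its larger
        annihilator competes in the family and so equals that of \<open>c\<close>; this turns
        \<open>a b c\<close> in \<open>K\<close> into \<open>a c\<close> in
        \<open>K\<close>.\<close>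
      have "b \<otimes> c \<in> carrier R - K" using nb c(1) ab by simp
      hence "colon_ideal R K {b \<otimes> c} \<in> S" unfolding S_def using c(4) sub by blast
      hence "colon_ideal R K {b \<otimes> c} = colon_ideal R K {c}" using M(2) sub unfolding c(3) by blast
      moreover have "a \<in> colon_ideal R K {b \<otimes> c}" using ab c by (simp add: mem_colon m_assoc)
      ultimately show "a \<in> colon_ideal R K {c}" by simp
    qed
  qed
  thus ?thesis using c that by blast
qed

end

section \<open>Associated primes of R/K and nonzerodivisors modulo K\<close>

definition (in cring) assoc_prime :: "'a set \<Rightarrow> 'a set \<Rightarrow> bool" where
  "assoc_prime K Q \<longleftrightarrow> primeideal Q R \<and> (\<exists>c\<in>carrier R. Q = colon_ideal R K {c})"

definition (in cring) nzd :: "'a set \<Rightarrow> 'a \<Rightarrow> bool" where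
  "nzd K x \<longleftrightarrow> x \<in> carrier R \<and> (\<forall>r\<in>carrier R. r \<otimes> x \<in> K \<longrightarrow> r \<in> K)"

lemma (in cring) nzdD: "nzd K x \<Longrightarrow> r \<in> carrier R \<Longrightarrow> r \<otimes> x \<in> K \<Longrightarrow> r \<in> K"
  by (simp add: nzd_def)

lemma (in cring) nzdD': "nzd K x \<Longrightarrow> r \<in> carrier R \<Longrightarrow> x \<otimes> r \<in> K \<Longrightarrow> r \<in> K"
  by (simp add: nzd_def m_comm)

lemma (in cring) assoc_prime_not_nzd:
  assumes "assoc_prime K Q" "nzd K x" shows "x \<notin> Q"
proof
  assume x: "x \<in> Q"
  obtain c where c: "c \<in> carrier R" "Q = colon_ideal R K {c}" "primeideal Q R"
    using assms by (auto simp: assoc_prime_def)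
  have "c \<in> K" using x c assms(2) by (auto simp: mem_colon intro: nzdD')
  hence "\<one> \<in> Q" using c by (simp add: mem_colon)
  thus False using c prime_one by blast
qed

context noetherian_cring begin

lemma zero_divisor_assoc:
  assumes "ideal K R" "x \<in> carrier R" "\<not> nzd K x"
  obtains Q where "assoc_prime K Q" "x \<in> Q"
proof -
  obtain r where r: "r \<in> carrier R" "r \<otimes> x \<in> K" "r \<notin> K" using assms by (auto simp: nzd_def)
  obtain c where c: "c \<in> carrier R" "primeideal (colon_ideal R K {c}) R"
    "colon_ideal R K {r} \<subseteq> colon_ideal R K {c}" using exists_colon_prime[OF assms(1) r(1,3)] by blast
  have "x \<in> colon_ideal R K {r}" using r assms by (simp add: mem_colon m_comm)
  thus ?thesis using that[of "colon_ideal R K {c}"] c by (auto simp: assoc_prime_def)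
qed

text \<open>If \<open>Q\<close> is the annihilator of \<open>c\<close> modulo \<open>K\<close>, then
  \<open>c\<close> generates a copy of R/Q in R/K, whose only associated prime is \<open>Q\<close>;
  all others already occur modulo the larger ideal \<open>adj K c\<close>.\<close>

lemma finite_assoc_primes:
  assumes "ideal K R" shows "finite {Q. assoc_prime K Q}"
  using assms
proof (induction rule: ideal_noetherian_induct)
  case (step K)
  show ?case
  proof (cases "{Q. assoc_prime K Q} = {}")
    case True thus ?thesis by (metis finite.emptyI)
  next
    case False
    then obtain Q c where Q: "primeideal Q R" "c \<in> carrier R" "Q = colon_ideal R K {c}"
      by (auto simp: assoc_prime_def)
    let ?K = "adj K c"
    have cK: "c \<notin> K" using prime_one[OF Q(1)] Q by (auto simp: mem_colon)
    have K': "ideal ?K R" using step Q adj_ideal by blast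
    have "K \<subset> ?K" using cK adj_mem adj_supset step(1) Q(2) by blast
    hence fin: "finite {Q. assoc_prime ?K Q}" using step K' by blast
    have "{Q. assoc_prime K Q} \<subseteq> insert Q {Q. assoc_prime ?K Q}"
    proof
      fix Q' assume "Q' \<in> {Q. assoc_prime K Q}"
      then obtain d where d: "primeideal Q' R" "d \<in> carrier R" "Q' = colon_ideal R K {d}"
        by (auto simp: assoc_prime_def)
      show "Q' \<in> insert Q {Q. assoc_prime ?K Q}"
      \<comment> \<open>The question is whether the cyclic modules of \<open>d\<close> and
        \<open>c\<close> meet nontrivially modulo \<open>K\<close>. If they do not, the annihilator
        of \<open>d\<close> stays the same modulo \<open>?K\<close>.\<close>
      proof (cases "\<exists>r\<in>carrier R. r \<otimes> d \<in> ?K \<and> r \<otimes> d \<notin> K")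
        case True
        then obtain r where r: "r \<in> carrier R" "r \<otimes> d \<in> ?K" "r \<otimes> d \<notin> K" by blast
        then obtain k s where ks: "k \<in> K" "s \<in> carrier R" "r \<otimes> d = k \<oplus> s \<otimes> c" by (auto simp: mem_adj)
        have kc: "k \<in> carrier R" using ks step idl_carr by blast
        have sc: "s \<otimes> c \<notin> K" using r ks step(1) idl_add by metis
        \<comment> \<open>An element with prime annihilator shares it with each of its nonzero
          multiples. The common nonzero multiple of \<open>c\<close> and \<open>d\<close> then
          identifies \<open>Q\<close> with \<open>Q'\<close>.\<close>
        have aux: "u \<in> colon_ideal R K {e} \<longleftrightarrow> u \<in> carrier R \<and> u \<otimes> (t \<otimes> e) \<in> K"
          if e: "e \<in> carrier R" "t \<in> carrier R" "t \<otimes> e \<notin> K" "primeideal (colon_ideal R K {e}) R" for u t e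
        proof
          assume "u \<in> colon_ideal R K {e}"
          hence "u \<in> carrier R" "t \<otimes> (u \<otimes> e) \<in> K" using e step(1) idl_l by (auto simp: mem_colon)
          thus "u \<in> carrier R \<and> u \<otimes> (t \<otimes> e) \<in> K" using e by (simp add: m_lcomm)
        next
          assume u: "u \<in> carrier R \<and> u \<otimes> (t \<otimes> e) \<in> K"
          hence "u \<otimes> t \<in> colon_ideal R K {e}" using e by (simp add: mem_colon m_assoc)
          moreover have "t \<notin> colon_ideal R K {e}" using e by (simp add: mem_colon)
          ultimately show "u \<in> colon_ideal R K {e}" using prime_multD e u by blast
        qed
        have "u \<in> Q' \<longleftrightarrow> u \<in> Q" for u
        proof -
          have "u \<in> Q' \<longleftrightarrow> u \<in> carrier R \<and> u \<otimes> (r \<otimes> d) \<in> K" using aux[of d r u] d r by simp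
          also have "\<dots> \<longleftrightarrow> u \<in> carrier R \<and> u \<otimes> (s \<otimes> c) \<in> K"
          proof (rule conj_cong[OF refl])
            assume u: "u \<in> carrier R"
            have e: "u \<otimes> (r \<otimes> d) = u \<otimes> k \<oplus> u \<otimes> (s \<otimes> c)" using u ks kc Q by (simp add: r_distr)
            have "u \<otimes> k \<in> K" using ks u step(1) idl_l by blast
            thus "(u \<otimes> (r \<otimes> d) \<in> K) = (u \<otimes> (s \<otimes> c) \<in> K)"
              unfolding e using step(1) idl_add idl_add_cancel[of K "u \<otimes> k" "u \<otimes> (s \<otimes> c)"] u ks Q by auto
          qed
          also have "\<dots> \<longleftrightarrow> u \<in> Q" using aux[of c s u] Q ks sc by simp
          finally show ?thesis .
        qed
        thus ?thesis by blast
      next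
        case False
        have "colon_ideal R ?K {d} = Q'"
          using False d adj_supset[OF step(1) Q(2)] by (auto simp: mem_colon)
        thus ?thesis using d by (auto simp: assoc_prime_def)
      qed
    qed
    thus ?thesis using fin finite_subset by (metis finite.insertI)
  qed
qed

end

section \<open>Prime avoidance\<close>

context cring begin

lemma prod_outside_prime:
  assumes Q: "primeideal Q R" and x: "ideal A R" "x \<in> A" "x \<notin> Q"
    and F: "finite F" "\<And>P. P \<in> F \<Longrightarrow> primeideal P R \<and> \<not> P \<subseteq> Q"
  shows "\<exists>y\<in>A. y \<notin> Q \<and> (\<forall>P\<in>F. y \<in> P)"
  using F
proof (induction F)
  case empty thus ?case using x by auto
next
  case (insert P F)
  then obtain y where y: "y \<in> A" "y \<notin> Q" "\<forall>P\<in>F. y \<in> P" by auto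
  obtain z where z: "z \<in> P" "z \<notin> Q" using insert by blast
  have P: "primeideal P R" using insert by blast
  have c: "z \<in> carrier R" "y \<in> carrier R" using idl_carr[OF prime_ideal[OF P] z(1)] idl_carr[OF x(1) y(1)] .
  have "z \<otimes> y \<in> A" by (rule idl_l[OF x(1) y(1) c(1)])
  moreover have "z \<otimes> y \<notin> Q" using prime_multD[OF Q c] y z by blast
  moreover have "z \<otimes> y \<in> P" by (rule idl_r[OF prime_ideal[OF P] z(1) c(2)])
  moreover have "z \<otimes> y \<in> P'" if "P' \<in> F" for P'
    using that y(3) c(1) insert.prems prime_ideal by (intro idl_l) auto
  ultimately show ?case by auto
qed

lemma prime_avoidance:
  assumes "finite F" "\<And>P. P \<in> F \<Longrightarrow> primeideal P R" "ideal A R" "\<And>P. P \<in> F \<Longrightarrow> \<not> A \<subseteq> P"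
  shows "\<exists>a\<in>A. \<forall>P\<in>F. a \<notin> P"
  using assms(1,2,4)
proof (induction "card F" arbitrary: F rule: less_induct)
  case less
  show ?case
  proof (cases "\<exists>P\<in>F. \<exists>Q\<in>F. P \<noteq> Q \<and> P \<subseteq> Q")
    case True
    then obtain P Q where PQ: "P \<in> F" "Q \<in> F" "P \<noteq> Q" "P \<subseteq> Q" by blast
    have "card (F - {P}) < card F" using PQ(1) less.prems(1) by (rule card_Diff1_less[rotated])
    then obtain a where "a \<in> A" "\<forall>Q\<in>F-{P}. a \<notin> Q" using less.hyps[of "F - {P}"] less.prems by auto
    hence "a \<notin> Q'" if "Q' \<in> F" for Q' using that PQ by (cases "Q' = P") auto
    thus ?thesis using \<open>a \<in> A\<close> by blast
  next
    case False
    show ?thesis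
    proof (cases "F = {}")
      case True thus ?thesis using idl_zero[OF assms(3)] by blast
    next
      case False2: False
      then obtain Q where Q: "Q \<in> F" by blast
      have "card (F - {Q}) < card F" using Q less.prems(1) by (rule card_Diff1_less[rotated])
      then obtain a where a: "a \<in> A" "\<forall>P\<in>F-{Q}. a \<notin> P" using less.hyps[of "F - {Q}"] less.prems by auto
      show ?thesis
      proof (cases "a \<in> Q")
        case False thus ?thesis using a by blast
      next
        case aQ: True
        \<comment> \<open>Here \<open>a\<close> avoids every prime but \<open>Q\<close>.
          Incomparability provides \<open>y\<close> in \<open>A\<close> outside \<open>Q\<close> and
          inside all the others, so \<open>a + y\<close> avoids all of them.\<close>
        obtain x where x: "x \<in> A" "x \<notin> Q" using less.prems(3)[OF Q] by blast
        have pp: "primeideal P R \<and> \<not> P \<subseteq> Q" if "P \<in> F - {Q}" for P using that less.prems(2) False Q by blast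
        have fin: "finite (F - {Q})" using less.prems(1) by simp
        obtain y where y: "y \<in> A" "y \<notin> Q" "\<forall>P\<in>F-{Q}. y \<in> P"
          using prod_outside_prime[OF less.prems(2)[OF Q] assms(3) x fin pp] by blast
        have c: "a \<in> carrier R" "y \<in> carrier R" using a y assms(3) idl_carr by auto
        have "a \<oplus> y \<notin> P" if P: "P \<in> F" for P
        proof (cases "P = Q")
          case True thus ?thesis using aQ y c idl_add_cancel[OF prime_ideal[OF less.prems(2)[OF P]], of a y] by blast
        next
          case False thus ?thesis
            using a y c P idl_add_cancel'[OF prime_ideal[OF less.prems(2)[OF P]], of y a] by blast
        qed
        thus ?thesis using a y assms(3) idl_add by blast
      qed
    qed
  qed
qed

end

context noetherian_cring begin

text \<open>The zero divisors modulo \<open>K\<close> are covered by the finitely many associated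
  primes, so prime avoidance puts the whole ideal into one of them.\<close>

lemma zero_divisors_in_assoc:
  assumes "ideal K R" "ideal A R" "\<And>a. a \<in> A \<Longrightarrow> \<not> nzd K a"
  obtains Q where "assoc_prime K Q" "A \<subseteq> Q"
proof (rule ccontr)
  assume "\<not> thesis"
  hence "\<exists>a\<in>A. \<forall>P\<in>{Q. assoc_prime K Q}. a \<notin> P"
    using that assms finite_assoc_primes by (intro prime_avoidance) (auto simp: assoc_prime_def)
  thus False using assms zero_divisor_assoc idl_carr by (metis mem_Collect_eq)
qed

text \<open>The associated primes of all members of \<open>F\<close> are avoided at once; the
  resulting element can be compared with several quotients simultaneously.\<close>

lemma common_nzd:
  assumes "finite F" "\<And>K. K \<in> F \<Longrightarrow> ideal K R" "ideal A R" "\<And>K. K \<in> F \<Longrightarrow> \<exists>a\<in>A. nzd K a"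
  shows "\<exists>a\<in>A. \<forall>K\<in>F. nzd K a"
proof -
  let ?F = "\<Union>K\<in>F. {Q. assoc_prime K Q}"
  have "\<exists>a\<in>A. \<forall>P\<in>?F. a \<notin> P"
  proof (rule prime_avoidance)
    show "finite ?F" using assms finite_assoc_primes by blast
    show "primeideal P R" if "P \<in> ?F" for P using that by (auto simp: assoc_prime_def)
    show "ideal A R" by fact
    show "\<not> A \<subseteq> P" if "P \<in> ?F" for P using that assms(4) assoc_prime_not_nzd by blast
  qed
  then obtain a where a: "a \<in> A" "\<forall>P\<in>?F. a \<notin> P" by blast
  have "nzd K a" if "K \<in> F" for K
    using that a zero_divisor_assoc assms(2,3) idl_carr by (metis UN_I mem_Collect_eq)
  thus ?thesis using a by blast
qed

end

section \<open>Depth and dimension\<close>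

text \<open>The half of the exchange of neighbours in a regular sequence that holds in every
  commutative ring: in \<open>r y = k + s z\<close> the element \<open>s\<close> is a multiple of
  \<open>y\<close> modulo \<open>K\<close>, and cancelling \<open>y\<close> leaves \<open>r\<close>
  a multiple of \<open>z\<close>.\<close>

lemma (in cring) nzd_adj_swap:
  assumes K: "ideal K R" and y: "nzd K y" and z: "nzd (adj K y) z"
  shows "nzd (adj K z) y"
proof -
  have c: "y \<in> carrier R" "z \<in> carrier R" using y z by (auto simp: nzd_def)
  have "r \<in> adj K z" if r: "r \<in> carrier R" "r \<otimes> y \<in> adj K z" for r
  proof -
    obtain k s where ks: "k \<in> K" "s \<in> carrier R" "r \<otimes> y = k \<oplus> s \<otimes> z" using r by (auto simp: mem_adj)
    have kc: "k \<in> carrier R" using ks K idl_carr by blast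
    have "s \<otimes> z = \<ominus> k \<oplus> r \<otimes> y" using ks c kc r by (simp add: r_neg1)
    hence "s \<otimes> z \<in> adj K y" using adjI[of "\<ominus> k" K r y] ks r K idl_neg by simp
    hence "s \<in> adj K y" using z ks by (auto intro: nzdD)
    then obtain k' t where kt: "k' \<in> K" "t \<in> carrier R" "s = k' \<oplus> t \<otimes> y" by (auto simp: mem_adj)
    have kc': "k' \<in> carrier R" using kt K idl_carr by blast
    have "(r \<ominus> t \<otimes> z) \<otimes> y = r \<otimes> y \<ominus> t \<otimes> z \<otimes> y" using r kt c by algebra
    also have "\<dots> = k \<oplus> z \<otimes> k'" unfolding ks(3) kt(3) using c kt(2) kc kc' by algebra
    also have "\<dots> \<in> K" using K ks kt c idl_add idl_l by blast
    finally have "r \<ominus> t \<otimes> z \<in> K" using y r kt c by (auto intro: nzdD)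
    hence "(r \<ominus> t \<otimes> z) \<oplus> t \<otimes> z \<in> adj K z" using kt adjI by blast
    moreover have "(r \<ominus> t \<otimes> z) \<oplus> t \<otimes> z = r" using r kt c by algebra
    ultimately show ?thesis by simp
  qed
  thus ?thesis using c by (simp add: nzd_def)
qed

text \<open>Krull's lemma: take an ideal maximal among those above \<open>K\<close> that miss
  \<open>T\<close>. Enlarging it by either of two elements outside produces members of
  \<open>T\<close>, whose product would lie in the ideal if the product of the two elements
  did.\<close>

lemma (in noetherian_cring) exists_prime_avoiding:
  assumes K: "ideal K R" and T: "T \<subseteq> carrier R" "\<one> \<in> T" "\<And>a b. a \<in> T \<Longrightarrow> b \<in> T \<Longrightarrow> a \<otimes> b \<in> T" "K \<inter> T = {}"
  obtains P where "primeideal P R" "K \<subseteq> P" "P \<inter> T = {}"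
proof -
  define S where "S = {L. ideal L R \<and> K \<subseteq> L \<and> L \<inter> T = {}}"
  have 1: "S \<noteq> {}" using K T by (auto simp: S_def)
  have 2: "ideal I R" if "I \<in> S" for I using that by (auto simp: S_def)
  obtain M where M: "M \<in> S" "\<And>I. I \<in> S \<Longrightarrow> M \<subseteq> I \<Longrightarrow> I = M"
    using ideal_maximal[OF 1 2] by blast
  have Mi: "ideal M R" "K \<subseteq> M" "M \<inter> T = {}" using M by (auto simp: S_def)
  have *: "\<exists>r\<in>carrier R. \<exists>k\<in>M. k \<oplus> r \<otimes> a \<in> T" if a: "a \<in> carrier R" "a \<notin> M" for a
  proof -
    have "adj M a \<notin> S" using M(2)[of "adj M a"] adj_supset[OF Mi(1) a(1)] adj_mem[OF Mi(1) a(1)] a by blast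
    moreover have "K \<subseteq> adj M a" using adj_supset[OF Mi(1) a(1)] Mi by blast
    ultimately have "adj M a \<inter> T \<noteq> {}" using adj_ideal[OF Mi(1) a(1)] by (auto simp: S_def)
    thus ?thesis by (auto simp: mem_adj)
  qed
  have "primeideal M R"
  proof (rule primeI[OF Mi(1)])
    show "\<one> \<notin> M" using Mi T by blast
    fix a b assume ab: "a \<in> carrier R" "b \<in> carrier R" "a \<otimes> b \<in> M"
    show "a \<in> M \<or> b \<in> M"
    proof (rule ccontr)
      assume "\<not> (a \<in> M \<or> b \<in> M)"
      then obtain r k s l where rs: "r \<in> carrier R" "k \<in> M" "k \<oplus> r \<otimes> a \<in> T" "s \<in> carrier R" "l \<in> M" "l \<oplus> s \<otimes> b \<in> T"
        using *[of a] *[of b] ab by blast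
      have c: "k \<in> carrier R" "l \<in> carrier R" using rs Mi idl_carr by blast+
      have "(k \<oplus> r \<otimes> a) \<otimes> (l \<oplus> s \<otimes> b) = (l \<oplus> s \<otimes> b) \<otimes> k \<oplus> ((r \<otimes> a) \<otimes> l \<oplus> (r \<otimes> s) \<otimes> (a \<otimes> b))"
        using rs c ab(1,2) by algebra
      also have "\<dots> \<in> M"
        by (rule idl_add[OF Mi(1) idl_l[OF Mi(1)] idl_add[OF Mi(1) idl_l[OF Mi(1)] idl_l[OF Mi(1)]]])
          (use rs c ab in auto)
      finally show False using T rs Mi by blast
    qed
  qed
  thus ?thesis using that Mi by blast
qed

text \<open>A nonzerodivisor modulo \<open>K\<close> lies in no minimal prime over \<open>K\<close>;
  its powers, too, can be cancelled modulo \<open>K\<close>, which keeps \<open>K\<close> away from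
  the multiplicative set used here.\<close>

lemma (in noetherian_cring) prime_below_nzd:
  assumes K: "ideal K R" and x: "nzd K x" and Q: "primeideal Q R" "K \<subseteq> Q" "x \<in> Q"
  obtains Q' where "primeideal Q' R" "K \<subseteq> Q'" "Q' \<subset> Q"
proof -
  have xc: "x \<in> carrier R" using x by (simp add: nzd_def)
  have *: "s \<in> K" if "s \<otimes> x [^] (n::nat) \<in> K" "s \<in> carrier R" for s n
    using that
  proof (induction n)
    case (Suc n)
    have "s \<otimes> x [^] n \<otimes> x \<in> K" using Suc.prems xc by (simp add: m_assoc)
    thus ?case using Suc nzdD[OF x, of "s \<otimes> x [^] n"] xc by simp
  qed simp
  \<comment> \<open>\<open>T\<close> contains the complement of \<open>Q\<close>, which forces the
    new prime into \<open>Q\<close>, and \<open>x\<close> itself, which makes the inclusion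
    strict.\<close>
  define T where "T = {s \<otimes> x [^] (n::nat) | s n. s \<in> carrier R - Q}"
  have one: "\<one> \<in> carrier R - Q" using prime_one[OF Q(1)] by simp
  obtain P where P: "primeideal P R" "K \<subseteq> P" "P \<inter> T = {}"
  proof (rule exists_prime_avoiding[OF K, of T])
    show "T \<subseteq> carrier R" using xc by (auto simp: T_def)
    have "\<one> \<otimes> x [^] (0::nat) \<in> T" unfolding T_def using one by blast
    thus "\<one> \<in> T" by simp
    show "K \<inter> T = {}" using * Q(2) by (auto simp: T_def)
    fix a b assume "a \<in> T" "b \<in> T"
    then obtain s t n k where st: "s \<in> carrier R - Q" "t \<in> carrier R - Q" "a = s \<otimes> x [^] (n::nat)" "b = t \<otimes> x [^] (k::nat)"
      by (auto simp: T_def)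
    have "a \<otimes> b = (s \<otimes> t) \<otimes> (x [^] n \<otimes> x [^] k)" using st xc by (simp add: m_assoc m_lcomm)
    also have "\<dots> = (s \<otimes> t) \<otimes> x [^] (n + k)" using xc by (simp add: nat_pow_mult)
    also have "\<dots> \<in> T" unfolding T_def using st prime_multD[OF Q(1)] by blast
    finally show "a \<otimes> b \<in> T" .
  qed
  have "P \<subseteq> Q"
  proof
    fix s assume s: "s \<in> P"
    have sc: "s \<in> carrier R" using s P prime_ideal idl_carr by blast
    show "s \<in> Q"
    proof (rule ccontr)
      assume "s \<notin> Q"
      hence "s \<otimes> x [^] (0::nat) \<in> T" using sc unfolding T_def by blast
      thus False using sc s P by auto
    qed
  qed
  moreover have "x \<notin> P"
  proof
    assume "x \<in> P"
    moreover have "\<one> \<otimes> x [^] (1::nat) \<in> T" unfolding T_def using one by blast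
    ultimately show False using xc P by auto
  qed
  ultimately show ?thesis using that P Q by blast
qed

section \<open>Local rings: regular sequences in the maximal ideal\<close>

locale noetherian_local = noetherian_cring +
  fixes m
  assumes max_m: "maximalideal m R" and max_unique: "\<And>n. maximalideal n R \<Longrightarrow> n = m"

context noetherian_local begin

lemma m_ideal: "ideal m R" using max_m by (simp add: maximalideal_def)

lemma m_one: "\<one> \<notin> m"
  using maximalideal.I_notcarr[OF max_m] ideal.one_imp_carrier[OF m_ideal] by blast

lemma proper_in_m:
  assumes K: "ideal K R" "\<one> \<notin> K" shows "K \<subseteq> m"
proof -
  define S where "S = {L. ideal L R \<and> K \<subseteq> L \<and> \<one> \<notin> L}"
  have 1: "S \<noteq> {}" using K by (auto simp: S_def)
  have 2: "ideal I R" if "I \<in> S" for I using that by (auto simp: S_def)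
  obtain M where M: "M \<in> S" "\<And>I. I \<in> S \<Longrightarrow> M \<subseteq> I \<Longrightarrow> I = M"
    using ideal_maximal[OF 1 2] by blast
  have Mi: "ideal M R" "K \<subseteq> M" "\<one> \<notin> M" using M by (auto simp: S_def)
  have "maximalideal M R"
  proof (rule maximalidealI[OF Mi(1)])
    show "carrier R \<noteq> M" using Mi one_closed by blast
    fix L assume L: "ideal L R" "M \<subseteq> L" "L \<subseteq> carrier R"
    show "L = M \<or> L = carrier R"
    proof (cases "\<one> \<in> L")
      case True thus ?thesis using ideal.one_imp_carrier[OF L(1)] by blast
    next
      case False
      hence "L \<in> S" using L Mi by (auto simp: S_def)
      thus ?thesis using M(2) L by blast
    qed
  qed
  thus ?thesis using max_unique Mi by blast
qed

lemma unit_outside_m: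
  assumes "a \<in> carrier R" "a \<notin> m" obtains b where "b \<in> carrier R" "b \<otimes> a = \<one>"
proof -
  have "\<not> PIdl a \<subseteq> m" using assms cgenideal_self by blast
  hence "\<one> \<in> PIdl a" using proper_in_m cgenideal_ideal assms by blast
  then obtain b where "b \<in> carrier R" "\<one> = b \<otimes> a" unfolding cgenideal_def by blast
  thus ?thesis using that by simp
qed

text \<open>The element \<open>\<one> \<ominus> a\<close> is a unit; its cancellation takes the
  place of Nakayama's lemma.\<close>

lemma one_minus_cancel:
  assumes "ideal K R" "a \<in> m" "s \<in> carrier R" "s \<otimes> (\<one> \<ominus> a) \<in> K" shows "s \<in> K"
proof -
  have ac: "a \<in> carrier R" using assms m_ideal idl_carr by blast
  have "\<one> \<ominus> a \<notin> m" using m_one idl_minus_cancel[OF m_ideal _ assms(2)] by blast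
  then obtain b where b: "b \<in> carrier R" "b \<otimes> (\<one> \<ominus> a) = \<one>" using unit_outside_m[of "\<one> \<ominus> a"] ac by auto
  have "b \<otimes> (s \<otimes> (\<one> \<ominus> a)) \<in> K" using assms b idl_l by blast
  moreover have "b \<otimes> (s \<otimes> (\<one> \<ominus> a)) = s \<otimes> (b \<otimes> (\<one> \<ominus> a))" using assms ac b(1) by (intro m_lcomm) auto
  ultimately show ?thesis using b assms by simp
qed

text \<open>For \<open>K\<close> inside \<open>m\<close> this says that the depth of R/K is at least
  \<open>n\<close>. The sequence itself is forgotten, so that its first element can be
  exchanged.\<close>

primrec has_reg :: "nat \<Rightarrow> 'a set \<Rightarrow> bool" where
  "has_reg 0 K = True"
| "has_reg (Suc n) K = (\<exists>y\<in>m. nzd K y \<and> has_reg n (adj K y))"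

lemma has_reg_Suc: "has_reg (Suc n) K \<Longrightarrow> has_reg n K"
  by (induction n arbitrary: K) auto

lemma has_reg_mono: "has_reg n K \<Longrightarrow> k \<le> n \<Longrightarrow> has_reg k K"
proof (induction n)
  case (Suc n) thus ?case using has_reg_Suc le_Suc_eq by blast
qed simp

text \<open>Multiplication by \<open>y / x\<close> carries elements of R/(K,x) killed by
  \<open>m\<close> to such elements of R/(K,y); both describe the first Ext of the residue field
  into R/K. If no \<open>z\<close> were regular for \<open>x\<close>, a nonzero element for
  \<open>y\<close> killed by the given \<open>z\<close> would result.\<close>

lemma exchange_one:
  assumes K: "ideal K R" and x: "x \<in> m" "nzd K x" and y: "y \<in> m" "nzd K y"
    and z: "z \<in> m" "nzd (adj K y) z"
  shows "\<exists>z\<in>m. nzd (adj K x) z"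
proof (rule ccontr)
  assume neg: "\<not> ?thesis"
  have c: "x \<in> carrier R" "y \<in> carrier R" "z \<in> carrier R" using x y z m_ideal idl_carr by blast+
  have Kx: "ideal (adj K x) R" using K c adj_ideal by blast
  obtain Q where Q: "assoc_prime (adj K x) Q" "m \<subseteq> Q"
    using zero_divisors_in_assoc[OF Kx m_ideal] neg by blast
  then obtain u where u: "u \<in> carrier R" "Q = colon_ideal R (adj K x) {u}" "primeideal Q R" by (auto simp: assoc_prime_def)
  have nu: "u \<notin> adj K x" using u prime_one[OF u(3)] by (auto simp: mem_colon)
  have mu: "a \<otimes> u \<in> adj K x" if "a \<in> m" for a using that Q u by (auto simp: mem_colon)
  \<comment> \<open>\<open>v\<close> is the image \<open>y u / x\<close> of \<open>u\<close>. It
    stays nonzero modulo \<open>adj K y\<close> because \<open>y\<close> can be cancelled modulo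
    \<open>K\<close>.\<close>
  obtain k v where kv: "k \<in> K" "v \<in> carrier R" "y \<otimes> u = k \<oplus> v \<otimes> x" using mu[OF y(1)] by (auto simp: mem_adj)
  have kc: "k \<in> carrier R" using kv K idl_carr by blast
  have "v \<notin> adj K y"
  proof
    assume "v \<in> adj K y"
    then obtain l t where lt: "l \<in> K" "t \<in> carrier R" "v = l \<oplus> t \<otimes> y" by (auto simp: mem_adj)
    have lc: "l \<in> carrier R" using lt K idl_carr by blast
    have "(u \<ominus> t \<otimes> x) \<otimes> y = y \<otimes> u \<ominus> t \<otimes> x \<otimes> y" using u c lt by algebra
    also have "\<dots> = k \<oplus> x \<otimes> l" unfolding kv(3) lt(3) using kc lc c lt(2) by algebra
    also have "\<dots> \<in> K" using K kv lt c idl_add idl_l by blast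
    finally have "u \<ominus> t \<otimes> x \<in> K" using y u c lt by (auto intro: nzdD)
    hence "(u \<ominus> t \<otimes> x) \<oplus> t \<otimes> x \<in> adj K x" using lt adjI by blast
    moreover have "(u \<ominus> t \<otimes> x) \<oplus> t \<otimes> x = u" using u c lt by algebra
    ultimately show False using nu by simp
  qed
  \<comment> \<open>\<open>z u\<close> is a multiple of \<open>x\<close> modulo \<open>K\<close> as
    well; multiplying by \<open>y\<close> and cancelling \<open>x\<close> makes \<open>z v\<close> a
    multiple of \<open>y\<close>.\<close>
  moreover have "z \<otimes> v \<in> adj K y"
  proof -
    obtain l s where ls: "l \<in> K" "s \<in> carrier R" "z \<otimes> u = l \<oplus> s \<otimes> x" using mu[OF z(1)] by (auto simp: mem_adj)
    have lc: "l \<in> carrier R" using ls K idl_carr by blast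
    have vx: "v \<otimes> x = y \<otimes> u \<ominus> k" unfolding kv(3) using kc kv(2) c by algebra
    have "(z \<otimes> v \<ominus> s \<otimes> y) \<otimes> x = z \<otimes> (v \<otimes> x) \<ominus> s \<otimes> y \<otimes> x" using ls(2) c kv(2) by algebra
    also have "\<dots> = y \<otimes> (z \<otimes> u) \<ominus> z \<otimes> k \<ominus> s \<otimes> y \<otimes> x" unfolding vx using kc u c ls(2) by algebra
    also have "\<dots> = y \<otimes> l \<ominus> z \<otimes> k" unfolding ls(3) using kc lc c ls(2) by algebra
    also have "\<dots> \<in> K" using K kv ls c idl_minus idl_l by blast
    finally have "z \<otimes> v \<ominus> s \<otimes> y \<in> K" using x ls kv c by (auto intro: nzdD)
    hence "(z \<otimes> v \<ominus> s \<otimes> y) \<oplus> s \<otimes> y \<in> adj K y" using ls adjI by blast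
    moreover have "(z \<otimes> v \<ominus> s \<otimes> y) \<oplus> s \<otimes> y = z \<otimes> v" using kv c ls by algebra
    ultimately show ?thesis by simp
  qed
  ultimately show False using z kv by (auto dest: nzdD')
qed

text \<open>Invariance of the length of regular sequences: whichever nonzerodivisor is adjoined
  first, at most one is lost. Length two comes from \<open>exchange_one\<close>; the induction moves
  a third element past each of the two first elements.\<close>

lemma has_reg_adj:
  "has_reg (Suc n) K \<Longrightarrow> ideal K R \<Longrightarrow> x \<in> m \<Longrightarrow> nzd K x \<Longrightarrow> has_reg n (adj K x)"
proof (induction n arbitrary: K x)
  case 0 show ?case by simp
next
  case (Suc n)
  note K = \<open>ideal K R\<close> note x = \<open>x \<in> m\<close> \<open>nzd K x\<close>
  obtain y where y: "y \<in> m" "nzd K y" "has_reg (Suc n) (adj K y)" using Suc.prems(1) by auto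
  then obtain y1 where y1: "y1 \<in> m" "nzd (adj K y) y1" by auto
  have c: "x \<in> carrier R" "y \<in> carrier R" using x y m_ideal idl_carr by blast+
  obtain x1 where x1: "x1 \<in> m" "nzd (adj K x) x1" using exchange_one[OF K x y(1,2) y1] by blast
  \<comment> \<open>By prime avoidance, \<open>x\<close> and \<open>y\<close> can both be compared with a third element \<open>z\<close>.\<close>
  have "\<exists>z\<in>m. \<forall>L\<in>{K, adj K x, adj K y}. nzd L z"
    by (rule common_nzd) (use K c adj_ideal m_ideal x x1 y1 in auto)
  then obtain z where z: "z \<in> m" "nzd K z" "nzd (adj K x) z" "nzd (adj K y) z" by auto
  have zc: "z \<in> carrier R" using z m_ideal idl_carr by blast
  have "has_reg n (adj (adj K y) z)" using Suc.IH[OF y(3) adj_ideal[OF K c(2)] z(1,4)] .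
  hence "has_reg n (adj (adj K z) y)" using adj_swap[OF K c(2) zc] by simp
  hence "has_reg (Suc n) (adj K z)" using y(1) nzd_adj_swap[OF K y(2) z(4)] by auto
  hence "has_reg n (adj (adj K z) x)"
    using Suc.IH[OF _ adj_ideal[OF K zc] x(1) nzd_adj_swap[OF K x(2) z(3)]] by blast
  hence "has_reg n (adj (adj K x) z)" using adj_swap[OF K c(1) zc] by simp
  thus ?case using z by auto
qed

text \<open>If every length occurred, an ideal maximal with that property would remain so after
  adjoining a nonzerodivisor \<open>y\<close>, by \<open>has_reg_adj\<close>. So \<open>y\<close>
  would lie in it already, and cancelling \<open>y\<close> would put \<open>\<one>\<close>
  there.\<close>

lemma has_reg_bounded:
  assumes K: "ideal K R" "K \<subseteq> m" shows "\<exists>n. \<not> has_reg n K"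
proof (rule ccontr)
  assume a: "\<not> ?thesis"
  define S where "S = {L. ideal L R \<and> L \<subseteq> m \<and> (\<forall>n. has_reg n L)}"
  have 1: "S \<noteq> {}" using K a by (auto simp: S_def)
  have 2: "ideal I R" if "I \<in> S" for I using that by (auto simp: S_def)
  obtain M where M: "M \<in> S" "\<And>I. I \<in> S \<Longrightarrow> M \<subseteq> I \<Longrightarrow> I = M"
    using ideal_maximal[OF 1 2] by blast
  have Mi: "ideal M R" "M \<subseteq> m" "\<And>n. has_reg n M" using M by (auto simp: S_def)
  obtain y where y: "y \<in> m" "nzd M y" using Mi(3)[of 1] by auto
  have c: "y \<in> carrier R" using y by (simp add: nzd_def)
  have "adj M y \<in> S" unfolding S_def
    using adj_ideal[OF Mi(1) c] adj_least[OF m_ideal Mi(2) y(1)] has_reg_adj[OF Mi(3) Mi(1) y] by blast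
  hence "adj M y = M" using M(2) adj_supset[OF Mi(1) c] by blast
  hence "y \<in> M" using adj_mem[OF Mi(1) c] by simp
  hence "\<one> \<in> M" using y c nzdD[of M y \<one>] by simp
  thus False using Mi m_one by blast
qed

end

text \<open>Chains are recorded by their bottom element, since the constructions below lengthen them
  downwards.\<close>

primrec (in ring) prime_chain :: "nat \<Rightarrow> 'a set \<Rightarrow> bool" where
  "prime_chain 0 Q = primeideal Q R"
| "prime_chain (Suc n) Q = (primeideal Q R \<and> (\<exists>Q'. Q \<subset> Q' \<and> prime_chain n Q'))"

lemma (in ring) prime_chain_prime: "prime_chain n Q \<Longrightarrow> primeideal Q R"
  by (cases n) auto

lemma (in ring) prime_chain_le_dim:
  assumes "prime_chain n Q" shows "enat n \<le> krull_dim R"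
proof -
  have "\<exists>c. (\<forall>i\<le>n. primeideal (c i) R) \<and> (\<forall>i<n. c i \<subset> c (Suc i)) \<and> c 0 = Q"
    using assms
  proof (induction n arbitrary: Q)
    case 0 thus ?case by (intro exI[of _ "\<lambda>_. Q"]) auto
  next
    case (Suc n)
    obtain Q' where Q: "primeideal Q R" "Q \<subset> Q'" "prime_chain n Q'" using Suc.prems by auto
    then obtain c where c: "\<forall>i\<le>n. primeideal (c i) R" "\<forall>i<n. c i \<subset> c (Suc i)" "c 0 = Q'"
      using Suc.IH by blast
    show ?case
      by (intro exI[of _ "case_nat Q c"]) (use c Q in \<open>auto split: nat.splits simp: less_Suc_eq_0_disj\<close>)
  qed
  then obtain c where c: "\<forall>i\<le>n. primeideal (c i) R" "\<forall>i<n. c i \<subset> c (Suc i)" by blast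
  have "enat n \<le> ideal_height R (c n)"
    unfolding ideal_height_def by (rule Sup_upper) (use c in blast)
  also have "\<dots> \<le> krull_dim R" unfolding krull_dim_def by (rule SUP_upper) (use c in blast)
  finally show ?thesis .
qed

context noetherian_local begin

text \<open>The depth of R/K is at most the dimension of R/Q for an associated prime
  \<open>Q\<close>. For a nonzerodivisor \<open>x\<close> modulo \<open>K\<close>, the ideal Q + (x)
  sits in an associated prime of \<open>adj K x\<close>, strictly larger than \<open>Q\<close>,
  where the induction continues.\<close>

lemma has_reg_prime_chain:
  "has_reg n K \<Longrightarrow> ideal K R \<Longrightarrow> assoc_prime K Q \<Longrightarrow> prime_chain n Q"
proof (induction n arbitrary: K Q)
  case 0 thus ?case by (auto simp: assoc_prime_def)
next
  case (Suc n)
  note K = \<open>ideal K R\<close>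
  obtain x where x: "x \<in> m" "nzd K x" "has_reg n (adj K x)" using Suc.prems(1) by auto
  have xc: "x \<in> carrier R" using x by (simp add: nzd_def)
  obtain c where c: "c \<in> carrier R" "Q = colon_ideal R K {c}" "primeideal Q R"
    using Suc.prems by (auto simp: assoc_prime_def)
  have Qc: "Q \<subseteq> carrier R" using c prime_ideal idl_sub by blast
  \<comment> \<open>Modulo \<open>K\<close>, \<open>N\<close> is the submodule killed by
    \<open>Q\<close>. Were it contained in \<open>adj K x\<close>, its elements would be multiples
    of \<open>x\<close> by elements of \<open>N\<close> itself, against the choice of a maximal
    cyclic submodule of it.\<close>
  define N where "N = {u \<in> carrier R. \<forall>q\<in>Q. q \<otimes> u \<in> K}"
  have "\<exists>u\<in>N. u \<notin> adj K x"
  proof (rule ccontr)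
    assume a: "\<not> ?thesis"
    define S where "S = {adj K u | u. u \<in> N \<and> u \<notin> K}"
    have "c \<in> N" using c by (auto simp: N_def mem_colon)
    moreover have "c \<notin> K" using c prime_one[OF c(3)] by (auto simp: mem_colon)
    ultimately have 1: "S \<noteq> {}" by (auto simp: S_def)
    have 2: "ideal I R" if "I \<in> S" for I using that adj_ideal[OF K] by (auto simp: S_def N_def)
    obtain M where M: "M \<in> S" "\<And>I. I \<in> S \<Longrightarrow> M \<subseteq> I \<Longrightarrow> I = M"
      using ideal_maximal[OF 1 2] by blast
    then obtain u where u: "u \<in> N" "u \<notin> K" "M = adj K u" by (auto simp: S_def)
    have uc: "u \<in> carrier R" using u by (simp add: N_def)
    obtain k s where ks: "k \<in> K" "s \<in> carrier R" "u = k \<oplus> s \<otimes> x" using a u by (auto simp: mem_adj)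
    have kc: "k \<in> carrier R" using ks K idl_carr by blast
    have sN: "s \<in> N" unfolding N_def
    proof (intro CollectI conjI ballI)
      fix q assume q: "q \<in> Q"
      have qc: "q \<in> carrier R" using q Qc by blast
      have "q \<otimes> s \<otimes> x = q \<otimes> u \<ominus> q \<otimes> k" unfolding ks(3) using qc ks(2) kc xc by algebra
      also have "\<dots> \<in> K" using u q qc ks K idl_minus idl_l by (auto simp: N_def)
      finally show "q \<otimes> s \<in> K" using x qc ks by (auto intro: nzdD)
    qed (rule ks(2))
    have sK: "s \<notin> K" using ks u idl_add[OF K] idl_r[OF K] xc by blast
    have "adj K s \<in> S" using sN sK by (auto simp: S_def)
    moreover have "M \<subseteq> adj K s"
      unfolding u(3)
    proof (rule adj_least[OF adj_ideal[OF K ks(2)] adj_supset[OF K ks(2)]])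
      have "u = k \<oplus> x \<otimes> s" using ks xc by (simp add: m_comm)
      thus "u \<in> adj K s" using ks xc adjI by simp
    qed
    ultimately have "adj K s = adj K u" using M(2) u(3) by blast
    hence "s \<in> adj K u" using adj_mem[OF K ks(2)] by simp
    then obtain l t where lt: "l \<in> K" "t \<in> carrier R" "s = l \<oplus> t \<otimes> u" by (auto simp: mem_adj)
    have lc: "l \<in> carrier R" using lt K idl_carr by blast
    \<comment> \<open>From \<open>u = k + s x\<close> and \<open>s = l + t u\<close>, the element
      \<open>s\<close> is killed modulo \<open>K\<close> by the unit \<open>1 - t x\<close>.\<close>
    have "s \<otimes> (\<one> \<ominus> t \<otimes> x) = (l \<oplus> t \<otimes> u) \<ominus> t \<otimes> (s \<otimes> x)" unfolding lt(3)[symmetric] using ks(2) xc lt(2) by algebra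
    also have "\<dots> = l \<oplus> t \<otimes> k" unfolding ks(3) using ks(2) kc xc lt(2) lc by algebra
    also have "\<dots> \<in> K" using lt ks K idl_add idl_l by blast
    finally have "s \<in> K" using one_minus_cancel[OF K idl_l[OF m_ideal x(1) lt(2)] ks(2)] by blast
    thus False using sK by blast
  qed
  then obtain u where u: "u \<in> carrier R" "\<forall>q\<in>Q. q \<otimes> u \<in> K" "u \<notin> adj K x" by (auto simp: N_def)
  obtain d where d: "d \<in> carrier R" "primeideal (colon_ideal R (adj K x) {d}) R"
    "colon_ideal R (adj K x) {u} \<subseteq> colon_ideal R (adj K x) {d}"
    using exists_colon_prime[OF adj_ideal[OF K xc] u(1,3)] by blast
  let ?Q = "colon_ideal R (adj K x) {d}"
  have "Q \<subseteq> colon_ideal R (adj K x) {u}"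
    using u(2) Qc adj_supset[OF K xc] unfolding subset_iff mem_colon by blast
  moreover have "x \<in> colon_ideal R (adj K x) {u}"
    using adjI[OF idl_zero[OF K] u(1), of x] u xc by (simp add: mem_colon m_comm)
  moreover have "x \<notin> Q" using assoc_prime_not_nzd Suc.prems(3) x(2) by blast
  ultimately have "Q \<subset> ?Q" using d(3) by blast
  moreover have "prime_chain n ?Q"
    using Suc.IH[OF x(3) adj_ideal[OF K xc]] d by (auto simp: assoc_prime_def)
  ultimately show ?case using c by auto
qed

end

lemma (in cring) regular_sequence_step:
  assumes "regular_sequence R xs" "i < length xs"
  shows "nzd (Idl (set (take i xs))) (xs ! i)"
    "Idl (set (take (Suc i) xs)) = adj (Idl (set (take i xs))) (xs ! i)"
proof -
  have sub: "set xs \<subseteq> carrier R" using assms by (simp add: regular_sequence_def)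
  hence c: "xs ! i \<in> carrier R" "set (take i xs) \<subseteq> carrier R"
    using assms(2) by (auto dest: in_set_takeD)
  show "nzd (Idl (set (take i xs))) (xs ! i)"
    using assms c by (auto simp: regular_sequence_def nzd_def)
  show "Idl (set (take (Suc i) xs)) = adj (Idl (set (take i xs))) (xs ! i)"
    using adj_eq_genideal[OF c(2,1)] assms(2) by (simp add: take_Suc_conv_app_nth)
qed

lemma (in cring) regular_sequence_take_ideal:
  "regular_sequence R xs \<Longrightarrow> ideal (Idl (set (take i xs))) R"
  by (rule genideal_ideal) (auto simp: regular_sequence_def dest: in_set_takeD)

context noetherian_local begin

lemma regular_sequence_has_reg:
  assumes ys: "regular_sequence R ys" "set ys \<subseteq> m" and i: "i \<le> length ys"
  shows "has_reg (length ys - i) (Idl (set (take i ys)))"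
  using i
proof (induction "length ys - i" arbitrary: i)
  case 0 thus ?case by (metis has_reg.simps(1))
next
  case (Suc k)
  hence i: "i < length ys" "length ys - i = Suc (length ys - Suc i)" by auto
  have "has_reg (length ys - Suc i) (Idl (set (take (Suc i) ys)))" using Suc(1)[of "Suc i"] Suc.hyps(2) i by simp
  hence "has_reg (length ys - Suc i) (adj (Idl (set (take i ys))) (ys ! i))"
    unfolding regular_sequence_step(2)[OF ys(1) i(1)] .
  moreover have "ys ! i \<in> m" using ys i by auto
  ultimately show ?case unfolding i(2) using regular_sequence_step(1)[OF ys(1) i(1)] by auto
qed

text \<open>By \<open>has_reg_adj\<close> the elements of any regular sequence \<open>xs\<close> may
  be adjoined first, at a cost of one from \<open>N\<close> per element.\<close>

lemma has_reg_regular_sequence: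
  assumes xs: "regular_sequence R xs" "set xs \<subseteq> m" and N: "has_reg N {\<zero>}" "length xs \<le> N"
    and i: "i \<le> length xs"
  shows "has_reg (N - i) (Idl (set (take i xs)))"
  using i
proof (induction i)
  case 0 thus ?case using N by (simp add: Idl_empty)
next
  case (Suc i)
  hence i: "i < length xs" "N - i = Suc (N - Suc i)" using N by auto
  have "has_reg (Suc (N - Suc i)) (Idl (set (take i xs)))" using Suc i(2) by (metis Suc_leD)
  moreover have "xs ! i \<in> m" using xs(2) i(1) by auto
  ultimately show ?case unfolding regular_sequence_step(2)[OF xs(1) i(1)]
    by (rule has_reg_adj[OF _ regular_sequence_take_ideal[OF xs(1)] _ regular_sequence_step(1)[OF xs(1) i(1)]])
qed

text \<open>The supremum in \<open>depth\<close> is a maximum: the lengths are bounded by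
  \<open>has_reg_bounded\<close>, and the empty sequence is admissible because the ring is
  nonzero.\<close>

lemma depth_attained:
  obtains ys where "regular_sequence R ys" "set ys \<subseteq> m" "depth R m = enat (length ys)"
proof -
  let ?S = "{enat (length xs) | xs. regular_sequence R xs \<and> set xs \<subseteq> m}"
  have z: "{\<zero>} \<subseteq> m" "ideal {\<zero>} R" using idl_zero[OF m_ideal] zeroideal by auto
  obtain B where B: "\<not> has_reg B {\<zero>}" using has_reg_bounded[OF z(2,1)] by blast
  have "length xs \<le> B" if "regular_sequence R xs" "set xs \<subseteq> m" for xs
  proof (rule ccontr)
    assume "\<not> length xs \<le> B"
    moreover have "has_reg (length xs) {\<zero>}" using regular_sequence_has_reg[OF that, of 0] by (simp add: Idl_empty)
    ultimately show False using B has_reg_mono by (metis nat_le_linear)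
  qed
  hence "?S \<subseteq> enat ` {..B}" by auto
  hence fin: "finite ?S" by (rule finite_subset) simp
  have "\<one> \<notin> {\<zero>}" using z m_one by auto
  hence "regular_sequence R []" unfolding regular_sequence_def by (auto simp: Idl_empty)
  hence ne: "?S \<noteq> {}" by auto
  have "depth R m = Max ?S" unfolding depth_def Sup_enat_def using fin ne by auto
  also have "Max ?S \<in> ?S" using fin ne by (rule Max_in)
  finally show ?thesis using that by blast
qed

text \<open>Each \<open>xs ! i\<close> lies in the bottom prime and is a nonzerodivisor modulo its
  predecessors, so a strictly smaller prime contains these. The generators are given up one at a
  time.\<close>

lemma prime_chain_extend_below:
  assumes xs: "regular_sequence R xs"
  shows "prime_chain n P \<Longrightarrow> Idl (set (take i xs)) \<subseteq> P \<Longrightarrow> i \<le> length xs \<Longrightarrow> \<exists>P'. prime_chain (n + i) P'"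
proof (induction i arbitrary: n P)
  case 0 thus ?case by auto
next
  case (Suc i)
  hence i: "i < length xs" by simp
  let ?K = "Idl (set (take i xs))"
  have K: "ideal ?K R" using regular_sequence_take_ideal[OF xs] .
  have c: "xs ! i \<in> carrier R" using regular_sequence_step(1)[OF xs i] by (simp add: nzd_def)
  have "adj ?K (xs ! i) \<subseteq> P" using Suc.prems(2) regular_sequence_step(2)[OF xs i] by simp
  hence "?K \<subseteq> P" "xs ! i \<in> P" using adj_supset[OF K c] adj_mem[OF K c] by auto
  then obtain Q where "primeideal Q R" "?K \<subseteq> Q" "Q \<subset> P"
    using prime_below_nzd[OF K regular_sequence_step(1)[OF xs i] prime_chain_prime[OF Suc.prems(1)]] by blast
  moreover from this have "prime_chain (Suc n) Q" using Suc.prems(1) by auto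
  ultimately obtain P' where "prime_chain (Suc n + i) P'" using Suc.IH[of "Suc n" Q] i by auto
  thus ?case by auto
qed

text \<open>For depth N and a sequence of length g, depth provides N - g steps above
  \<open>Q\<close>, and regularity g steps below any prime containing \<open>xs\<close>. A proper
  inclusion of \<open>Q'\<close> in \<open>Q\<close> would add one more step and exceed the
  dimension N.\<close>

theorem cohen_macaulay_unmixed:
  assumes cm: "depth R m = krull_dim R" and xs: "regular_sequence R xs"
    and Q: "assoc_prime (Idl (set xs)) Q" "primeideal Q' R" "Idl (set xs) \<subseteq> Q'" "Q' \<subseteq> Q"
  shows "Q' = Q"
proof (rule ccontr)
  assume ne: "Q' \<noteq> Q"
  have sc: "set xs \<subseteq> carrier R" "Idl (set xs) \<noteq> carrier R" using xs by (auto simp: regular_sequence_def)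
  have Ji: "ideal (Idl (set xs)) R" using sc genideal_ideal by blast
  have "\<one> \<notin> Idl (set xs)" using sc ideal.one_imp_carrier[OF Ji] by blast
  hence xm: "set xs \<subseteq> m" using proper_in_m[OF Ji] genideal_self[OF sc(1)] by blast
  obtain ys where ys: "regular_sequence R ys" "set ys \<subseteq> m" "depth R m = enat (length ys)" using depth_attained .
  let ?N = "length ys" and ?g = "length xs"
  have "enat ?g \<le> depth R m" unfolding depth_def by (rule Sup_upper) (use xs xm in blast)
  hence gN: "?g \<le> ?N" using ys by simp
  have "has_reg ?N {\<zero>}" using regular_sequence_has_reg[OF ys(1,2), of 0] by (simp add: Idl_empty)
  from has_reg_regular_sequence[OF xs xm this gN, of ?g]
  have "has_reg (?N - ?g) (Idl (set xs))" by simp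
  hence "prime_chain (?N - ?g) Q" using has_reg_prime_chain Ji Q by blast
  hence "prime_chain (Suc (?N - ?g)) Q'" using Q ne by auto
  from prime_chain_extend_below[OF xs this, of ?g] Q obtain P' where "prime_chain (Suc (?N - ?g) + ?g) P'" by auto
  hence "enat (Suc ?N) \<le> krull_dim R" using prime_chain_le_dim gN by fastforce
  hence "enat (Suc ?N) \<le> enat ?N" using cm ys by simp
  thus False by simp
qed

end

section \<open>Powers of ideals generated by regular sequences\<close>

context cring begin

abbreviation pw :: "'a set \<Rightarrow> nat \<Rightarrow> 'a set" where
  "pw J n \<equiv> ideal_power R J n"

lemma pw_ideal: "ideal J R \<Longrightarrow> ideal (pw J n) R"
  by (induction n) (simp_all add: oneideal ideal_prod_is_ideal)

lemma prod_least:
  assumes "ideal L R" "\<And>i k. i \<in> I \<Longrightarrow> k \<in> K \<Longrightarrow> i \<otimes> k \<in> L"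
  shows "I \<cdot> K \<subseteq> L"
proof
  fix s assume "s \<in> I \<cdot> K" thus "s \<in> L"
    by (induct s rule: ideal_prod.induct) (use assms idl_add in auto)
qed

lemma prod_mono: "I \<subseteq> I' \<Longrightarrow> K \<subseteq> K' \<Longrightarrow> I \<cdot> K \<subseteq> I' \<cdot> K'"
proof
  fix s assume a: "I \<subseteq> I'" "K \<subseteq> K'" "s \<in> I \<cdot> K"
  from a(3) show "s \<in> I' \<cdot> K'"
    by (induct s rule: ideal_prod.induct) (use a in \<open>auto intro: ideal_prod.intros\<close>)
qed

lemma pw_mono: "I \<subseteq> J \<Longrightarrow> pw I n \<subseteq> pw J n"
  by (induction n) (simp_all add: prod_mono)

lemma prod_one_left: "ideal K R \<Longrightarrow> carrier R \<cdot> K = K"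
  using ideal_prod_one ideal_prod_commute oneideal by metis

lemma pw_one: "ideal J R \<Longrightarrow> pw J (Suc 0) = J"
  by (simp add: ideal_prod_one)

lemma pw_add: "ideal J R \<Longrightarrow> pw J (n + k) = pw J n \<cdot> pw J k"
  by (induction n) (simp_all add: prod_one_left pw_ideal ideal_prod_assoc)

lemma pw_mult: "ideal J R \<Longrightarrow> a \<in> pw J n \<Longrightarrow> b \<in> pw J k \<Longrightarrow> a \<otimes> b \<in> pw J (n + k)"
  by (simp add: pw_add ideal_prod.prod)

lemma pw_Suc_right: "ideal J R \<Longrightarrow> pw J (Suc n) = pw J n \<cdot> J"
  by (simp add: ideal_prod_commute pw_ideal)

lemma prod_sub_left: "ideal I R \<Longrightarrow> ideal K R \<Longrightarrow> I \<cdot> K \<subseteq> I"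
  using ideal_prod_inter by blast

lemma prod_sub_right: "ideal I R \<Longrightarrow> ideal K R \<Longrightarrow> I \<cdot> K \<subseteq> K"
  using ideal_prod_inter by blast

lemma pw_Suc_prod: "ideal J R \<Longrightarrow> ideal K R \<Longrightarrow> pw J (Suc n) \<cdot> K = J \<cdot> (pw J n \<cdot> K)"
  by (simp add: ideal_prod_assoc pw_ideal)

lemma pw_mult_prod:
  assumes "ideal J R" "ideal K R" "a \<in> pw J n" "b \<in> pw J k \<cdot> K"
  shows "a \<otimes> b \<in> pw J (n + k) \<cdot> K"
proof -
  have "a \<otimes> b \<in> pw J n \<cdot> (pw J k \<cdot> K)" by (rule ideal_prod.prod[OF assms(3,4)])
  thus ?thesis using assms by (simp add: pw_add ideal_prod_assoc pw_ideal)
qed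

lemma pw_mult_prod':
  assumes "ideal J R" "ideal K R" "a \<in> pw J n \<cdot> K" "b \<in> pw J k"
  shows "a \<otimes> b \<in> pw J (n + k) \<cdot> K"
proof -
  have "a \<in> carrier R" "b \<in> carrier R"
    using idl_carr[OF ideal_prod_is_ideal[OF pw_ideal[OF assms(1)] assms(2)] assms(3)]
      idl_carr[OF pw_ideal[OF assms(1)] assms(4)] .
  thus ?thesis using pw_mult_prod[OF assms(1,2,4,3)] by (simp add: m_comm add.commute)
qed

lemma idl_finsum:
  assumes "ideal I R" "finite A" "\<And>i. i \<in> A \<Longrightarrow> f i \<in> I"
  shows "finsum R f A \<in> I"
  using assms(2,3)
proof (induction A)
  case empty thus ?case using assms idl_zero by simp
next
  case (insert i A)
  have "f \<in> A \<rightarrow> carrier R" "f i \<in> carrier R" using insert.prems assms(1) idl_carr by auto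
  thus ?case using insert assms(1) idl_add by auto
qed

text \<open>Monomials in the generators that avoid \<open>x\<close> are separated from those
  divisible by \<open>x\<close>.\<close>

lemma pw_decomp:
  assumes J: "ideal J R" and x: "x \<in> carrier R" and K: "ideal K R"
  shows "w \<in> pw (adj J x) (Suc n) \<cdot> K \<Longrightarrow> \<exists>w'\<in>pw J (Suc n) \<cdot> K. \<exists>v\<in>pw (adj J x) n \<cdot> K. w = w' \<oplus> x \<otimes> v"
proof (induction n arbitrary: w)
  let ?L = "adj J x"
  have L: "ideal ?L R" using adj_ideal[OF J x] .
  have cl: "\<And>n. ideal (pw J n \<cdot> K) R" "\<And>n. ideal (pw ?L n \<cdot> K) R"
    using J L K pw_ideal ideal_prod_is_ideal by auto
  \<comment> \<open>The multiple of \<open>x\<close> in a factor from \<open>?L\<close> goes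
    straight into \<open>v\<close>. Only a factor \<open>j\<close> from \<open>J\<close> remains,
    and only its treatment, \<open>base\<close>, depends on the degree.\<close>
  have main: "\<exists>w'\<in>pw J (Suc n) \<cdot> K. \<exists>v\<in>pw ?L n \<cdot> K. w = w' \<oplus> x \<otimes> v"
    if w: "w \<in> pw ?L (Suc n) \<cdot> K"
      and base: "\<And>j w. j \<in> J \<Longrightarrow> w \<in> pw ?L n \<cdot> K \<Longrightarrow> \<exists>w'\<in>pw J (Suc n) \<cdot> K. \<exists>v\<in>pw ?L n \<cdot> K. j \<otimes> w = w' \<oplus> x \<otimes> v"
    for n w
    using w unfolding pw_Suc_prod[OF L K]
  proof (induction w rule: ideal_prod.induct)
    case (prod l w)
    then obtain j r where jr: "j \<in> J" "r \<in> carrier R" "l = j \<oplus> r \<otimes> x" by (auto simp: mem_adj)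
    obtain w' v where wv: "w' \<in> pw J (Suc n) \<cdot> K" "v \<in> pw ?L n \<cdot> K" "j \<otimes> w = w' \<oplus> x \<otimes> v"
      using base[OF jr(1) prod(2)] by blast
    have c: "w \<in> carrier R" "w' \<in> carrier R" "v \<in> carrier R" "j \<in> carrier R"
      using idl_carr[OF cl(2) prod(2)] idl_carr[OF cl(1) wv(1)] idl_carr[OF cl(2) wv(2)] idl_carr[OF J jr(1)] .
    have "l \<otimes> w = j \<otimes> w \<oplus> x \<otimes> (r \<otimes> w)" unfolding jr(3) using c jr(2) x by algebra
    also have "\<dots> = w' \<oplus> x \<otimes> (v \<oplus> r \<otimes> w)" unfolding wv(3) using c jr(2) x by algebra
    finally have "l \<otimes> w = w' \<oplus> x \<otimes> (v \<oplus> r \<otimes> w)" .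
    moreover have "v \<oplus> r \<otimes> w \<in> pw ?L n \<cdot> K" using idl_add[OF cl(2) wv(2) idl_l[OF cl(2) prod(2) jr(2)]] .
    ultimately show ?case using wv(1) by blast
  next
    case (sum s t)
    obtain w1 v1 w2 v2 where
      1: "w1 \<in> pw J (Suc n) \<cdot> K" "v1 \<in> pw ?L n \<cdot> K" "s = w1 \<oplus> x \<otimes> v1" and
      2: "w2 \<in> pw J (Suc n) \<cdot> K" "v2 \<in> pw ?L n \<cdot> K" "t = w2 \<oplus> x \<otimes> v2" using sum by blast
    have c: "w1 \<in> carrier R" "v1 \<in> carrier R" "w2 \<in> carrier R" "v2 \<in> carrier R"
      using idl_carr[OF cl(1) 1(1)] idl_carr[OF cl(2) 1(2)] idl_carr[OF cl(1) 2(1)] idl_carr[OF cl(2) 2(2)] .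
    have "s \<oplus> t = (w1 \<oplus> w2) \<oplus> x \<otimes> (v1 \<oplus> v2)" unfolding 1(3) 2(3) using c x by algebra
    thus ?case using idl_add[OF cl(1) 1(1) 2(1)] idl_add[OF cl(2) 1(2) 2(2)] by blast
  qed
  {
    case 0
    show ?case
    proof (rule main[OF 0])
      fix j w assume jw: "j \<in> J" "w \<in> pw ?L 0 \<cdot> K"
      have "j \<otimes> w \<in> J \<cdot> (pw J 0 \<cdot> K)" using jw ideal_prod.prod by simp
      hence "j \<otimes> w \<in> pw J (Suc 0) \<cdot> K" unfolding pw_Suc_prod[OF J K] .
      moreover have "j \<otimes> w = j \<otimes> w \<oplus> x \<otimes> \<zero>"
        using idl_carr[OF J jw(1)] idl_carr[OF cl(2) jw(2)] x by simp
      ultimately show "\<exists>w'\<in>pw J (Suc 0) \<cdot> K. \<exists>v\<in>pw ?L 0 \<cdot> K. j \<otimes> w = w' \<oplus> x \<otimes> v"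
        using idl_zero[OF cl(2)[of 0]] by blast
    qed
  next
    case (Suc n)
    show ?case
    proof (rule main[OF Suc.prems])
      fix j w assume jw: "j \<in> J" "w \<in> pw ?L (Suc n) \<cdot> K"
      obtain w' v where wv: "w' \<in> pw J (Suc n) \<cdot> K" "v \<in> pw ?L n \<cdot> K" "w = w' \<oplus> x \<otimes> v"
        using Suc.IH[OF jw(2)] by blast
      have c: "w' \<in> carrier R" "v \<in> carrier R" "j \<in> carrier R"
        using idl_carr[OF cl(1) wv(1)] idl_carr[OF cl(2) wv(2)] idl_carr[OF J jw(1)] .
      have "j \<otimes> w = j \<otimes> w' \<oplus> x \<otimes> (j \<otimes> v)" unfolding wv(3) using c x by algebra
      moreover have "j \<otimes> w' \<in> pw J (Suc (Suc n)) \<cdot> K"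
        unfolding pw_Suc_prod[OF J K, of "Suc n"] by (rule ideal_prod.prod[OF jw(1) wv(1)])
      moreover have "j \<in> ?L" using jw(1) adj_supset[OF J x] by blast
      hence "j \<otimes> v \<in> pw ?L (Suc n) \<cdot> K"
        unfolding pw_Suc_prod[OF L K, of n] using wv(2) by (rule ideal_prod.prod)
      ultimately show "\<exists>w'\<in>pw J (Suc (Suc n)) \<cdot> K. \<exists>v\<in>pw ?L (Suc n) \<cdot> K. j \<otimes> w = w' \<oplus> x \<otimes> v" by blast
    qed
  }
qed

lemma pw_decomp':
  assumes J: "ideal J R" and x: "x \<in> carrier R" and w: "w \<in> pw (adj J x) (Suc n)"
  obtains w' v where "w' \<in> pw J (Suc n)" "v \<in> pw (adj J x) n" "w = w' \<oplus> x \<otimes> v"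
proof -
  have e: "\<And>n. pw (adj J x) n \<cdot> carrier R = pw (adj J x) n" "\<And>n. pw J n \<cdot> carrier R = pw J n"
    using ideal_prod_one pw_ideal J adj_ideal[OF J x] by auto
  have "w \<in> pw (adj J x) (Suc n) \<cdot> carrier R" unfolding e(1) by (rule w)
  from pw_decomp[OF J x oneideal this] show ?thesis unfolding e using that by blast
qed

text \<open>The decomposition is unique modulo \<open>K\<close>, as for polynomials in a new
  variable \<open>x\<close>. Two decompositions give \<open>x (v - k)\<close> in
  \<open>J^(n+1)\<close>; cancelling \<open>x\<close> makes the discrepancy negligible, because
  \<open>J\<close> and \<open>x\<close> lie in \<open>K\<close>.\<close>

lemma pw_components:
  assumes J: "ideal J R" and x: "\<And>n. nzd (pw J n) x" and K: "ideal K R" "adj J x \<subseteq> K"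
    and w: "w' \<in> pw J (Suc n)" "v \<in> pw (adj J x) n" "w' \<oplus> x \<otimes> v \<in> pw (adj J x) (Suc n) \<cdot> K"
  shows "w' \<in> pw J (Suc n) \<cdot> K" "v \<in> pw (adj J x) n \<cdot> K"
proof -
  let ?L = "adj J x"
  have xc: "x \<in> carrier R" using x by (simp add: nzd_def)
  have L: "ideal ?L R" "J \<subseteq> ?L" "x \<in> ?L" using adj_ideal[OF J xc] adj_supset[OF J xc] adj_mem[OF J xc] .
  have cl: "\<And>n. ideal (pw J n \<cdot> K) R" "\<And>n. ideal (pw ?L n \<cdot> K) R" "\<And>n. ideal (pw J n) R" "\<And>n. ideal (pw ?L n) R"
    using J L K pw_ideal ideal_prod_is_ideal by auto
  obtain k' k where k: "k' \<in> pw J (Suc n) \<cdot> K" "k \<in> pw ?L n \<cdot> K" "w' \<oplus> x \<otimes> v = k' \<oplus> x \<otimes> k"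
    using pw_decomp[OF J xc K(1) w(3)] by blast
  have c: "w' \<in> carrier R" "v \<in> carrier R" "k' \<in> carrier R" "k \<in> carrier R"
    using idl_carr[OF cl(3) w(1)] idl_carr[OF cl(4) w(2)] idl_carr[OF cl(1) k(1)] idl_carr[OF cl(2) k(2)] .
  have "x \<otimes> (v \<ominus> k) = (w' \<oplus> x \<otimes> v) \<ominus> w' \<ominus> x \<otimes> k" using c xc by algebra
  also have "\<dots> = k' \<ominus> w'" unfolding k(3) using c xc by algebra
  also have "\<dots> \<in> pw J (Suc n)" using idl_minus[OF cl(3) _ w(1)] prod_sub_left[OF cl(3) K(1)] k(1) by blast
  finally have d: "v \<ominus> k \<in> pw J (Suc n)" using nzdD'[OF x minus_closed[OF c(2,4)]] by blast
  have "pw J (Suc n) \<subseteq> pw ?L n \<cdot> K"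
    unfolding pw_Suc_right[OF J] by (rule prod_mono) (use pw_mono L K in auto)
  thus "v \<in> pw ?L n \<cdot> K" using d idl_minus_cancel[OF cl(2) _ k(2) c(2)] by blast
  have "x \<in> K" using L(3) K(2) by blast
  with d have "(v \<ominus> k) \<otimes> x \<in> pw J (Suc n) \<cdot> K" by (rule ideal_prod.prod)
  hence "k' \<ominus> (v \<ominus> k) \<otimes> x \<in> pw J (Suc n) \<cdot> K" using idl_minus[OF cl(1) k(1)] by blast
  moreover have "k' \<ominus> (v \<ominus> k) \<otimes> x = (k' \<oplus> x \<otimes> k) \<ominus> x \<otimes> v" using c xc by algebra
  moreover have "(k' \<oplus> x \<otimes> k) \<ominus> x \<otimes> v = w'" unfolding k(3)[symmetric] using c xc by algebra
  ultimately show "w' \<in> pw J (Suc n) \<cdot> K" by simp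
qed

text \<open>A regular sequence remembered by its length and the ideal it generates, with the last
  generator exposed for induction.\<close>

inductive reg_ideal :: "nat \<Rightarrow> 'a set \<Rightarrow> bool" where
  zero: "reg_ideal 0 {\<zero>}"
| step: "reg_ideal g J \<Longrightarrow> nzd J x \<Longrightarrow> reg_ideal (Suc g) (adj J x)"

lemma reg_ideal_ideal: "reg_ideal g J \<Longrightarrow> ideal J R"
  by (induction rule: reg_ideal.induct) (auto simp: zeroideal nzd_def intro: adj_ideal)

lemma reg_ideal_generators:
  "reg_ideal g J \<Longrightarrow> \<exists>xs. set xs \<subseteq> carrier R \<and> length xs = g \<and> J = Idl (set xs)"
proof (induction rule: reg_ideal.induct)
  case zero thus ?case by (intro exI[of _ "[]"]) (simp add: Idl_empty)
next
  case (step g J x)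
  then obtain xs where "set xs \<subseteq> carrier R" "length xs = g" "J = Idl (set xs)" by blast
  thus ?case using step(2) adj_eq_genideal[of "set xs" x]
    by (intro exI[of _ "x # xs"]) (auto simp: nzd_def)
qed

lemma regular_sequence_reg_ideal:
  assumes "regular_sequence R xs" shows "reg_ideal (length xs) (Idl (set xs))"
proof -
  have "reg_ideal i (Idl (set (take i xs)))" if "i \<le> length xs" for i
    using that
  proof (induction i)
    case 0 thus ?case using reg_ideal.zero by (simp add: Idl_empty)
  next
    case (Suc i)
    hence "i < length xs" by simp
    from reg_ideal.step[OF _ regular_sequence_step(1)[OF assms this]] regular_sequence_step(2)[OF assms this] Suc
    show ?case by simp
  qed
  from this[of "length xs"] show ?thesis by simp
qed

lemma pw_zero: "pw {\<zero>} (Suc n) = {\<zero>}"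
  using ideal_prod_zero[OF pw_ideal[OF zeroideal]] ideal_prod_commute[OF zeroideal pw_ideal[OF zeroideal]] by simp

text \<open>For regular \<open>J\<close> the degree \<open>n\<close> part of the polynomial ring
  over R/K is \<open>J^n / J^n K\<close>. There an element is killed by the constants in
  \<open>A\<close> exactly if its coefficients are; the nontrivial direction is recorded.\<close>

definition colon_compat :: "'a set \<Rightarrow> bool" where
  "colon_compat J \<longleftrightarrow> (\<forall>n K A w. ideal K R \<longrightarrow> J \<subseteq> K \<longrightarrow> A \<subseteq> carrier R \<longrightarrow> w \<in> pw J n \<longrightarrow>
     (\<forall>a\<in>A. a \<otimes> w \<in> pw J n \<cdot> K) \<longrightarrow> w \<in> pw J n \<cdot> colon_ideal R K A)"

lemma colon_compatD:
  "colon_compat J \<Longrightarrow> ideal K R \<Longrightarrow> J \<subseteq> K \<Longrightarrow> A \<subseteq> carrier R \<Longrightarrow> w \<in> pw J n \<Longrightarrow>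
     (\<And>a. a \<in> A \<Longrightarrow> a \<otimes> w \<in> pw J n \<cdot> K) \<Longrightarrow> w \<in> pw J n \<cdot> colon_ideal R K A"
  unfolding colon_compat_def by blast

lemma colon_nzd: "nzd K x \<Longrightarrow> ideal K R \<Longrightarrow> colon_ideal R K {x} = K"
  using idl_carr idl_r by (auto simp: mem_colon nzd_def)

text \<open>Induction on the power: once \<open>r\<close> lies in \<open>J^n\<close>, the colon
  property with \<open>K = J\<close> and \<open>A = {x}\<close> moves it into
  \<open>J^n (J : x) = J^(n+1)\<close>.\<close>

lemma colon_compat_nzd_pw:
  assumes J: "ideal J R" "colon_compat J" and x: "nzd J x"
  shows "nzd (pw J n) x"
proof -
  have xc: "x \<in> carrier R" using x by (simp add: nzd_def)
  have "r \<in> pw J n" if "r \<in> carrier R" "r \<otimes> x \<in> pw J n" for r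
    using that
  proof (induction n)
    case (Suc n)
    have "r \<otimes> x \<in> pw J n"
      using Suc.prems(2) prod_sub_right[OF J(1) pw_ideal[OF J(1)]] by auto
    hence r: "r \<in> pw J n" using Suc by blast
    have "x \<otimes> r \<in> pw J n \<cdot> J" using Suc.prems xc unfolding pw_Suc_right[OF J(1)] by (simp add: m_comm)
    hence "r \<in> pw J n \<cdot> colon_ideal R J {x}"
      using xc by (intro colon_compatD[OF J(2,1) _ _ r]) auto
    thus ?case unfolding colon_nzd[OF x J(1)] pw_Suc_right[OF J(1)] .
  qed simp
  thus ?thesis using xc by (simp add: nzd_def)
qed

lemma colon_compat_0:
  assumes "ideal K R" "A \<subseteq> carrier R" "w \<in> carrier R" "\<And>a. a \<in> A \<Longrightarrow> a \<otimes> w \<in> pw J 0 \<cdot> K"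
  shows "w \<in> pw J 0 \<cdot> colon_ideal R K A"
proof -
  have "a \<otimes> w = w \<otimes> a" if "a \<in> A" for a using that assms(2,3) m_comm by blast
  thus ?thesis using assms colon_ideal_ideal[OF assms(1,2)] by (simp add: prod_one_left mem_colon)
qed

text \<open>For \<open>w = w' + x v\<close>, uniqueness of components modulo \<open>K\<close>
  transfers the hypothesis to \<open>w'\<close>, treated by induction on the generators, and to
  \<open>v\<close>, treated by induction on the degree.\<close>

lemma reg_ideal_colon_compat: "reg_ideal g J \<Longrightarrow> colon_compat J"
proof (induction rule: reg_ideal.induct)
  case zero
  show ?case unfolding colon_compat_def
  proof (intro allI impI)
    fix n K A w assume a: "ideal K R" "A \<subseteq> carrier R" "w \<in> pw {\<zero>} n" "\<forall>a\<in>A. a \<otimes> w \<in> pw {\<zero>} n \<cdot> K"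
    show "w \<in> pw {\<zero>} n \<cdot> colon_ideal R K A"
    proof (cases n)
      case 0 thus ?thesis using colon_compat_0 a by simp
    next
      case (Suc k)
      hence "w = \<zero>" using a(3) pw_zero by auto
      thus ?thesis using idl_zero[OF ideal_prod_is_ideal[OF pw_ideal[OF zeroideal] colon_ideal_ideal[OF a(1,2)]]] by simp
    qed
  qed
next
  case (step g J x)
  let ?L = "adj J x"
  have J: "ideal J R" using step reg_ideal_ideal by blast
  have xc: "x \<in> carrier R" using step by (simp add: nzd_def)
  have L: "ideal ?L R" "J \<subseteq> ?L" "x \<in> ?L" using adj_ideal[OF J xc] adj_supset[OF J xc] adj_mem[OF J xc] .
  have x: "\<And>n. nzd (pw J n) x" using colon_compat_nzd_pw[OF J step(3,2)] .
  have "w \<in> pw ?L n \<cdot> colon_ideal R K A"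
    if K: "ideal K R" "?L \<subseteq> K" and A: "A \<subseteq> carrier R"
      and w: "w \<in> pw ?L n" "\<forall>a\<in>A. a \<otimes> w \<in> pw ?L n \<cdot> K" for n K A w
    using w
  proof (induction n arbitrary: w)
    case 0 thus ?case using colon_compat_0 K A by simp
  next
    case (Suc n)
    let ?C = "colon_ideal R K A"
    have C: "ideal ?C R" using colon_ideal_ideal K A by blast
    obtain w' v where wv: "w' \<in> pw J (Suc n)" "v \<in> pw ?L n" "w = w' \<oplus> x \<otimes> v"
      using pw_decomp'[OF J xc Suc.prems(1)] by blast
    have c: "w' \<in> carrier R" "v \<in> carrier R"
      using idl_carr[OF pw_ideal[OF J] wv(1)] idl_carr[OF pw_ideal[OF L(1)] wv(2)] .
    have *: "a \<otimes> w' \<in> pw J (Suc n) \<cdot> K" "a \<otimes> v \<in> pw ?L n \<cdot> K" if a: "a \<in> A" for a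
    proof -
      have ac: "a \<in> carrier R" using a A by blast
      have "a \<otimes> w' \<oplus> x \<otimes> (a \<otimes> v) = a \<otimes> w" unfolding wv(3) using c ac xc by algebra
      hence 1: "a \<otimes> w' \<oplus> x \<otimes> (a \<otimes> v) \<in> pw ?L (Suc n) \<cdot> K" using Suc.prems(2) a by simp
      have 2: "a \<otimes> w' \<in> pw J (Suc n)" "a \<otimes> v \<in> pw ?L n"
        using idl_l[OF pw_ideal[OF J] wv(1) ac] idl_l[OF pw_ideal[OF L(1)] wv(2) ac] .
      show "a \<otimes> w' \<in> pw J (Suc n) \<cdot> K" "a \<otimes> v \<in> pw ?L n \<cdot> K"
        using pw_components[OF J x K 2 1] .
    qed
    have "w' \<in> pw J (Suc n) \<cdot> ?C"
      by (rule colon_compatD[OF step(3) K(1) _ A wv(1) *(1)]) (use L K in auto)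
    hence 1: "w' \<in> pw ?L (Suc n) \<cdot> ?C" using prod_mono[OF pw_mono[OF L(2)] order_refl] by blast
    have "v \<in> pw ?L n \<cdot> ?C" using Suc.IH wv(2) * by blast
    with L(3) have "x \<otimes> v \<in> ?L \<cdot> (pw ?L n \<cdot> ?C)" by (rule ideal_prod.prod)
    hence 2: "x \<otimes> v \<in> pw ?L (Suc n) \<cdot> ?C" unfolding pw_Suc_prod[OF L(1) C] .
    show ?case unfolding wv(3) using idl_add[OF ideal_prod_is_ideal[OF pw_ideal[OF L(1)] C] 1 2] .
  qed
  thus ?case unfolding colon_compat_def by blast
qed

text \<open>Only homogeneous elements are tested here; \<open>conv_prime\<close> extends the
  property to sums.\<close>

definition gr_prime :: "'a set \<Rightarrow> 'a set \<Rightarrow> bool" where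
  "gr_prime J q \<longleftrightarrow> (\<forall>n k u v. u \<in> pw J n \<longrightarrow> v \<in> pw J k \<longrightarrow> u \<otimes> v \<in> pw J (n + k) \<cdot> q \<longrightarrow>
     u \<in> pw J n \<cdot> q \<or> v \<in> pw J k \<cdot> q)"

text \<open>A constant \<open>u\<close> outside \<open>q\<close> is cancelled by the colon property,
  because \<open>q : u = q\<close>.\<close>

lemma gr_prime_0:
  assumes q: "primeideal q R" "J \<subseteq> q" and J: "ideal J R" "colon_compat J"
    and u: "u \<in> carrier R" "v \<in> pw J k" "u \<otimes> v \<in> pw J k \<cdot> q"
  shows "u \<in> pw J 0 \<cdot> q \<or> v \<in> pw J k \<cdot> q"
proof (cases "u \<in> q")
  case True thus ?thesis using q prime_ideal prod_one_left by simp
next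
  case False
  have "nzd q u" using u False prime_multD[OF q(1)] by (auto simp: nzd_def)
  moreover have "v \<in> pw J k \<cdot> colon_ideal R q {u}"
    using u q prime_ideal by (intro colon_compatD[OF J(2)]) auto
  ultimately show ?thesis using colon_nzd q prime_ideal by simp
qed

text \<open>Adjoining \<open>x\<close> adjoins a variable to a domain. The induction is over the
  generators and over the total degree \<open>n + k\<close>: the parts free of \<open>x\<close> are
  settled by \<open>J\<close>, and after removing one of them \<open>x\<close> is cancelled and the
  degree drops.\<close>

lemma reg_ideal_gr_prime: "reg_ideal g J \<Longrightarrow> primeideal q R \<Longrightarrow> J \<subseteq> q \<Longrightarrow> gr_prime J q"
proof (induction rule: reg_ideal.induct)
  case zero
  show ?case unfolding gr_prime_def
  proof (intro allI impI)
    fix n k u v assume a: "u \<in> pw {\<zero>} n" "v \<in> pw {\<zero>} k" "u \<otimes> v \<in> pw {\<zero>} (n + k) \<cdot> q"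
    have q: "ideal (pw {\<zero>} i \<cdot> q) R" for i using ideal_prod_is_ideal[OF pw_ideal[OF zeroideal]] zero prime_ideal by blast
    show "u \<in> pw {\<zero>} n \<cdot> q \<or> v \<in> pw {\<zero>} k \<cdot> q"
    proof (cases "n = 0 \<and> k = 0")
      case True thus ?thesis using a zero prime_multD by (simp add: prod_one_left prime_ideal)
    next
      case False
      hence "u = \<zero> \<or> v = \<zero>" using a(1,2) pw_zero by (metis not0_implies_Suc singletonD)
      thus ?thesis using idl_zero[OF q] by blast
    qed
  qed
next
  case (step g J x)
  let ?L = "adj J x"
  have J: "ideal J R" using step reg_ideal_ideal by blast
  have xc: "x \<in> carrier R" using step by (simp add: nzd_def)
  have L: "ideal ?L R" "J \<subseteq> ?L" "x \<in> ?L" using adj_ideal[OF J xc] adj_supset[OF J xc] adj_mem[OF J xc] .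
  have x: "\<And>n. nzd (pw J n) x" using colon_compat_nzd_pw[OF J reg_ideal_colon_compat] step by blast
  have cL: "colon_compat ?L" using reg_ideal_colon_compat[OF reg_ideal.step] step by blast
  have q: "ideal q R" "primeideal q R" "?L \<subseteq> q" "J \<subseteq> q" "x \<in> q" using step.prems prime_ideal L by auto
  have gJ: "gr_prime J q" using step q by blast
  have "u \<in> pw ?L n \<cdot> q \<or> v \<in> pw ?L k \<cdot> q"
    if "u \<in> pw ?L n" "v \<in> pw ?L k" "u \<otimes> v \<in> pw ?L (n + k) \<cdot> q" for n k u v
    using that
  proof (induction "n + k" arbitrary: n k u v)
    case 0
    thus ?case using gr_prime_0[OF q(2,3) L(1) cL, of u v 0] by simp
  next
    case (Suc N)
    have clL: "\<And>n. ideal (pw ?L n) R" "\<And>n. ideal (pw ?L n \<cdot> q) R" "\<And>n. ideal (pw J n) R"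
      using L J q pw_ideal ideal_prod_is_ideal by auto
    have uvc: "u \<in> carrier R" "v \<in> carrier R" using Suc.prems clL idl_carr by blast+
    consider "n = 0" | "k = 0" | n' k' where "n = Suc n'" "k = Suc k'" by (metis not0_implies_Suc)
    thus ?case
    proof cases
      case 1 thus ?thesis using gr_prime_0[OF q(2,3) L(1) cL, of u v k] Suc.prems by simp
    next
      case 2
      hence "v \<in> pw ?L 0 \<cdot> q \<or> u \<in> pw ?L n \<cdot> q"
        using gr_prime_0[OF q(2,3) L(1) cL, of v u n] Suc.prems uvc by (simp add: m_comm)
      thus ?thesis using 2 by blast
    next
      case (3 n' k')
      \<comment> \<open>The case where the \<open>x\<close>-free part \<open>u'\<close> of one
        factor vanishes modulo \<open>q\<close>: up to a negligible term \<open>u\<close> is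
        \<open>x u1\<close>, and the induction applies to \<open>u1 v\<close>.\<close>
      have half: "u \<in> pw ?L (Suc n) \<cdot> q \<or> v \<in> pw ?L k \<cdot> q"
        if h: "u' \<in> pw J (Suc n) \<cdot> q" "u1 \<in> pw ?L n" "u = u' \<oplus> x \<otimes> u1" "v \<in> pw ?L k"
          "u \<otimes> v \<in> pw ?L (Suc n + k) \<cdot> q" "N = n + k" for u v u' u1 n k
      proof -
        have u': "u' \<in> pw ?L (Suc n) \<cdot> q" using prod_mono[OF pw_mono[OF L(2)] order_refl] h(1) by blast
        have c: "u' \<in> carrier R" "u1 \<in> carrier R" "v \<in> carrier R"
          using idl_carr[OF clL(2) u'] idl_carr[OF clL(1) h(2)] idl_carr[OF clL(1) h(4)] .
        have "u \<otimes> v \<ominus> u' \<otimes> v \<in> pw ?L (Suc n + k) \<cdot> q"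
          using idl_minus[OF clL(2) h(5) pw_mult_prod'[OF L(1) q(1) u' h(4)]] .
        moreover have "u \<otimes> v \<ominus> u' \<otimes> v = \<zero> \<oplus> x \<otimes> (u1 \<otimes> v)" unfolding h(3) using c xc by algebra
        ultimately have "\<zero> \<oplus> x \<otimes> (u1 \<otimes> v) \<in> pw ?L (Suc (n + k)) \<cdot> q" by simp
        hence "u1 \<otimes> v \<in> pw ?L (n + k) \<cdot> q"
          using pw_components(2)[OF J x q(1,3) idl_zero[OF clL(3)] pw_mult[OF L(1) h(2,4)]] by blast
        hence "u1 \<in> pw ?L n \<cdot> q \<or> v \<in> pw ?L k \<cdot> q" using Suc.hyps(1)[OF h(6) h(2,4)] by blast
        thus ?thesis
        proof
          assume "u1 \<in> pw ?L n \<cdot> q"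
          hence "x \<otimes> u1 \<in> pw ?L (Suc n) \<cdot> q" unfolding pw_Suc_prod[OF L(1) q(1)]
            by (rule ideal_prod.prod[OF L(3)])
          thus ?thesis using idl_add[OF clL(2) u'] h(3) by blast
        qed blast
      qed
      obtain u' u1 where u: "u' \<in> pw J (Suc n')" "u1 \<in> pw ?L n'" "u = u' \<oplus> x \<otimes> u1"
        using pw_decomp'[OF J xc, of u n'] Suc.prems 3 by auto
      obtain v' v1 where v: "v' \<in> pw J (Suc k')" "v1 \<in> pw ?L k'" "v = v' \<oplus> x \<otimes> v1"
        using pw_decomp'[OF J xc, of v k'] Suc.prems 3 by auto
      have c: "u' \<in> carrier R" "u1 \<in> carrier R" "v' \<in> carrier R" "v1 \<in> carrier R"
        using idl_carr[OF clL(3) u(1)] idl_carr[OF clL(1) u(2)] idl_carr[OF clL(3) v(1)] idl_carr[OF clL(1) v(2)] .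
      have u'L: "u' \<in> pw ?L (Suc n')" using u(1) pw_mono[OF L(2)] by blast
      let ?r = "u' \<otimes> v1 \<oplus> u1 \<otimes> v"
      have "u' \<otimes> v1 \<in> pw ?L (Suc (n' + k'))" using pw_mult[OF L(1) u'L v(2)] by simp
      moreover have "u1 \<otimes> v \<in> pw ?L (Suc (n' + k'))" using pw_mult[OF L(1) u(2), of v k] Suc.prems 3 by simp
      ultimately have r: "?r \<in> pw ?L (Suc (n' + k'))" using idl_add[OF clL(1)] by blast
      have "u \<otimes> v = u' \<otimes> v' \<oplus> x \<otimes> ?r" unfolding u(3) v(3) using c xc by algebra
      hence "u' \<otimes> v' \<oplus> x \<otimes> ?r \<in> pw ?L (Suc (Suc (n' + k'))) \<cdot> q" using Suc.prems(3) 3 by simp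
      moreover have "u' \<otimes> v' \<in> pw J (Suc (Suc (n' + k')))" using pw_mult[OF J u(1) v(1)] by simp
      ultimately have "u' \<otimes> v' \<in> pw J (Suc (Suc (n' + k'))) \<cdot> q"
        using pw_components(1)[OF J x q(1,3) _ r] by blast
      hence "u' \<otimes> v' \<in> pw J (Suc n' + Suc k') \<cdot> q" by simp
      hence "u' \<in> pw J (Suc n') \<cdot> q \<or> v' \<in> pw J (Suc k') \<cdot> q"
        using gJ u(1) v(1) unfolding gr_prime_def by blast
      thus ?thesis
      proof
        assume "u' \<in> pw J (Suc n') \<cdot> q"
        thus ?thesis using half[OF _ u(2,3), of v k] Suc.prems Suc.hyps(2) 3 by simp
      next
        assume v': "v' \<in> pw J (Suc k') \<cdot> q"
        have "v \<otimes> u \<in> pw ?L (Suc k' + n) \<cdot> q" using Suc.prems(3) 3 uvc by (simp add: m_comm add.commute)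
        hence "v \<in> pw ?L (Suc k') \<cdot> q \<or> u \<in> pw ?L n \<cdot> q"
          using half[OF v' v(2,3), of u n] Suc.prems(1) Suc.hyps(2) 3 by simp
        thus ?thesis using 3 by blast
      qed
    qed
  qed
  thus ?case unfolding gr_prime_def by blast
qed

end

section \<open>The reduction number of a link\<close>

context cring begin

lemma prime_complD:
  assumes "primeideal p R" "a \<in> carrier R - p" "b \<in> carrier R - p"
  shows "a \<otimes> b \<in> carrier R - p"
  using assms prime_multD by blast

lemma Idl_Cons: "set (x # zs) \<subseteq> carrier R \<Longrightarrow> Idl (set (x # zs)) = adj (Idl (set zs)) x"
  using adj_eq_genideal[of "set zs" x] by simp

text \<open>Steinitz exchange after localizing at \<open>p\<close>; the element \<open>r\<close> clears the denominators.\<close>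

lemma reg_ideal_exchange:
  assumes "reg_ideal g J" "primeideal p R" "y \<in> J" "y \<notin> p \<cdot> J"
  shows "\<exists>zs r. Suc (length zs) = g \<and> set zs \<subseteq> J \<and> r \<in> carrier R - p \<and>
    (\<forall>l\<in>J. r \<otimes> l \<in> adj (Idl (set zs)) y) \<and> (\<forall>e\<in>carrier R. e \<otimes> y \<in> Idl (set zs) \<longrightarrow> r \<otimes> e \<in> J)"
  using assms
proof (induction arbitrary: y rule: reg_ideal.induct)
  case zero
  have "\<zero> \<in> p \<cdot> {\<zero>}" using idl_zero ideal_prod_is_ideal zeroideal zero prime_ideal by blast
  thus ?case using zero by simp
next
  case (step g J x)
  let ?L = "adj J x"
  note p = \<open>primeideal p R\<close>
  have J: "ideal J R" using step reg_ideal_ideal by blast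
  have xc: "x \<in> carrier R" using step by (simp add: nzd_def)
  have L: "ideal ?L R" "J \<subseteq> ?L" "x \<in> ?L" using adj_ideal[OF J xc] adj_supset[OF J xc] adj_mem[OF J xc] .
  have pi: "ideal p R" using p prime_ideal by blast
  obtain y' t where y: "y' \<in> J" "t \<in> carrier R" "y = y' \<oplus> t \<otimes> x" using \<open>y \<in> ?L\<close> by (auto simp: mem_adj)
  have c: "y' \<in> carrier R" "y \<in> carrier R" using idl_carr[OF J y(1)] idl_carr[OF L(1) \<open>y \<in> ?L\<close>] .
  show ?case
  proof (cases "t \<in> p")
    case False
    \<comment> \<open>The coefficient \<open>t\<close> of \<open>x\<close> is a unit locally, so
      \<open>y\<close> takes the place of \<open>x\<close> and the generators of \<open>J\<close>
      are kept.\<close>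
    obtain zs where zs: "set zs \<subseteq> carrier R" "length zs = g" "J = Idl (set zs)"
      using reg_ideal_generators step by blast
    have "set zs \<subseteq> ?L" using genideal_self[OF zs(1)] zs(3) L(2) by blast
    moreover have "t \<otimes> l \<in> adj J y" if l: "l \<in> ?L" for l
    proof -
      obtain k s where ks: "k \<in> J" "s \<in> carrier R" "l = k \<oplus> s \<otimes> x" using l unfolding mem_adj by blast
      have kc: "k \<in> carrier R" using idl_carr[OF J ks(1)] .
      have "t \<otimes> k \<ominus> s \<otimes> y' \<in> J" using idl_minus[OF J idl_l[OF J ks(1) y(2)] idl_l[OF J y(1) ks(2)]] .
      hence "(t \<otimes> k \<ominus> s \<otimes> y') \<oplus> s \<otimes> y \<in> adj J y" using ks(2) by (rule adjI)
      moreover have "(t \<otimes> k \<ominus> s \<otimes> y') \<oplus> s \<otimes> y = t \<otimes> l" unfolding ks(3) y(3) using kc ks(2) c y(2) xc by algebra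
      ultimately show ?thesis by simp
    qed
    moreover have "t \<otimes> e \<in> ?L" if e: "e \<in> carrier R" "e \<otimes> y \<in> J" for e
    proof -
      have "e \<otimes> y \<ominus> e \<otimes> y' \<in> J" using idl_minus[OF J e(2) idl_l[OF J y(1) e(1)]] .
      moreover have "e \<otimes> y \<ominus> e \<otimes> y' = (t \<otimes> e) \<otimes> x" unfolding y(3) using c y(2) xc e(1) by algebra
      ultimately have "t \<otimes> e \<in> J" using nzdD[OF step(2)] e y by simp
      thus ?thesis using L by blast
    qed
    ultimately show ?thesis using zs y False
      by (intro exI[of _ zs] exI[of _ t]) simp
  next
    case True
    \<comment> \<open>Here \<open>t x\<close> lies in \<open>p ?L\<close>, so \<open>y'\<close>
      inherits the assumption on \<open>y\<close> and is exchanged inside \<open>J\<close>, while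
      \<open>x\<close> stays as a further generator.\<close>
    have "y' \<notin> p \<cdot> J"
    proof
      assume "y' \<in> p \<cdot> J"
      hence "y' \<in> p \<cdot> ?L" using prod_mono[OF order_refl L(2)] by blast
      moreover have "t \<otimes> x \<in> p \<cdot> ?L" by (rule ideal_prod.prod[OF True L(3)])
      ultimately show False using idl_add[OF ideal_prod_is_ideal[OF pi L(1)]] y(3) step.prems(3) by blast
    qed
    then obtain zs r where zs: "Suc (length zs) = g" "set zs \<subseteq> J" "r \<in> carrier R - p"
      "\<forall>l\<in>J. r \<otimes> l \<in> adj (Idl (set zs)) y'" "\<forall>e\<in>carrier R. e \<otimes> y' \<in> Idl (set zs) \<longrightarrow> r \<otimes> e \<in> J"
      using step.IH[OF p y(1)] by blast
    let ?Z = "Idl (set zs)"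
    have zc: "set zs \<subseteq> carrier R" using zs J idl_sub by blast
    have Z: "ideal ?Z R" "?Z \<subseteq> J" using genideal_ideal[OF zc] genideal_minimal[OF J zs(2)] .
    have e: "Idl (set (x # zs)) = adj ?Z x" using Idl_Cons zc xc by simp
    have Zx: "ideal (adj ?Z x) R" using adj_ideal[OF Z(1) xc] .
    have rc: "r \<in> carrier R" using zs by blast
    have 1: "r \<otimes> r \<otimes> l \<in> adj (adj ?Z x) y" if l: "l \<in> ?L" for l
    proof -
      obtain k s where ks: "k \<in> J" "s \<in> carrier R" "l = k \<oplus> s \<otimes> x" using l unfolding mem_adj by blast
      obtain z m where zm: "z \<in> ?Z" "m \<in> carrier R" "r \<otimes> k = z \<oplus> m \<otimes> y'" using zs(4) ks(1) by (auto simp: mem_adj)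
      have kc: "k \<in> carrier R" "z \<in> carrier R" using idl_carr[OF J ks(1)] idl_carr[OF Z(1) zm(1)] .
      have "r \<otimes> l = r \<otimes> k \<oplus> (r \<otimes> s) \<otimes> x" unfolding ks(3) using rc kc ks(2) xc by algebra
      also have "\<dots> = (z \<oplus> (r \<otimes> s \<ominus> m \<otimes> t) \<otimes> x) \<oplus> m \<otimes> y"
        unfolding zm(3) y(3) using rc kc ks(2) xc zm(2) c y(2) by algebra
      also have "\<dots> \<in> adj (adj ?Z x) y"
        by (rule adjI[OF adjI[OF zm(1)] zm(2)]) (use rc ks zm y in auto)
      finally have "r \<otimes> (r \<otimes> l) \<in> adj (adj ?Z x) y" using idl_l[OF adj_ideal[OF Zx c(2)] _ rc] by blast
      thus ?thesis using rc idl_carr[OF L(1) l] by (simp add: m_assoc)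
    qed
    \<comment> \<open>First \<open>x\<close> is cancelled modulo \<open>J\<close>, then
      \<open>y'\<close> modulo \<open>?Z\<close>. The induction hypothesis is used twice, to express
      an element of \<open>J\<close> and to cancel \<open>y'\<close>, and each use costs a factor
      \<open>r\<close>.\<close>
    have 2: "r \<otimes> r \<otimes> e \<in> ?L" if e: "e \<in> carrier R" "e \<otimes> y \<in> adj ?Z x" for e
    proof -
      obtain z k where zk: "z \<in> ?Z" "k \<in> carrier R" "e \<otimes> y = z \<oplus> k \<otimes> x" using e by (auto simp: mem_adj)
      have zcc: "z \<in> carrier R" using idl_carr[OF Z(1) zk(1)] .
      have e1: "(k \<ominus> e \<otimes> t) \<otimes> x = e \<otimes> y' \<ominus> z"
      proof -
        have "(k \<ominus> e \<otimes> t) \<otimes> x = (z \<oplus> k \<otimes> x) \<ominus> z \<ominus> e \<otimes> t \<otimes> x" using zk(2) e(1) y(2) xc zcc by algebra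
        also have "\<dots> = e \<otimes> y' \<ominus> z" unfolding zk(3)[symmetric] y(3) using zk(2) e(1) y(2) xc zcc c by algebra
        finally show ?thesis .
      qed
      also have "\<dots> \<in> J" using idl_minus[OF J idl_l[OF J y(1) e(1)]] zk(1) Z(2) by blast
      finally have k1: "k \<ominus> e \<otimes> t \<in> J" using nzdD[OF step(2)] zk e y by simp
      obtain z2 l where z2: "z2 \<in> ?Z" "l \<in> carrier R" "r \<otimes> (k \<ominus> e \<otimes> t) = z2 \<oplus> l \<otimes> y'"
        using zs(4) k1 by (auto simp: mem_adj)
      have z2c: "z2 \<in> carrier R" using idl_carr[OF Z(1) z2(1)] .
      have "(r \<otimes> e \<ominus> l \<otimes> x) \<otimes> y' = r \<otimes> (e \<otimes> y' \<ominus> z) \<oplus> r \<otimes> z \<ominus> l \<otimes> x \<otimes> y'" using rc e(1) z2(2) xc c zcc by algebra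
      also have "\<dots> = (r \<otimes> (k \<ominus> e \<otimes> t)) \<otimes> x \<oplus> r \<otimes> z \<ominus> l \<otimes> x \<otimes> y'"
        unfolding e1[symmetric] using rc e(1) z2(2) xc c zcc zk(2) y(2) by algebra
      also have "\<dots> = r \<otimes> z \<oplus> x \<otimes> z2" unfolding z2(3) using rc e(1) z2(2) xc c zcc z2c by algebra
      also have "\<dots> \<in> ?Z" using idl_add[OF Z(1) idl_l[OF Z(1) zk(1) rc] idl_l[OF Z(1) z2(1) xc]] .
      finally have "r \<otimes> (r \<otimes> e \<ominus> l \<otimes> x) \<in> J" using zs(5) rc e(1) z2(2) xc by simp
      hence "r \<otimes> (r \<otimes> e \<ominus> l \<otimes> x) \<oplus> (r \<otimes> l) \<otimes> x \<in> ?L" using rc z2(2) by (intro adjI) auto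
      moreover have "r \<otimes> (r \<otimes> e \<ominus> l \<otimes> x) \<oplus> (r \<otimes> l) \<otimes> x = r \<otimes> r \<otimes> e" using rc e(1) z2(2) xc by algebra
      ultimately show ?thesis by simp
    qed
    have "r \<otimes> r \<in> carrier R - p" using prime_complD[OF p zs(3) zs(3)] .
    thus ?thesis using 1 2 zs L
      by (intro exI[of _ "x # zs"] exI[of _ "r \<otimes> r"]) (unfold e, auto)
  qed
qed

lemma link_reduction:
  assumes J: "reg_ideal g J" "J \<subseteq> p" and p: "primeideal p R"
    and not_reg: "\<And>zs r. set zs \<subseteq> p \<Longrightarrow> length zs = g \<Longrightarrow> r \<in> carrier R - p \<Longrightarrow> \<exists>c\<in>p. r \<otimes> c \<notin> Idl (set zs)"
  defines "I \<equiv> colon_ideal R J p"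
  shows "I \<subseteq> p" "I \<cdot> I \<subseteq> J \<cdot> I"
proof -
  have Ji: "ideal J R" using J reg_ideal_ideal by blast
  have pi: "ideal p R" using p prime_ideal by blast
  have I: "ideal I R" unfolding I_def using colon_ideal_ideal[OF Ji idl_sub[OF pi]] .
  have Ip: "i \<otimes> c \<in> J" if "i \<in> I" "c \<in> p" for i c using that by (simp add: I_def mem_colon)
  show Isub: "I \<subseteq> p"
  proof
    fix i assume i: "i \<in> I"
    \<comment> \<open>An \<open>i\<close> outside \<open>p\<close> would itself be a clearing
      factor, and the \<open>g\<close> generators of \<open>J\<close> would generate
      \<open>p\<close> locally.\<close>
    show "i \<in> p"
    proof (rule ccontr)
      assume "i \<notin> p"
      hence ic: "i \<in> carrier R - p" using idl_carr[OF I i] by blast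
      obtain zs where zs: "set zs \<subseteq> carrier R" "length zs = g" "J = Idl (set zs)"
        using reg_ideal_generators J by blast
      have "set zs \<subseteq> p" using genideal_self[OF zs(1)] zs(3) J(2) by blast
      from not_reg[OF this zs(2) ic] Ip[OF i] zs(3) show False by blast
    qed
  qed
  have pI: "a \<otimes> b \<in> p \<cdot> J" if a: "a \<in> p" and b: "b \<in> I" for a b
  proof (rule ccontr)
    assume n: "a \<otimes> b \<notin> p \<cdot> J"
    have c: "a \<in> carrier R" "b \<in> carrier R" using idl_carr[OF pi a] idl_carr[OF I b] .
    have "a \<otimes> b \<in> J" using Ip[OF b a] c by (simp add: m_comm)
    then obtain zs r where zs: "Suc (length zs) = g" "set zs \<subseteq> J" "r \<in> carrier R - p"
      "\<forall>l\<in>J. r \<otimes> l \<in> adj (Idl (set zs)) (a \<otimes> b)" "\<forall>e\<in>carrier R. e \<otimes> (a \<otimes> b) \<in> Idl (set zs) \<longrightarrow> r \<otimes> e \<in> J"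
      using reg_ideal_exchange[OF J(1) p _ n] by blast
    let ?Z = "Idl (set zs)"
    have zc: "set zs \<subseteq> carrier R" using zs Ji idl_sub by blast
    have Z: "ideal ?Z R" using genideal_ideal[OF zc] .
    have e: "Idl (set (a # zs)) = adj ?Z a" using Idl_Cons zc c by simp
    have Za: "ideal (adj ?Z a) R" using adj_ideal[OF Z c(1)] .
    have rc: "r \<in> carrier R" using zs by blast
    have sub: "adj ?Z (a \<otimes> b) \<subseteq> adj ?Z a"
      using adj_least[OF Za adj_supset[OF Z c(1)] idl_r[OF Za adj_mem[OF Z c(1)] c(2)]] .
    \<comment> \<open>\<open>b d\<close> is in \<open>J\<close>, hence locally
      \<open>z + l a b\<close>. Multiplying by \<open>a\<close> and cancelling \<open>a b\<close>
      shows that \<open>d\<close> is locally a multiple of \<open>a\<close> modulo \<open>J\<close>,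
      so \<open>a\<close> and \<open>zs\<close> generate \<open>p\<close> there. One factor
      \<open>r\<close> expresses \<open>b d\<close>, one pays for the cancellation, one expresses
      the resulting element of \<open>J\<close>.\<close>
    have "r \<otimes> (r \<otimes> r) \<otimes> d \<in> adj ?Z a" if d: "d \<in> p" for d
    proof -
      have dc: "d \<in> carrier R" using idl_carr[OF pi d] .
      have "r \<otimes> (b \<otimes> d) \<in> adj ?Z (a \<otimes> b)" using zs(4) Ip[OF b d] by blast
      then obtain z l where zl: "z \<in> ?Z" "l \<in> carrier R" "r \<otimes> (b \<otimes> d) = z \<oplus> l \<otimes> (a \<otimes> b)" by (auto simp: mem_adj)
      have zcc: "z \<in> carrier R" using idl_carr[OF Z zl(1)] .
      have "(r \<otimes> d \<ominus> l \<otimes> a) \<otimes> (a \<otimes> b) = a \<otimes> (r \<otimes> (b \<otimes> d)) \<ominus> a \<otimes> (l \<otimes> (a \<otimes> b))" using rc dc zl(2) c by algebra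
      also have "\<dots> = a \<otimes> z" unfolding zl(3) using zcc zl(2) c by algebra
      also have "\<dots> \<in> ?Z" using idl_l[OF Z zl(1) c(1)] .
      finally have "r \<otimes> (r \<otimes> d \<ominus> l \<otimes> a) \<in> J" using zs(5) rc dc zl(2) c by simp
      hence "r \<otimes> (r \<otimes> (r \<otimes> d \<ominus> l \<otimes> a)) \<in> adj ?Z a" using zs(4) sub by blast
      moreover have "(r \<otimes> r \<otimes> l) \<otimes> a \<in> adj ?Z a" using idl_l[OF Za adj_mem[OF Z c(1)]] rc zl(2) by simp
      ultimately have "r \<otimes> (r \<otimes> (r \<otimes> d \<ominus> l \<otimes> a)) \<oplus> (r \<otimes> r \<otimes> l) \<otimes> a \<in> adj ?Z a" by (rule idl_add[OF Za])
      moreover have "r \<otimes> (r \<otimes> (r \<otimes> d \<ominus> l \<otimes> a)) \<oplus> (r \<otimes> r \<otimes> l) \<otimes> a = r \<otimes> (r \<otimes> r) \<otimes> d"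
        using rc dc zl(2) c by algebra
      ultimately show ?thesis by simp
    qed
    moreover have "r \<otimes> (r \<otimes> r) \<in> carrier R - p" using prime_complD[OF p] zs(3) by blast
    moreover have "set (a # zs) \<subseteq> p" using a zs(2) J(2) by auto
    ultimately show False using not_reg[of "a # zs" "r \<otimes> (r \<otimes> r)"] zs(1) unfolding e by auto
  qed
  show "I \<cdot> I \<subseteq> J \<cdot> I"
  proof (rule prod_least[OF ideal_prod_is_ideal[OF Ji I]])
    fix b d assume bd: "b \<in> I" "d \<in> I"
    have c: "b \<in> carrier R" "d \<in> carrier R" using idl_carr[OF I bd(1)] idl_carr[OF I bd(2)] .
    have "b \<otimes> d \<in> p \<cdot> J" using pI bd Isub by blast
    hence bdJ: "b \<otimes> d \<in> pw J (Suc 0)" unfolding pw_one[OF Ji] using prod_sub_right[OF pi Ji] by blast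
    \<comment> \<open>The factor from \<open>p\<close> is absorbed by \<open>d\<close>: since
      \<open>d\<close> is in \<open>I\<close>, their product is in \<open>J\<close>. Hence
      \<open>p J\<close> times \<open>d\<close> lands in \<open>J^2\<close>.\<close>
    have "w \<otimes> d \<in> pw J (Suc 0) \<cdot> J" if "w \<in> p \<cdot> J" for w
      using that unfolding pw_one[OF Ji]
    proof (induction w rule: ideal_prod.induct)
      case (prod i j)
      have ij: "i \<in> carrier R" "j \<in> carrier R" using idl_carr[OF pi prod(1)] idl_carr[OF Ji prod(2)] .
      have "j \<otimes> (d \<otimes> i) \<in> J \<cdot> J" by (rule ideal_prod.prod[OF prod(2) Ip[OF bd(2) prod(1)]])
      moreover have "j \<otimes> (d \<otimes> i) = i \<otimes> j \<otimes> d" using ij c by algebra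
      ultimately show ?case by simp
    next
      case (sum s t)
      have "s \<in> carrier R" "t \<in> carrier R" using sum ideal_prod_is_ideal[OF pi Ji] idl_carr by blast+
      thus ?case using ideal_prod.sum[OF sum(3,4)] c by (simp add: l_distr)
    qed
    hence "(a \<otimes> b) \<otimes> d \<in> pw J (Suc 0) \<cdot> J" if "a \<in> p" for a using pI[OF that bd(1)] by blast
    hence "a \<otimes> (b \<otimes> d) \<in> pw J (Suc 0) \<cdot> J" if a: "a \<in> p" for a
      unfolding m_assoc[OF idl_carr[OF pi a] c, symmetric] using a by blast
    \<comment> \<open>The colon property in degree one, with \<open>K = J\<close> and
      \<open>A = p\<close>, is what yields \<open>I\<close> as the second factor.\<close>
    hence "b \<otimes> d \<in> pw J (Suc 0) \<cdot> colon_ideal R J p"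
      using colon_compatD[OF reg_ideal_colon_compat[OF J(1)] Ji order_refl idl_sub[OF pi] bdJ] by blast
    thus "b \<otimes> d \<in> J \<cdot> I" unfolding pw_one[OF Ji] I_def .
  qed
qed

lemma reduction_powers:
  assumes "ideal J R" "ideal I R" "J \<subseteq> I" "I \<cdot> I \<subseteq> J \<cdot> I"
  shows "pw I (Suc n) = pw J n \<cdot> I"
proof (induction n)
  case 0 thus ?case using assms by (simp add: ideal_prod_one prod_one_left)
next
  case (Suc n)
  have II: "I \<cdot> I = J \<cdot> I" using assms(4) prod_mono[OF assms(3) order_refl, of I] by blast
  note pwi = pw_ideal[OF assms(1), of n]
  have "pw I (Suc (Suc n)) = I \<cdot> (pw J n \<cdot> I)" using Suc by simp
  also have "\<dots> = pw J n \<cdot> (I \<cdot> I)"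
    using assms pwi ideal_prod_assoc ideal_prod_commute by metis
  also have "\<dots> = J \<cdot> pw J n \<cdot> I" unfolding II
    using assms pwi ideal_prod_assoc ideal_prod_commute by metis
  finally show ?case by simp
qed

section \<open>Convolution of sequences\<close>

text \<open>The Cauchy product, for arbitrary sequences, so that cancellation can be argued degree
  by degree; on \<open>up R\<close> it is the product of polynomials.\<close>

definition conv :: "(nat \<Rightarrow> 'a) \<Rightarrow> (nat \<Rightarrow> 'a) \<Rightarrow> nat \<Rightarrow> 'a" where
  "conv f h n = (\<Oplus>i\<in>{..n}. f i \<otimes> h (n - i))"

lemma conv_prime:
  assumes J: "ideal J R" "gr_prime J q" and q: "ideal q R"
    and f: "\<And>n. f n \<in> pw J n" "\<exists>n. f n \<notin> pw J n \<cdot> q" and v: "\<And>n. v n \<in> pw J n"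
    and fv: "\<And>n. conv f v n \<in> pw J n \<cdot> q"
  shows "v k \<in> pw J k \<cdot> q"
proof (rule ccontr)
  assume "v k \<notin> pw J k \<cdot> q"
  hence ex: "\<exists>k. v k \<notin> pw J k \<cdot> q" by blast
  \<comment> \<open>Lowest rather than leading terms, so that \<open>v\<close> need not have finite support.\<close>
  define n where "n = (LEAST n. f n \<notin> pw J n \<cdot> q)"
  define k where "k = (LEAST k. v k \<notin> pw J k \<cdot> q)"
  have n: "f n \<notin> pw J n \<cdot> q" "\<And>i. i < n \<Longrightarrow> f i \<in> pw J i \<cdot> q"
    unfolding n_def using LeastI_ex[OF f(2)] not_less_Least by auto
  have k: "v k \<notin> pw J k \<cdot> q" "\<And>i. i < k \<Longrightarrow> v i \<in> pw J i \<cdot> q"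
    unfolding k_def using LeastI_ex[OF ex] not_less_Least by auto
  have cl: "\<And>n. ideal (pw J n) R" "\<And>n. ideal (pw J n \<cdot> q) R"
    using J q pw_ideal ideal_prod_is_ideal by auto
  have c: "\<And>n. f n \<in> carrier R" "\<And>n. v n \<in> carrier R" using idl_carr cl f(1) v by blast+
  let ?N = "n + k" and ?g = "\<lambda>i. f i \<otimes> v (n + k - i)"
  have g: "?g \<in> {..?N} \<rightarrow> carrier R" using c by auto
  have "{..?N} = insert n ({..?N} - {n})" by auto
  hence "conv f v ?N = finsum R ?g (insert n ({..?N} - {n}))" unfolding conv_def by simp
  also have "\<dots> = ?g n \<oplus> finsum R ?g ({..?N} - {n})"
    using c by (intro finsum_insert) auto
  finally have e: "conv f v ?N = f n \<otimes> v k \<oplus> finsum R ?g ({..?N} - {n})" by simp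
  \<comment> \<open>Away from \<open>i = n\<close> one of the two factors sits below its lowest
    index and is negligible, so only \<open>f n\<close> times \<open>v k\<close> matters in this
    degree.\<close>
  have "finsum R ?g ({..?N} - {n}) \<in> pw J ?N \<cdot> q"
  proof (rule idl_finsum[OF cl(2)])
    fix i assume i: "i \<in> {..?N} - {n}"
    show "?g i \<in> pw J ?N \<cdot> q"
    proof (cases "i < n")
      case True
      have "?g i \<in> pw J (i + (n + k - i)) \<cdot> q" by (rule pw_mult_prod'[OF J(1) q n(2)[OF True] v])
      thus ?thesis using i by simp
    next
      case False
      hence "n + k - i < k" using i by auto
      from pw_mult_prod[OF J(1) q f(1)[of i] k(2)[OF this]] show ?thesis using i by simp
    qed
  qed simp
  moreover have "conv f v ?N \<in> pw J ?N \<cdot> q" by (rule fv)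
  ultimately have "f n \<otimes> v k \<in> pw J ?N \<cdot> q"
    unfolding e by (intro idl_add_cancel'[OF cl(2) _ m_closed[OF c]])
  thus False using J(2) f(1) v n(1) k(1) unfolding gr_prime_def by blast
qed

lemma prod_adj_decomp:
  assumes M: "ideal M R" and K: "ideal K R" and c: "c \<in> carrier R"
  shows "w \<in> M \<cdot> adj K c \<Longrightarrow> \<exists>k\<in>M \<cdot> K. \<exists>v\<in>M. w = k \<oplus> c \<otimes> v"
proof (induction w rule: ideal_prod.induct)
  note MK = ideal_prod_is_ideal[OF M K]
  {
    case (prod i y)
    then obtain k r where y: "k \<in> K" "r \<in> carrier R" "y = k \<oplus> r \<otimes> c" by (auto simp: mem_adj)
    have cc: "i \<in> carrier R" "k \<in> carrier R" using idl_carr[OF M prod(1)] idl_carr[OF K y(1)] .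
    have "i \<otimes> y = i \<otimes> k \<oplus> c \<otimes> (r \<otimes> i)" unfolding y(3) using cc y(2) c by algebra
    thus ?case using ideal_prod.prod[OF prod(1) y(1), of R] idl_l[OF M prod(1) y(2)] by blast
  next
    case (sum s t)
    obtain k v k' v' where 1: "k \<in> M \<cdot> K" "v \<in> M" "s = k \<oplus> c \<otimes> v"
      and 2: "k' \<in> M \<cdot> K" "v' \<in> M" "t = k' \<oplus> c \<otimes> v'" using sum(3,4) by blast
    have cc: "k \<in> carrier R" "v \<in> carrier R" "k' \<in> carrier R" "v' \<in> carrier R"
      using idl_carr[OF MK 1(1)] idl_carr[OF M 1(2)] idl_carr[OF MK 2(1)] idl_carr[OF M 2(2)] .
    have "s \<oplus> t = (k \<oplus> k') \<oplus> c \<otimes> (v \<oplus> v')" unfolding 1(3) 2(3) using cc c by algebra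
    thus ?case using idl_add[OF MK 1(1) 2(1)] idl_add[OF M 1(2) 2(2)] by blast
  }
qed

end

context noetherian_cring begin

text \<open>A polynomial outside \<open>q\<close> is a nonzerodivisor on (R/K)[T] once the constants
  are localized at \<open>q\<close>. The Noetherian induction amounts to a prime filtration of R/K:
  factors R/Q with \<open>Q\<close> not inside \<open>q\<close> die in the localization, and by
  minimality of \<open>q\<close> the only others are R/q, whose polynomials form a domain.\<close>

lemma conv_cancel:
  assumes J: "reg_ideal g J" and q: "primeideal q R" "J \<subseteq> q"
    and min: "\<And>Q. primeideal Q R \<Longrightarrow> J \<subseteq> Q \<Longrightarrow> Q \<subseteq> q \<Longrightarrow> Q = q"
    and f: "\<And>n. f n \<in> pw J n" "\<exists>n. f n \<notin> pw J n \<cdot> q" and h: "\<And>n. h n \<in> pw J n"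
    and K: "ideal K R"
  shows "J \<subseteq> K \<Longrightarrow> (\<And>n. conv f h n \<in> pw J n \<cdot> K) \<Longrightarrow> \<exists>s\<in>carrier R - q. \<forall>n. s \<otimes> h n \<in> pw J n \<cdot> K"
  using K
proof (induction K rule: ideal_noetherian_induct)
  case (step K)
  note K = step(1)
  have Ji: "ideal J R" using J reg_ideal_ideal by blast
  have qi: "ideal q R" using q prime_ideal by blast
  have hc: "\<And>n. h n \<in> carrier R" "\<And>n. f n \<in> carrier R" using idl_carr pw_ideal[OF Ji] h f(1) by blast+
  have cl: "\<And>n. ideal (pw J n) R" "\<And>n. ideal (pw J n \<cdot> K) R" "\<And>n. ideal (pw J n \<cdot> q) R"
    using pw_ideal[OF Ji] ideal_prod_is_ideal[OF pw_ideal[OF Ji]] K qi by auto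
  show ?case
  proof (cases "\<one> \<in> K")
    case True
    hence "K = carrier R" using ideal.one_imp_carrier[OF K] by blast
    hence "\<one> \<otimes> h n \<in> pw J n \<cdot> K" for n using ideal_prod_one[OF pw_ideal[OF Ji]] hc h by simp
    moreover have "\<one> \<in> carrier R - q" using prime_one[OF q(1)] by simp
    ultimately show ?thesis by blast
  next
    case False
    obtain c where c: "c \<in> carrier R" "primeideal (colon_ideal R K {c}) R"
      using exists_colon_prime[OF K one_closed False] by blast
    let ?Q = "colon_ideal R K {c}" and ?K = "adj K c"
    have "c \<notin> K" using prime_one[OF c(2)] c(1) by (auto simp: mem_colon)
    hence KK: "ideal ?K R" "K \<subset> ?K" using adj_ideal[OF K c(1)] adj_supset[OF K c(1)] adj_mem[OF K c(1)] by auto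
    have "conv f h n \<in> pw J n \<cdot> ?K" for n using step(4)[of n] prod_mono[OF order_refl, of K ?K] KK by blast
    then obtain s where s: "s \<in> carrier R - q" "\<And>n. s \<otimes> h n \<in> pw J n \<cdot> ?K"
      using step(2)[OF KK] step(3) KK by blast
    have "\<forall>n. \<exists>k v. k \<in> pw J n \<cdot> K \<and> v \<in> pw J n \<and> s \<otimes> h n = k \<oplus> c \<otimes> v" using prod_adj_decomp[OF cl(1) K c(1) s(2)] by blast
    then obtain k v where kv: "\<And>n. k n \<in> pw J n \<cdot> K" "\<And>n. v n \<in> pw J n" "\<And>n. s \<otimes> h n = k n \<oplus> c \<otimes> v n"
      by metis
    have kc: "k n \<in> carrier R" "v n \<in> carrier R" "s \<in> carrier R" for n
      using idl_carr[OF cl(2) kv(1)] idl_carr[OF cl(1) kv(2)] s by blast+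
    show ?thesis
    proof (cases "?Q \<subseteq> q")
      case False
      \<comment> \<open>\<open>t\<close> kills the class of \<open>c\<close> modulo
        \<open>K\<close>, so multiplying by it removes the term \<open>c v n\<close>.\<close>
      then obtain t where t: "t \<in> ?Q" "t \<notin> q" by blast
      hence tc: "t \<in> carrier R" "t \<otimes> c \<in> K" by (auto simp: mem_colon)
      have "t \<otimes> s \<otimes> h n \<in> pw J n \<cdot> K" for n
      proof -
        have "t \<otimes> s \<otimes> h n = t \<otimes> (s \<otimes> h n)" using tc kc hc by (simp add: m_assoc)
        also have "\<dots> = t \<otimes> k n \<oplus> v n \<otimes> (t \<otimes> c)" unfolding kv(3) using tc(1) kc c(1) by algebra
        also have "\<dots> \<in> pw J n \<cdot> K"
          using idl_add[OF cl(2) idl_l[OF cl(2) kv(1) tc(1)] ideal_prod.prod[OF kv(2) tc(2)]] .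
        finally show ?thesis .
      qed
      moreover have "t \<otimes> s \<in> carrier R - q" using prime_complD[OF q(1)] s t tc by blast
      ultimately show ?thesis by blast
    next
      case True
      have "K \<subseteq> ?Q" using colon_supset[OF K] c(1) by simp
      hence Qq: "?Q = q" using min[OF c(2)] step(3) True by blast
      have "conv f v n \<in> pw J n \<cdot> q" for n
      proof -
        have cfk: "conv f k n \<in> pw J n \<cdot> K" unfolding conv_def
        proof (rule idl_finsum[OF cl(2)])
          fix i assume "i \<in> {..n}"
          thus "f i \<otimes> k (n - i) \<in> pw J n \<cdot> K" using pw_mult_prod[OF Ji K f(1) kv(1), of i "n - i"] by simp
        qed simp
        have cfv: "conv f v n \<in> pw J n" unfolding conv_def
        proof (rule idl_finsum[OF cl(1)])
          fix i assume "i \<in> {..n}"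
          thus "f i \<otimes> v (n - i) \<in> pw J n" using pw_mult[OF Ji f(1) kv(2), of i "n - i"] by simp
        qed simp
        have cc: "conv f h n \<in> carrier R" "conv f k n \<in> carrier R" "conv f v n \<in> carrier R"
          unfolding conv_def using hc kc by (auto intro: finsum_closed)
        have "s \<otimes> conv f h n = (\<Oplus>i\<in>{..n}. s \<otimes> (f i \<otimes> h (n - i)))"
          unfolding conv_def using hc kc by (intro finsum_rdistr) auto
        also have "\<dots> = (\<Oplus>i\<in>{..n}. f i \<otimes> k (n - i) \<oplus> c \<otimes> (f i \<otimes> v (n - i)))"
        proof (rule finsum_cong')
          fix i assume "i \<in> {..n}"
          have "s \<otimes> (f i \<otimes> h (n - i)) = f i \<otimes> (s \<otimes> h (n - i))" using hc kc by (simp add: m_lcomm)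
          also have "\<dots> = f i \<otimes> k (n - i) \<oplus> c \<otimes> (f i \<otimes> v (n - i))" unfolding kv(3) using hc kc c(1) by algebra
          finally show "s \<otimes> (f i \<otimes> h (n - i)) = f i \<otimes> k (n - i) \<oplus> c \<otimes> (f i \<otimes> v (n - i))" .
        qed (use hc kc c in auto)
        also have "\<dots> = conv f k n \<oplus> (\<Oplus>i\<in>{..n}. c \<otimes> (f i \<otimes> v (n - i)))"
          unfolding conv_def using hc kc c by (intro finsum_addf) auto
        also have "(\<Oplus>i\<in>{..n}. c \<otimes> (f i \<otimes> v (n - i))) = c \<otimes> conv f v n"
          unfolding conv_def using hc kc c by (intro finsum_rdistr[symmetric]) auto
        finally have e: "s \<otimes> conv f h n = conv f k n \<oplus> c \<otimes> conv f v n" .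
        have "s \<otimes> conv f h n \<in> pw J n \<cdot> K" using idl_l[OF cl(2) step(4) kc(3)] .
        hence "c \<otimes> conv f v n \<in> pw J n \<cdot> K"
          unfolding e using idl_add_cancel[OF cl(2) cfk] c(1) cc(3) by simp
        \<comment> \<open>Being killed by \<open>c\<close> modulo \<open>K\<close> means having
          coefficients in \<open>K : c\<close>, which is \<open>q\<close> here.\<close>
        hence "conv f v n \<in> pw J n \<cdot> ?Q"
          using c(1) by (intro colon_compatD[OF reg_ideal_colon_compat[OF J] K step(3) _ cfv]) auto
        thus ?thesis unfolding Qq .
      qed
      hence v: "v n \<in> pw J n \<cdot> q" for n
        using conv_prime[OF Ji reg_ideal_gr_prime[OF J q] qi f kv(2)] by blast
      have cv: "w \<otimes> c \<in> pw J n \<cdot> K" if "w \<in> pw J n \<cdot> q" for w n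
        using that
      proof (induction w rule: ideal_prod.induct)
        case (prod i j)
        have "j \<otimes> c \<in> K" "j \<in> carrier R" using prod(2) Qq by (auto simp: mem_colon)
        moreover have "i \<in> carrier R" using idl_carr[OF cl(1) prod(1)] .
        ultimately show ?case using ideal_prod.prod[OF prod(1), of "j \<otimes> c" K R] c(1) by (simp add: m_assoc)
      next
        case (sum a b)
        have "a \<in> carrier R" "b \<in> carrier R" using idl_carr[OF cl(3)] sum by blast+
        thus ?case using idl_add[OF cl(2) sum(3,4)] c(1) by (simp add: l_distr)
      qed
      have "s \<otimes> h n \<in> pw J n \<cdot> K" for n
        unfolding kv(3) using idl_add[OF cl(2) kv(1) cv[OF v]] kc c(1) by (simp add: m_comm)
      thus ?thesis using s by blast
    qed
  qed
qed

end

section \<open>Incomparability for finite extensions\<close>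

context cring begin

text \<open>Membership in Q + B e_1 + ... + B e_n, arranged so that the generators can be eliminated
  one at a time.\<close>

primrec in_span :: "'a set \<Rightarrow> 'a set \<Rightarrow> 'a list \<Rightarrow> 'a \<Rightarrow> bool" where
  "in_span B Q [] v \<longleftrightarrow> v \<in> Q"
| "in_span B Q (e # es) v \<longleftrightarrow> (\<exists>b\<in>B. in_span B Q es (v \<ominus> b \<otimes> e))"

lemma in_span_cong:
  assumes "ideal Q R" "B \<subseteq> carrier R"
  shows "set es \<subseteq> carrier R \<Longrightarrow> u \<in> carrier R \<Longrightarrow> v \<in> carrier R \<Longrightarrow> u \<ominus> v \<in> Q \<Longrightarrow> in_span B Q es u \<Longrightarrow> in_span B Q es v"
proof (induction es arbitrary: u v)
  case Nil
  have "v = u \<ominus> (u \<ominus> v)" using Nil.prems(2,3) by algebra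
  thus ?case using Nil.prems idl_minus[OF assms(1)] by (metis in_span.simps(1))
next
  case (Cons e es)
  then obtain b where b: "b \<in> B" "in_span B Q es (u \<ominus> b \<otimes> e)" by auto
  have c: "b \<in> carrier R" "e \<in> carrier R" using b assms Cons.prems by auto
  have "(u \<ominus> b \<otimes> e) \<ominus> (v \<ominus> b \<otimes> e) = u \<ominus> v" using c Cons.prems(2,3) by algebra
  hence "in_span B Q es (v \<ominus> b \<otimes> e)" using Cons.IH[OF _ _ _ _ b(2)] Cons.prems c by auto
  thus ?case using b by auto
qed

lemma in_span_combination:
  assumes Q: "ideal Q R" and B: "subring B R" and cd: "c \<in> B" "d \<in> B"
  shows "set es \<subseteq> carrier R \<Longrightarrow> u \<in> carrier R \<Longrightarrow> v \<in> carrier R \<Longrightarrow> in_span B Q es u \<Longrightarrow> in_span B Q es v \<Longrightarrow>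
    in_span B Q es (c \<otimes> u \<ominus> d \<otimes> v)"
proof (induction es arbitrary: u v)
  case Nil
  have "c \<in> carrier R" "d \<in> carrier R" using cd subringE(1)[OF B] by auto
  thus ?case using Nil idl_minus[OF Q idl_l[OF Q] idl_l[OF Q]] by simp
next
  case (Cons e es)
  have cc: "c \<in> carrier R" "d \<in> carrier R" "e \<in> carrier R" using cd subringE(1)[OF B] Cons.prems by auto
  from Cons.prems obtain a b where ab: "a \<in> B" "in_span B Q es (u \<ominus> a \<otimes> e)" "b \<in> B" "in_span B Q es (v \<ominus> b \<otimes> e)"
    by auto
  have abc: "a \<in> carrier R" "b \<in> carrier R" using ab subringE(1)[OF B] by auto
  have "in_span B Q es (c \<otimes> (u \<ominus> a \<otimes> e) \<ominus> d \<otimes> (v \<ominus> b \<otimes> e))"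
    using Cons.IH[OF _ _ _ ab(2,4)] Cons.prems abc by auto
  moreover have "c \<otimes> (u \<ominus> a \<otimes> e) \<ominus> d \<otimes> (v \<ominus> b \<otimes> e) = (c \<otimes> u \<ominus> d \<otimes> v) \<ominus> (c \<otimes> a \<ominus> d \<otimes> b) \<otimes> e"
    using cc abc Cons.prems(2,3) by algebra
  moreover have "c \<otimes> a \<ominus> d \<otimes> b \<in> B"
    using subringE(5,6,7)[OF B] ab cd by (simp add: a_minus_def)
  ultimately show ?case by auto
qed

lemma subring_finsum:
  assumes "subring B R" "finite X" "\<forall>i\<in>X. f i \<in> B" shows "finsum R f X \<in> B"
  using assms(2,3)
proof (induction X)
  case empty thus ?case using subringE(2)[OF assms(1)] by simp
next
  case (insert i X)
  have "f \<in> X \<rightarrow> carrier R" "f i \<in> carrier R" using insert.prems subringE(1)[OF assms(1)] by auto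
  thus ?case using insert subringE(7)[OF assms(1)] by auto
qed

text \<open>More elements than generators of a module over a domain, here \<open>B\<close> modulo
  \<open>Q\<close>, are linearly dependent. Gaussian elimination is done without division, by
  cross-multiplying with a pivot \<open>c k\<close>.\<close>

lemma span_dependence:
  assumes Q: "primeideal Q R" and B: "subring B R"
  shows "set es \<subseteq> carrier R \<Longrightarrow> finite X \<Longrightarrow> length es < card X \<Longrightarrow> v \<in> X \<rightarrow> carrier R \<Longrightarrow>
    (\<And>i. i \<in> X \<Longrightarrow> in_span B Q es (v i)) \<Longrightarrow>
    \<exists>b. (\<forall>i\<in>X. b i \<in> B) \<and> (\<exists>i\<in>X. b i \<notin> Q) \<and> (\<Oplus>i\<in>X. b i \<otimes> v i) \<in> Q"
proof (induction es arbitrary: X v)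
  case Nil
  have Qi: "ideal Q R" using Q prime_ideal by blast
  have "X \<noteq> {}" using Nil by auto
  moreover have "(\<Oplus>i\<in>X. \<one> \<otimes> v i) \<in> Q"
    using Nil by (intro idl_finsum[OF Qi]) (auto simp: Pi_iff)
  moreover have "\<one> \<in> B" "\<one> \<notin> Q" using subringE(3)[OF B] prime_one[OF Q] .
  ultimately show ?case by (intro exI[of _ "\<lambda>_. \<one>"]) auto
next
  case (Cons e es)
  have Qi: "ideal Q R" using Q prime_ideal by blast
  note Bs = subringE(1)[OF B]
  have ec: "e \<in> carrier R" "set es \<subseteq> carrier R" using Cons.prems by auto
  have "\<forall>i\<in>X. \<exists>c\<in>B. in_span B Q es (v i \<ominus> c \<otimes> e)" using Cons.prems(5) by auto
  then obtain c where c: "\<And>i. i \<in> X \<Longrightarrow> c i \<in> B" "\<And>i. i \<in> X \<Longrightarrow> in_span B Q es (v i \<ominus> c i \<otimes> e)"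
    by metis
  have cc: "\<And>i. i \<in> X \<Longrightarrow> c i \<in> carrier R" "\<And>i. i \<in> X \<Longrightarrow> v i \<in> carrier R" using c Bs Cons.prems(4) by auto
  show ?case
  proof (cases "\<forall>i\<in>X. c i \<in> Q")
    case True
    have "in_span B Q es (v i)" if i: "i \<in> X" for i
    proof (rule in_span_cong[OF Qi Bs ec(2) _ cc(2)[OF i] _ c(2)[OF i]])
      have "(v i \<ominus> c i \<otimes> e) \<ominus> v i = \<ominus> (c i \<otimes> e)" using cc[OF i] ec(1) by algebra
      thus "(v i \<ominus> c i \<otimes> e) \<ominus> v i \<in> Q" using True i idl_neg[OF Qi] idl_r[OF Qi] ec(1) by simp
    qed (use cc[OF i] ec in auto)
    thus ?thesis using Cons.IH[OF ec(2) Cons.prems(2) _ Cons.prems(4)] Cons.prems(3) by simp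
  next
    case False
    then obtain k where k: "k \<in> X" "c k \<notin> Q" by blast
    let ?X = "X - {k}"
    \<comment> \<open>Cross-multiplication removes the generator \<open>e\<close>. The pivot is
      outside the prime \<open>Q\<close>, so a coefficient outside \<open>Q\<close> remains so when
      multiplied by it.\<close>
    define w where "w i = c k \<otimes> v i \<ominus> c i \<otimes> v k" for i
    have wc: "w \<in> ?X \<rightarrow> carrier R" using cc k by (auto simp: w_def)
    have "in_span B Q es (w i)" if i: "i \<in> ?X" for i
    proof -
      have iX: "i \<in> X" using i by blast
      have "in_span B Q es (c k \<otimes> (v i \<ominus> c i \<otimes> e) \<ominus> c i \<otimes> (v k \<ominus> c k \<otimes> e))"
        using cc[OF iX] cc[OF k(1)] ec
        by (intro in_span_combination[OF Qi B c(1)[OF k(1)] c(1)[OF iX] ec(2) _ _ c(2)[OF iX] c(2)[OF k(1)]]) auto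
      moreover have "c k \<otimes> (v i \<ominus> c i \<otimes> e) \<ominus> c i \<otimes> (v k \<ominus> c k \<otimes> e) = w i"
        unfolding w_def using cc[OF iX] cc[OF k(1)] ec(1) by algebra
      ultimately show ?thesis by simp
    qed
    moreover have "length es < card ?X" using Cons.prems(2,3) k by simp
    ultimately obtain b where b: "\<forall>i\<in>?X. b i \<in> B" "\<exists>i\<in>?X. b i \<notin> Q" "(\<Oplus>i\<in>?X. b i \<otimes> w i) \<in> Q"
      using Cons.IH[OF ec(2) _ _ wc] Cons.prems(2) by blast
    have bc: "\<And>i. i \<in> ?X \<Longrightarrow> b i \<in> carrier R" using b Bs by auto
    define s where "s = (\<Oplus>i\<in>?X. b i \<otimes> c i)"
    have "\<forall>i\<in>?X. b i \<otimes> c i \<in> B" using b(1) c(1) subringE(6)[OF B] by blast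
    hence sB: "s \<in> B" unfolding s_def using Cons.prems(2) by (intro subring_finsum[OF B]) simp_all
    hence sc: "s \<in> carrier R" using Bs by blast
    \<comment> \<open>A relation among the \<open>w i\<close> is rewritten in the
      \<open>v i\<close>; the coefficient of \<open>v k\<close> collects all the correction
      terms.\<close>
    define d where "d i = (if i = k then \<ominus> s else b i \<otimes> c k)" for i
    have dB: "d i \<in> B" if "i \<in> X" for i
      using that b(1) c(1)[OF k(1)] sB subringE(5,6)[OF B] by (auto simp: d_def)
    have dc: "d i \<in> carrier R" if "i \<in> X" for i using dB[OF that] Bs by blast
    obtain j where j: "j \<in> ?X" "b j \<notin> Q" using b(2) by blast
    have "d j \<notin> Q" using j prime_multD[OF Q bc[OF j(1)] cc(1)[OF k(1)]] k by (auto simp: d_def)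
    moreover have "(\<Oplus>i\<in>X. d i \<otimes> v i) \<in> Q"
    proof -
      have X: "X = insert k ?X" using k by blast
      have "(\<Oplus>i\<in>X. d i \<otimes> v i) = (\<Oplus>i\<in>insert k ?X. d i \<otimes> v i)" using X by simp
      also have "\<dots> = d k \<otimes> v k \<oplus> (\<Oplus>i\<in>?X. d i \<otimes> v i)"
        using Cons.prems(2) k dc cc by (intro finsum_insert) auto
      also have "(\<Oplus>i\<in>?X. d i \<otimes> v i) = (\<Oplus>i\<in>?X. b i \<otimes> w i \<oplus> (b i \<otimes> c i) \<otimes> v k)"
      proof (rule finsum_cong')
        fix i assume i: "i \<in> ?X"
        have iX: "i \<in> X" using i by blast
        have "d i \<otimes> v i = b i \<otimes> c k \<otimes> v i" using i by (simp add: d_def)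
        also have "\<dots> = b i \<otimes> w i \<oplus> (b i \<otimes> c i) \<otimes> v k"
          unfolding w_def using bc[OF i] cc[OF iX] cc[OF k(1)] by algebra
        finally show "d i \<otimes> v i = b i \<otimes> w i \<oplus> (b i \<otimes> c i) \<otimes> v k" .
      qed (use bc cc wc k in \<open>auto simp: Pi_iff\<close>)
      also have "\<dots> = (\<Oplus>i\<in>?X. b i \<otimes> w i) \<oplus> (\<Oplus>i\<in>?X. (b i \<otimes> c i) \<otimes> v k)"
        using bc cc wc k by (intro finsum_addf) auto
      also have "(\<Oplus>i\<in>?X. (b i \<otimes> c i) \<otimes> v k) = s \<otimes> v k"
        unfolding s_def using bc cc k Cons.prems(2) by (intro finsum_ldistr[symmetric]) auto
      also have "d k \<otimes> v k \<oplus> ((\<Oplus>i\<in>?X. b i \<otimes> w i) \<oplus> s \<otimes> v k) = (\<Oplus>i\<in>?X. b i \<otimes> w i)"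
      proof -
        have "\<ominus> s \<otimes> v k \<oplus> (y \<oplus> s \<otimes> v k) = y" if "y \<in> carrier R" for y
          using that sc cc(2)[OF k(1)] by algebra
        moreover have "d k = \<ominus> s" by (simp add: d_def)
        ultimately show ?thesis using idl_carr[OF Qi b(3)] by simp
      qed
      finally show ?thesis using b(3) by simp
    qed
    ultimately show ?thesis using dB j by blast
  qed
qed

text \<open>Powers of \<open>h\<close> are divided out modulo \<open>Q\<close> until the constant
  coefficient is outside \<open>Q\<close>; as \<open>h\<close> is in \<open>P\<close>, the relation
  then puts that coefficient into \<open>P\<close>.\<close>

lemma incomparable_relation:
  assumes P: "primeideal P R" and Q: "primeideal Q R" "Q \<subseteq> P" and h: "h \<in> P" "h \<notin> Q"
  shows "b \<in> UNIV \<rightarrow> carrier R \<Longrightarrow> (\<Oplus>i\<in>{..n}. b i \<otimes> h [^] i) \<in> Q \<Longrightarrow> \<exists>i\<le>n. b i \<notin> Q \<Longrightarrow> \<exists>i\<le>(n::nat). b i \<in> P \<and> b i \<notin> Q"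
proof (induction n arbitrary: b)
  case 0
  thus ?case by (auto simp: Pi_iff)
next
  case (Suc n)
  have Pi: "ideal P R" "ideal Q R" using P Q prime_ideal by auto
  have hc: "h \<in> carrier R" using idl_carr[OF Pi(1) h(1)] .
  have bc: "\<And>i. b i \<in> carrier R" using Suc.prems by auto
  let ?S = "\<Oplus>i\<in>{..n}. b (Suc i) \<otimes> h [^] i"
  have Sc: "?S \<in> carrier R" using bc hc by auto
  have "(\<Oplus>i\<in>{..Suc n}. b i \<otimes> h [^] i) = (\<Oplus>i\<in>{..n}. b (Suc i) \<otimes> h [^] Suc i) \<oplus> b 0 \<otimes> h [^] (0::nat)"
    by (rule finsum_Suc2) (use bc hc in auto)
  also have "(\<Oplus>i\<in>{..n}. b (Suc i) \<otimes> h [^] Suc i) = (\<Oplus>i\<in>{..n}. h \<otimes> (b (Suc i) \<otimes> h [^] i))"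
    using bc hc by (intro finsum_cong') (auto simp: m_ac)
  also have "\<dots> = h \<otimes> ?S" using bc hc by (intro finsum_rdistr[symmetric]) auto
  finally have e: "(\<Oplus>i\<in>{..Suc n}. b i \<otimes> h [^] i) = h \<otimes> ?S \<oplus> b 0" using bc by simp
  have q: "h \<otimes> ?S \<oplus> b 0 \<in> Q" using Suc.prems(2) unfolding e .
  show ?case
  proof (cases "b 0 \<in> Q")
    case True
    hence "h \<otimes> ?S \<in> Q" using q idl_add_cancel'[OF Pi(2)] hc Sc by blast
    hence "?S \<in> Q" using prime_multD[OF Q(1) hc Sc] h by blast
    moreover obtain i where "i \<le> Suc n" "b i \<notin> Q" using Suc.prems by blast
    hence "\<exists>i\<le>n. b (Suc i) \<notin> Q" using True by (cases i) auto
    ultimately have "\<exists>i\<le>n. b (Suc i) \<in> P \<and> b (Suc i) \<notin> Q" using Suc.IH[of "\<lambda>i. b (Suc i)"] bc by auto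
    thus ?thesis by (meson Suc_le_mono)
  next
    case False
    have "h \<otimes> ?S \<in> P" using idl_r[OF Pi(1) h(1) Sc] .
    hence "b 0 \<in> P" using idl_add_cancel[OF Pi(1)] q Q(2) bc by blast
    thus ?thesis using False by blast
  qed
qed

text \<open>For \<open>h\<close> in \<open>P\<close> outside \<open>Q\<close>, the powers of
  exponent 0 to \<open>length es\<close> outnumber the generators by one, so they satisfy a
  nontrivial relation over \<open>B\<close> modulo \<open>Q\<close>, and one of its coefficients is
  the required \<open>b\<close>.\<close>

lemma finite_extension_incomparable:
  assumes P: "primeideal P R" and Q: "primeideal Q R" "Q \<subset> P" and B: "subring B R"
    and es: "set es \<subseteq> carrier R" and span: "\<And>v. v \<in> carrier R \<Longrightarrow> in_span B Q es v"
  shows "\<exists>b\<in>B. b \<in> P \<and> b \<notin> Q"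
proof -
  obtain h where h: "h \<in> P" "h \<notin> Q" using Q by blast
  have hc: "h \<in> carrier R" using idl_carr[OF prime_ideal[OF P] h(1)] .
  let ?n = "length es"
  obtain b where b: "\<forall>i\<in>{..?n}. b i \<in> B" "\<exists>i\<in>{..?n}. b i \<notin> Q" "(\<Oplus>i\<in>{..?n}. b i \<otimes> h [^] i) \<in> Q"
    using span_dependence[OF Q(1) B es, of "{..?n}" "\<lambda>i. h [^] i"] span hc by auto
  define b' where "b' i = (if i \<le> ?n then b i else \<zero>)" for i
  have bB: "b' i \<in> B" for i using b(1) subringE(2)[OF B] by (auto simp: b'_def)
  have bc: "b' i \<in> carrier R" for i using bB subringE(1)[OF B] by blast
  have "(\<Oplus>i\<in>{..?n}. b' i \<otimes> h [^] i) = (\<Oplus>i\<in>{..?n}. b i \<otimes> h [^] i)"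
    by (rule finsum_cong') (use b(1) subringE(1)[OF B] hc in \<open>auto simp: b'_def\<close>)
  hence "\<exists>i\<le>?n. b' i \<in> P \<and> b' i \<notin> Q"
    using b by (intro incomparable_relation[OF P Q(1) _ h]) (use bc Q in \<open>auto simp: b'_def\<close>)
  thus ?thesis using bB by blast
qed

end

section \<open>Rings of fractions\<close>

text \<open>The operations of \<open>localization\<close> are unions over representatives; once all
  representatives give the same class, the union collapses to it.\<close>

lemma UN_pairs_const:
  assumes "x \<in> A" "y \<in> B" "\<And>a s b t. (a, s) \<in> A \<Longrightarrow> (b, t) \<in> B \<Longrightarrow> f a s b t = C"
  shows "(\<Union>(a, s)\<in>A. \<Union>(b, t)\<in>B. f a s b t) = C"
proof -
  have "(\<Union>(a, s)\<in>A. \<Union>(b, t)\<in>B. f a s b t) = (\<Union>p\<in>A. \<Union>q\<in>B. C)"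
    using assms(3) by (intro SUP_cong refl) (auto split: prod.splits)
  also have "\<dots> = C" using assms(1,2) by auto
  finally show ?thesis .
qed

locale multiplicative_set = cring +
  fixes S
  assumes S_sub: "S \<subseteq> carrier R" and S_one: "\<one> \<in> S" and S_mult: "s \<in> S \<Longrightarrow> t \<in> S \<Longrightarrow> s \<otimes> t \<in> S"
begin

abbreviation "fr \<equiv> frac_class R S"
abbreviation "T \<equiv> localization R S"

lemma S_carr: "s \<in> S \<Longrightarrow> s \<in> carrier R" using S_sub by blast

lemma frac_rel_iff:
  "((a, s), (b, t)) \<in> frac_rel R S \<longleftrightarrow> a \<in> carrier R \<and> s \<in> S \<and> b \<in> carrier R \<and> t \<in> S \<and>
     (\<exists>u\<in>S. u \<otimes> (a \<otimes> t \<ominus> b \<otimes> s) = \<zero>)"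
  by (simp add: frac_rel_def)

lemma frac_rel_equiv: "equiv (carrier R \<times> S) (frac_rel R S)"
proof (rule equivI)
  show "frac_rel R S \<subseteq> (carrier R \<times> S) \<times> (carrier R \<times> S)" by (auto simp: frac_rel_def)
  show "refl_on (carrier R \<times> S) (frac_rel R S)"
  proof (rule refl_onI)
    fix x assume "x \<in> carrier R \<times> S"
    then obtain a s where x: "x = (a, s)" "a \<in> carrier R" "s \<in> S" by blast
    have "\<one> \<otimes> (a \<otimes> s \<ominus> a \<otimes> s) = \<zero>" using x S_carr[OF x(3)] by algebra
    thus "(x, x) \<in> frac_rel R S" using x S_one by (auto simp: frac_rel_iff)
  qed
  show "sym (frac_rel R S)"
  proof (rule symI)
    fix x y assume xy: "(x, y) \<in> frac_rel R S"
    obtain a s b t where e: "x = (a, s)" "y = (b, t)" by fastforce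
    obtain u where u: "u \<in> S" "u \<otimes> (a \<otimes> t \<ominus> b \<otimes> s) = \<zero>" and c: "a \<in> carrier R" "s \<in> S" "b \<in> carrier R" "t \<in> S"
      using xy unfolding e frac_rel_iff by blast
    have "u \<otimes> (b \<otimes> s \<ominus> a \<otimes> t) = \<ominus> (u \<otimes> (a \<otimes> t \<ominus> b \<otimes> s))"
      using c(1,3) S_carr[OF u(1)] S_carr[OF c(2)] S_carr[OF c(4)] by algebra
    hence "u \<otimes> (b \<otimes> s \<ominus> a \<otimes> t) = \<zero>" using u by simp
    thus "(y, x) \<in> frac_rel R S" using u c unfolding e frac_rel_iff by blast
  qed
  show "trans (frac_rel R S)"
  proof (rule transI)
    fix x y z assume xy: "(x, y) \<in> frac_rel R S" and yz: "(y, z) \<in> frac_rel R S"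
    obtain a s b t d v where e: "x = (a, s)" "y = (b, t)" "z = (d, v)" by fastforce
    obtain u where u: "u \<in> S" "u \<otimes> (a \<otimes> t \<ominus> b \<otimes> s) = \<zero>" and c: "a \<in> carrier R" "s \<in> S" "b \<in> carrier R" "t \<in> S"
      using xy unfolding e frac_rel_iff by blast
    obtain w where w: "w \<in> S" "w \<otimes> (b \<otimes> v \<ominus> d \<otimes> t) = \<zero>" and c': "d \<in> carrier R" "v \<in> S"
      using yz unfolding e frac_rel_iff by blast
    note cc = c(1,3) c'(1) S_carr[OF u(1)] S_carr[OF w(1)] S_carr[OF c(2)] S_carr[OF c(4)] S_carr[OF c'(2)]
    have "(u \<otimes> w \<otimes> t) \<otimes> (a \<otimes> v \<ominus> d \<otimes> s) = (w \<otimes> v) \<otimes> (u \<otimes> (a \<otimes> t \<ominus> b \<otimes> s)) \<oplus> (u \<otimes> s) \<otimes> (w \<otimes> (b \<otimes> v \<ominus> d \<otimes> t))"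
      using cc by algebra
    also have "\<dots> = \<zero>" unfolding u(2) w(2) using cc by simp
    finally show "(x, z) \<in> frac_rel R S" using u w c c' S_mult unfolding e frac_rel_iff by blast
  qed
qed

lemma fr_eq:
  assumes "a \<in> carrier R" "s \<in> S" "b \<in> carrier R" "t \<in> S"
  shows "fr a s = fr b t \<longleftrightarrow> (\<exists>u\<in>S. u \<otimes> (a \<otimes> t \<ominus> b \<otimes> s) = \<zero>)"
proof -
  have "fr a s = fr b t \<longleftrightarrow> ((a, s), (b, t)) \<in> frac_rel R S"
    unfolding frac_class_def using eq_equiv_class_iff[OF frac_rel_equiv] assms by simp
  thus ?thesis using assms by (simp add: frac_rel_iff)
qed

lemma fr_eqI:
  assumes "a \<in> carrier R" "s \<in> S" "b \<in> carrier R" "t \<in> S" "a \<otimes> t = b \<otimes> s"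
  shows "fr a s = fr b t"
proof -
  have "\<one> \<otimes> (a \<otimes> t \<ominus> b \<otimes> s) = \<zero>" unfolding assms(5) using assms S_carr by (simp add: r_right_minus_eq)
  thus ?thesis using fr_eq assms S_one by blast
qed

lemma mem_fr: "(b, t) \<in> fr a s \<longleftrightarrow> ((a, s), (b, t)) \<in> frac_rel R S"
  by (simp add: frac_class_def)

lemma fr_repr:
  assumes "(b, t) \<in> fr a s" shows "b \<in> carrier R" "t \<in> S" "fr b t = fr a s"
proof -
  have m: "((a, s), (b, t)) \<in> frac_rel R S" using assms mem_fr by blast
  thus "b \<in> carrier R" "t \<in> S" by (auto simp: frac_rel_iff)
  show "fr b t = fr a s" unfolding frac_class_def using equiv_class_eq[OF frac_rel_equiv m] by simp
qed

lemma fr_self: "a \<in> carrier R \<Longrightarrow> s \<in> S \<Longrightarrow> (a, s) \<in> fr a s"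
  unfolding frac_class_def by (rule equiv_class_self[OF frac_rel_equiv]) simp

lemma fr_carrier: "carrier T = {fr a s | a s. a \<in> carrier R \<and> s \<in> S}"
  unfolding localization_def quotient_def frac_class_def by auto

lemma fr_closed: "a \<in> carrier R \<Longrightarrow> s \<in> S \<Longrightarrow> fr a s \<in> carrier T"
  unfolding fr_carrier by blast

lemma frE:
  assumes "x \<in> carrier T" obtains a s where "a \<in> carrier R" "s \<in> S" "x = fr a s"
  using assms unfolding fr_carrier by blast

lemma fr_mult:
  assumes c: "a \<in> carrier R" "s \<in> S" "b \<in> carrier R" "t \<in> S"
  shows "fr a s \<otimes>\<^bsub>T\<^esub> fr b t = fr (a \<otimes> b) (s \<otimes> t)"
proof -
  have "fr (a' \<otimes> b') (s' \<otimes> t') = fr (a \<otimes> b) (s \<otimes> t)" if "(a', s') \<in> fr a s" "(b', t') \<in> fr b t" for a' s' b' t'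
  proof -
    note r = fr_repr[OF that(1)] fr_repr[OF that(2)]
    obtain u where u: "u \<in> S" "u \<otimes> (a' \<otimes> s \<ominus> a \<otimes> s') = \<zero>" using r(3) fr_eq[OF r(1,2) c(1,2)] by blast
    obtain w where w: "w \<in> S" "w \<otimes> (b' \<otimes> t \<ominus> b \<otimes> t') = \<zero>" using r(6) fr_eq[OF r(4,5) c(3,4)] by blast
    note cc = c(1,3) r(1,4) S_carr[OF u(1)] S_carr[OF w(1)] S_carr[OF c(2)] S_carr[OF c(4)] S_carr[OF r(2)] S_carr[OF r(5)]
    \<comment> \<open>The representatives are changed one at a time, so the two witnesses of
      equality multiply.\<close>
    have "(u \<otimes> w) \<otimes> ((a' \<otimes> b') \<otimes> (s \<otimes> t) \<ominus> (a \<otimes> b) \<otimes> (s' \<otimes> t')) =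
      (w \<otimes> b' \<otimes> t) \<otimes> (u \<otimes> (a' \<otimes> s \<ominus> a \<otimes> s')) \<oplus> (u \<otimes> a \<otimes> s') \<otimes> (w \<otimes> (b' \<otimes> t \<ominus> b \<otimes> t'))"
      using cc by algebra
    also have "\<dots> = \<zero>" unfolding u(2) w(2) using cc by simp
    finally show ?thesis using fr_eq[of "a' \<otimes> b'" "s' \<otimes> t'" "a \<otimes> b" "s \<otimes> t"] cc S_mult u w c r by blast
  qed
  moreover have "fr a s \<otimes>\<^bsub>T\<^esub> fr b t = (\<Union>(a', s')\<in>fr a s. \<Union>(b', t')\<in>fr b t. fr (a' \<otimes> b') (s' \<otimes> t'))"
    by (simp add: localization_def)
  ultimately show ?thesis by (simp only:) (rule UN_pairs_const[OF fr_self[OF c(1,2)] fr_self[OF c(3,4)]])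
qed

lemma fr_add:
  assumes c: "a \<in> carrier R" "s \<in> S" "b \<in> carrier R" "t \<in> S"
  shows "fr a s \<oplus>\<^bsub>T\<^esub> fr b t = fr (a \<otimes> t \<oplus> b \<otimes> s) (s \<otimes> t)"
proof -
  have "fr (a' \<otimes> t' \<oplus> b' \<otimes> s') (s' \<otimes> t') = fr (a \<otimes> t \<oplus> b \<otimes> s) (s \<otimes> t)"
    if "(a', s') \<in> fr a s" "(b', t') \<in> fr b t" for a' s' b' t'
  proof -
    note r = fr_repr[OF that(1)] fr_repr[OF that(2)]
    obtain u where u: "u \<in> S" "u \<otimes> (a' \<otimes> s \<ominus> a \<otimes> s') = \<zero>" using r(3) fr_eq[OF r(1,2) c(1,2)] by blast
    obtain w where w: "w \<in> S" "w \<otimes> (b' \<otimes> t \<ominus> b \<otimes> t') = \<zero>" using r(6) fr_eq[OF r(4,5) c(3,4)] by blast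
    note cc = c(1,3) r(1,4) S_carr[OF u(1)] S_carr[OF w(1)] S_carr[OF c(2)] S_carr[OF c(4)] S_carr[OF r(2)] S_carr[OF r(5)]
    have "(u \<otimes> w) \<otimes> ((a' \<otimes> t' \<oplus> b' \<otimes> s') \<otimes> (s \<otimes> t) \<ominus> (a \<otimes> t \<oplus> b \<otimes> s) \<otimes> (s' \<otimes> t')) =
      (w \<otimes> t \<otimes> t') \<otimes> (u \<otimes> (a' \<otimes> s \<ominus> a \<otimes> s')) \<oplus> (u \<otimes> s \<otimes> s') \<otimes> (w \<otimes> (b' \<otimes> t \<ominus> b \<otimes> t'))"
      using cc by algebra
    also have "\<dots> = \<zero>" unfolding u(2) w(2) using cc by simp
    finally have z: "(u \<otimes> w) \<otimes> ((a' \<otimes> t' \<oplus> b' \<otimes> s') \<otimes> (s \<otimes> t) \<ominus> (a \<otimes> t \<oplus> b \<otimes> s) \<otimes> (s' \<otimes> t')) = \<zero>" .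
    have "a' \<otimes> t' \<oplus> b' \<otimes> s' \<in> carrier R" "a \<otimes> t \<oplus> b \<otimes> s \<in> carrier R" using cc by auto
    thus ?thesis
      using fr_eq[of "a' \<otimes> t' \<oplus> b' \<otimes> s'" "s' \<otimes> t'" "a \<otimes> t \<oplus> b \<otimes> s" "s \<otimes> t"] z S_mult[OF u(1) w(1)]
        S_mult[OF c(2,4)] S_mult[OF r(2,5)] by blast
  qed
  moreover have "fr a s \<oplus>\<^bsub>T\<^esub> fr b t = (\<Union>(a', s')\<in>fr a s. \<Union>(b', t')\<in>fr b t. fr (a' \<otimes> t' \<oplus> b' \<otimes> s') (s' \<otimes> t'))"
    by (simp add: localization_def)
  ultimately show ?thesis by (simp only:) (rule UN_pairs_const[OF fr_self[OF c(1,2)] fr_self[OF c(3,4)]])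
qed

lemma fr_one: "\<one>\<^bsub>T\<^esub> = fr \<one> \<one>" and fr_zero: "\<zero>\<^bsub>T\<^esub> = fr \<zero> \<one>"
  by (simp_all add: localization_def)

lemma fr_eq_zero: "a \<in> carrier R \<Longrightarrow> s \<in> S \<Longrightarrow> fr a s = \<zero>\<^bsub>T\<^esub> \<longleftrightarrow> (\<exists>u\<in>S. u \<otimes> a = \<zero>)"
  unfolding fr_zero using fr_eq[of a s \<zero> \<one>] S_one S_carr by (simp add: a_minus_def)

lemma fr_add_same:
  assumes "a \<in> carrier R" "b \<in> carrier R" "s \<in> S" shows "fr a s \<oplus>\<^bsub>T\<^esub> fr b s = fr (a \<oplus> b) s"
proof -
  note c = assms(1,2) S_carr[OF assms(3)]
  have "(a \<otimes> s \<oplus> b \<otimes> s) \<otimes> s = (a \<oplus> b) \<otimes> (s \<otimes> s)" using c by algebra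
  thus ?thesis unfolding fr_add[OF assms(1,3,2,3)] using c assms S_mult by (intro fr_eqI) auto
qed

lemma localization_cring: "cring T"
proof (rule cringI)
  show "abelian_group T"
  proof (rule abelian_groupI)
    fix x y assume "x \<in> carrier T" "y \<in> carrier T"
    then obtain a s b t where e: "x = fr a s" "y = fr b t" and c: "a \<in> carrier R" "s \<in> S" "b \<in> carrier R" "t \<in> S"
      by (metis frE)
    show "x \<oplus>\<^bsub>T\<^esub> y \<in> carrier T" unfolding e fr_add[OF c] using c S_mult S_carr by (intro fr_closed) auto
    have "a \<otimes> t \<oplus> b \<otimes> s = b \<otimes> s \<oplus> a \<otimes> t" "s \<otimes> t = t \<otimes> s" using c S_carr[OF c(2)] S_carr[OF c(4)] by algebra+
    thus "x \<oplus>\<^bsub>T\<^esub> y = y \<oplus>\<^bsub>T\<^esub> x" unfolding e fr_add[OF c] fr_add[OF c(3,4,1,2)] by simp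
  next
    show "\<zero>\<^bsub>T\<^esub> \<in> carrier T" unfolding fr_zero using S_one by (intro fr_closed) auto
  next
    fix x y z assume "x \<in> carrier T" "y \<in> carrier T" "z \<in> carrier T"
    then obtain a s b t d v where e: "x = fr a s" "y = fr b t" "z = fr d v"
      and c: "a \<in> carrier R" "s \<in> S" "b \<in> carrier R" "t \<in> S" "d \<in> carrier R" "v \<in> S" by (metis frE)
    note cc = c(1,3,5) S_carr[OF c(2)] S_carr[OF c(4)] S_carr[OF c(6)]
    have m: "a \<otimes> t \<oplus> b \<otimes> s \<in> carrier R" "s \<otimes> t \<in> S" "b \<otimes> v \<oplus> d \<otimes> t \<in> carrier R" "t \<otimes> v \<in> S"
      using cc c S_mult by auto
    have "(a \<otimes> t \<oplus> b \<otimes> s) \<otimes> v \<oplus> d \<otimes> (s \<otimes> t) = a \<otimes> (t \<otimes> v) \<oplus> (b \<otimes> v \<oplus> d \<otimes> t) \<otimes> s" using cc by algebra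
    moreover have "s \<otimes> t \<otimes> v = s \<otimes> (t \<otimes> v)" using cc by algebra
    ultimately show "x \<oplus>\<^bsub>T\<^esub> y \<oplus>\<^bsub>T\<^esub> z = x \<oplus>\<^bsub>T\<^esub> (y \<oplus>\<^bsub>T\<^esub> z)"
      unfolding e fr_add[OF c(1-4)] fr_add[OF c(3-6)] fr_add[OF m(1,2) c(5,6)] fr_add[OF c(1,2) m(3,4)] by simp
  next
    fix x assume "x \<in> carrier T"
    then obtain a s where e: "x = fr a s" and c: "a \<in> carrier R" "s \<in> S" by (metis frE)
    have "\<zero> \<otimes> s \<oplus> a \<otimes> \<one> = a" "\<one> \<otimes> s = s" using c S_carr by auto
    thus "\<zero>\<^bsub>T\<^esub> \<oplus>\<^bsub>T\<^esub> x = x" unfolding e fr_zero using fr_add[of \<zero> \<one> a s] c S_one by simp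
    have "fr (\<ominus> a) s \<oplus>\<^bsub>T\<^esub> x = fr (\<ominus> a \<oplus> a) s" unfolding e using c by (intro fr_add_same) auto
    also have "\<dots> = \<zero>\<^bsub>T\<^esub>" using c S_one S_carr by (subst fr_eq_zero) (auto simp: l_neg)
    finally show "\<exists>y\<in>carrier T. y \<oplus>\<^bsub>T\<^esub> x = \<zero>\<^bsub>T\<^esub>" using fr_closed[of "\<ominus> a" s] c by blast
  qed
  show "Group.comm_monoid T"
  proof (rule comm_monoidI)
    fix x y assume "x \<in> carrier T" "y \<in> carrier T"
    then obtain a s b t where e: "x = fr a s" "y = fr b t" and c: "a \<in> carrier R" "s \<in> S" "b \<in> carrier R" "t \<in> S"
      by (metis frE)
    show "x \<otimes>\<^bsub>T\<^esub> y \<in> carrier T" unfolding e fr_mult[OF c] using c S_mult S_carr by (intro fr_closed) auto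
    show "x \<otimes>\<^bsub>T\<^esub> y = y \<otimes>\<^bsub>T\<^esub> x" unfolding e fr_mult[OF c] fr_mult[OF c(3,4,1,2)] using c S_carr by (simp add: m_comm)
  next
    show "\<one>\<^bsub>T\<^esub> \<in> carrier T" unfolding fr_one using S_one by (intro fr_closed) auto
  next
    fix x y z assume "x \<in> carrier T" "y \<in> carrier T" "z \<in> carrier T"
    then obtain a s b t d v where e: "x = fr a s" "y = fr b t" "z = fr d v"
      and c: "a \<in> carrier R" "s \<in> S" "b \<in> carrier R" "t \<in> S" "d \<in> carrier R" "v \<in> S" by (metis frE)
    have m: "a \<otimes> b \<in> carrier R" "s \<otimes> t \<in> S" "b \<otimes> d \<in> carrier R" "t \<otimes> v \<in> S" using c S_mult by auto
    show "x \<otimes>\<^bsub>T\<^esub> y \<otimes>\<^bsub>T\<^esub> z = x \<otimes>\<^bsub>T\<^esub> (y \<otimes>\<^bsub>T\<^esub> z)"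
      unfolding e fr_mult[OF c(1-4)] fr_mult[OF c(3-6)] fr_mult[OF m(1,2) c(5,6)] fr_mult[OF c(1,2) m(3,4)]
      using c S_carr by (simp add: m_assoc)
  next
    fix x assume "x \<in> carrier T"
    then obtain a s where e: "x = fr a s" and c: "a \<in> carrier R" "s \<in> S" by (metis frE)
    show "\<one>\<^bsub>T\<^esub> \<otimes>\<^bsub>T\<^esub> x = x" unfolding e fr_one using fr_mult[of \<one> \<one> a s] c S_one S_carr by simp
  qed
  fix x y z assume "x \<in> carrier T" "y \<in> carrier T" "z \<in> carrier T"
  then obtain a s b t d v where e: "x = fr a s" "y = fr b t" "z = fr d v"
    and c: "a \<in> carrier R" "s \<in> S" "b \<in> carrier R" "t \<in> S" "d \<in> carrier R" "v \<in> S" by (metis frE)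
  note cc = c(1,3,5) S_carr[OF c(2)] S_carr[OF c(4)] S_carr[OF c(6)]
  have m: "a \<otimes> t \<oplus> b \<otimes> s \<in> carrier R" "s \<otimes> t \<in> S" "a \<otimes> d \<in> carrier R" "s \<otimes> v \<in> S" "b \<otimes> d \<in> carrier R" "t \<otimes> v \<in> S"
    using cc c S_mult by auto
  have "(a \<otimes> t \<oplus> b \<otimes> s) \<otimes> d \<otimes> (s \<otimes> v \<otimes> (t \<otimes> v)) = (a \<otimes> d \<otimes> (t \<otimes> v) \<oplus> b \<otimes> d \<otimes> (s \<otimes> v)) \<otimes> (s \<otimes> t \<otimes> v)"
    using cc by algebra
  thus "(x \<oplus>\<^bsub>T\<^esub> y) \<otimes>\<^bsub>T\<^esub> z = x \<otimes>\<^bsub>T\<^esub> z \<oplus>\<^bsub>T\<^esub> y \<otimes>\<^bsub>T\<^esub> z"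
    unfolding e fr_add[OF c(1-4)] fr_mult[OF c(1,2,5,6)] fr_mult[OF c(3-6)] fr_mult[OF m(1,2) c(5,6)] fr_add[OF m(3-6)]
    using m cc c S_mult by (intro fr_eqI) auto
qed

lemma fr_hom: "(\<lambda>a. fr a \<one>) \<in> ring_hom R T"
proof (rule ring_hom_memI)
  fix a b assume "a \<in> carrier R" "b \<in> carrier R"
  thus "fr (a \<otimes> b) \<one> = fr a \<one> \<otimes>\<^bsub>T\<^esub> fr b \<one>" "fr (a \<oplus> b) \<one> = fr a \<one> \<oplus>\<^bsub>T\<^esub> fr b \<one>"
    using fr_mult[of a \<one> b \<one>] fr_add_same[of a b \<one>] S_one by simp_all
qed (use S_one in \<open>auto simp: fr_one intro: fr_closed\<close>)

lemma fr_hom_ring: "ring_hom_ring R T (\<lambda>a. fr a \<one>)"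
  using ring_hom_ringI2[OF ring_axioms cring.axioms(1)[OF localization_cring] fr_hom] .

lemma fr_split: "a \<in> carrier R \<Longrightarrow> s \<in> S \<Longrightarrow> fr a s = fr \<one> s \<otimes>\<^bsub>T\<^esub> fr a \<one>"
  using fr_mult[of \<one> s a \<one>] S_one S_carr by simp

definition contraction :: "('a \<times> 'a) set set \<Rightarrow> 'a set" where
  "contraction A = {a \<in> carrier R. fr a \<one> \<in> A}"

lemma contraction_ideal: "ideal A T \<Longrightarrow> ideal (contraction A) R"
  unfolding contraction_def using ring_hom_ring.ideal_vimage[OF fr_hom_ring] by blast

lemma mem_contraction:
  assumes A: "ideal A T" and c: "a \<in> carrier R" "s \<in> S"
  shows "fr a s \<in> A \<longleftrightarrow> a \<in> contraction A"
proof
  interpret T: cring T using localization_cring .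
  assume "fr a s \<in> A"
  hence "fr s \<one> \<otimes>\<^bsub>T\<^esub> fr a s \<in> A" using T.idl_l[OF A] fr_closed[OF S_carr[OF c(2)] S_one] by blast
  moreover have "fr s \<one> \<otimes>\<^bsub>T\<^esub> fr a s = fr a \<one>"
    unfolding fr_mult[OF S_carr[OF c(2)] S_one c] using c S_carr S_one by (intro fr_eqI) (auto simp: m_ac)
  ultimately show "a \<in> contraction A" using c by (simp add: contraction_def)
next
  interpret T: cring T using localization_cring .
  assume "a \<in> contraction A"
  thus "fr a s \<in> A" unfolding fr_split[OF c] using T.idl_l[OF A] fr_closed[OF one_closed c(2)]
    by (simp add: contraction_def)
qed

lemma contraction_strict:
  assumes "ideal A T" "ideal B T" "A \<subset> B" shows "contraction A \<subset> contraction B"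
proof -
  interpret T: cring T using localization_cring .
  obtain x where x: "x \<in> B" "x \<notin> A" using assms by blast
  obtain a s where a: "a \<in> carrier R" "s \<in> S" "x = fr a s" using frE T.idl_carr[OF assms(2) x(1)] by metis
  have "a \<in> contraction B" "a \<notin> contraction A" using x a mem_contraction assms by blast+
  moreover have "contraction A \<subseteq> contraction B" using assms by (auto simp: contraction_def)
  ultimately show ?thesis by blast
qed

lemma contraction_prime:
  assumes "primeideal A T" shows "primeideal (contraction A) R" "contraction A \<inter> S = {}"
proof -
  interpret T: cring T using localization_cring .
  have A: "ideal A T" using assms T.prime_ideal by blast
  have one: "\<one>\<^bsub>T\<^esub> \<notin> A" using T.prime_one assms by blast
  show "primeideal (contraction A) R"
  proof (rule primeI[OF contraction_ideal[OF A]])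
    show "\<one> \<notin> contraction A" using one by (simp add: contraction_def fr_one)
    fix a b assume ab: "a \<in> carrier R" "b \<in> carrier R" "a \<otimes> b \<in> contraction A"
    hence "fr a \<one> \<otimes>\<^bsub>T\<^esub> fr b \<one> \<in> A" using fr_mult[of a \<one> b \<one>] S_one by (simp add: contraction_def)
    thus "a \<in> contraction A \<or> b \<in> contraction A"
      using T.prime_multD[OF assms] fr_closed S_one ab by (auto simp: contraction_def)
  qed
  show "contraction A \<inter> S = {}"
  proof (rule ccontr)
    assume "contraction A \<inter> S \<noteq> {}"
    then obtain s where s: "s \<in> contraction A" "s \<in> S" by blast
    hence "fr s s \<in> A" using mem_contraction[OF A S_carr[OF s(2)] s(2)] by blast
    moreover have "fr s s = \<one>\<^bsub>T\<^esub>" unfolding fr_one using s S_carr S_one by (intro fr_eqI) auto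
    ultimately show False using one by simp
  qed
qed

definition extension :: "'a set \<Rightarrow> ('a \<times> 'a) set set" where
  "extension Q = {fr a s | a s. a \<in> Q \<and> s \<in> S}"

lemma mem_extension:
  assumes Q: "primeideal Q R" "Q \<inter> S = {}" and c: "a \<in> carrier R" "s \<in> S"
  shows "fr a s \<in> extension Q \<longleftrightarrow> a \<in> Q"
proof
  assume "fr a s \<in> extension Q"
  then obtain b t where bt: "b \<in> Q" "t \<in> S" "fr a s = fr b t" by (auto simp: extension_def)
  have Qi: "ideal Q R" using Q prime_ideal by blast
  have bc: "b \<in> carrier R" using idl_carr[OF Qi bt(1)] .
  obtain u where u: "u \<in> S" "u \<otimes> (a \<otimes> t \<ominus> b \<otimes> s) = \<zero>" using fr_eq[OF c bc bt(2)] bt(3) by blast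
  note cc = bc c(1) S_carr[OF c(2)] S_carr[OF bt(2)] S_carr[OF u(1)]
  have "a \<otimes> t \<ominus> b \<otimes> s \<in> Q" using prime_multD[OF Q(1), of u "a \<otimes> t \<ominus> b \<otimes> s"] u Q(2) idl_zero[OF Qi] cc by auto
  hence "a \<otimes> t \<in> Q" using idl_minus_cancel[OF Qi _ idl_r[OF Qi bt(1)]] cc by blast
  thus "a \<in> Q" using prime_multD[OF Q(1)] cc Q(2) bt by blast
next
  assume "a \<in> Q" thus "fr a s \<in> extension Q" using c by (auto simp: extension_def)
qed

lemma extension_ideal:
  assumes Q: "ideal Q R" shows "ideal (extension Q) T"
proof -
  interpret T: cring T using localization_cring .
  have Qc: "\<And>a. a \<in> Q \<Longrightarrow> a \<in> carrier R" using idl_carr[OF Q] .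
  show ?thesis
  proof (rule idealI[OF T.ring_axioms])
    show "subgroup (extension Q) (add_monoid T)"
    proof (rule T.add.subgroupI)
      show "extension Q \<subseteq> carrier T" using Qc fr_closed by (auto simp: extension_def)
      show "extension Q \<noteq> {}" using idl_zero[OF Q] S_one by (auto simp: extension_def)
    next
      fix x assume "x \<in> extension Q"
      then obtain a s where a: "a \<in> Q" "s \<in> S" "x = fr a s" by (auto simp: extension_def)
      have "fr (\<ominus> a) s \<oplus>\<^bsub>T\<^esub> fr a s = fr (\<ominus> a \<oplus> a) s" using a Qc by (intro fr_add_same) auto
      also have "\<dots> = \<zero>\<^bsub>T\<^esub>" using a Qc S_one S_carr by (subst fr_eq_zero) (auto simp: l_neg)
      finally have "\<ominus>\<^bsub>T\<^esub> x = fr (\<ominus> a) s" using a Qc fr_closed by (intro T.minus_equality) auto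
      thus "\<ominus>\<^bsub>T\<^esub> x \<in> extension Q" using a idl_neg[OF Q] by (auto simp: extension_def)
    next
      fix x y assume "x \<in> extension Q" "y \<in> extension Q"
      then obtain a s b t where a: "a \<in> Q" "s \<in> S" "x = fr a s" "b \<in> Q" "t \<in> S" "y = fr b t" by (auto simp: extension_def)
      have "a \<otimes> t \<oplus> b \<otimes> s \<in> Q" using a S_carr by (intro idl_add[OF Q] idl_r[OF Q])
      moreover have "x \<oplus>\<^bsub>T\<^esub> y = fr (a \<otimes> t \<oplus> b \<otimes> s) (s \<otimes> t)" using a Qc fr_add by simp
      ultimately show "x \<oplus>\<^bsub>T\<^esub> y \<in> extension Q" using S_mult[OF a(2,5)] by (auto simp: extension_def)
    qed
    fix x y assume "x \<in> extension Q" "y \<in> carrier T"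
    then obtain a s b t where a: "a \<in> Q" "s \<in> S" "x = fr a s" "b \<in> carrier R" "t \<in> S" "y = fr b t"
      by (auto simp: extension_def elim: frE)
    have "y \<otimes>\<^bsub>T\<^esub> x = fr (b \<otimes> a) (t \<otimes> s)" using a Qc fr_mult by simp
    moreover have "b \<otimes> a \<in> Q" using idl_l[OF Q] a by blast
    ultimately show yx: "y \<otimes>\<^bsub>T\<^esub> x \<in> extension Q" using S_mult[OF a(5,2)] by (auto simp: extension_def)
    show "x \<otimes>\<^bsub>T\<^esub> y \<in> extension Q"
      using yx T.m_comm[of x y] a Qc fr_closed by metis
  qed
qed

lemma extension_prime:
  assumes Q: "primeideal Q R" "Q \<inter> S = {}" shows "primeideal (extension Q) T"
proof -
  interpret T: cring T using localization_cring .
  show ?thesis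
  proof (rule T.primeI[OF extension_ideal[OF prime_ideal[OF Q(1)]]])
    show "\<one>\<^bsub>T\<^esub> \<notin> extension Q" unfolding fr_one using mem_extension[OF Q] S_one prime_one[OF Q(1)] by simp
    fix x y assume xy: "x \<in> carrier T" "y \<in> carrier T" "x \<otimes>\<^bsub>T\<^esub> y \<in> extension Q"
    then obtain a s b t where e: "x = fr a s" "y = fr b t" and c: "a \<in> carrier R" "s \<in> S" "b \<in> carrier R" "t \<in> S"
      by (metis frE)
    have "a \<otimes> b \<in> Q" using xy(3) unfolding e fr_mult[OF c] using mem_extension[OF Q] c S_mult by simp
    thus "x \<in> extension Q \<or> y \<in> extension Q"
      unfolding e using mem_extension[OF Q] c prime_multD[OF Q(1)] by blast
  qed
qed

text \<open>The factor \<open>s\<close> becomes invertible, so generation up to \<open>s\<close> in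
  \<open>R\<close> is generation in the localization. This serves both finite generation and the
  regularity criterion.\<close>

lemma ideal_fr_generators:
  assumes F: "F \<subseteq> carrier R" and c: "s \<in> S" "a \<in> carrier R" "s \<otimes> a \<in> Idl F"
    and A: "ideal A T" "(\<lambda>b. fr b \<one>) ` F \<subseteq> A" and t: "t \<in> S"
  shows "fr a t \<in> A"
proof -
  have "F \<subseteq> contraction A" using A F by (auto simp: contraction_def)
  hence "Idl F \<subseteq> contraction A" using genideal_minimal contraction_ideal[OF A(1)] by blast
  hence sa: "s \<otimes> a \<in> contraction A" using c by blast
  have "fr (s \<otimes> a) (s \<otimes> t) \<in> A" using mem_contraction[OF A(1)] sa c t S_mult S_carr by simp
  moreover have "fr (s \<otimes> a) (s \<otimes> t) = fr a t" using c t S_mult S_carr by (intro fr_eqI) (auto simp: m_ac)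
  ultimately show ?thesis by simp
qed

lemma localization_noetherian:
  assumes "noetherian_ring R" shows "noetherian_ring T"
proof -
  interpret T: cring T using localization_cring .
  show ?thesis
  proof (rule T.noetherian_ringI)
    fix A assume A: "ideal A T"
    obtain F where F: "F \<subseteq> carrier R" "finite F" "contraction A = Idl F"
      using noetherian_ring.finetely_gen[OF assms contraction_ideal[OF A]] by blast
    let ?F = "(\<lambda>b. fr b \<one>) ` F"
    have sub: "?F \<subseteq> A" using genideal_self[OF F(1)] F(3) by (auto simp: contraction_def)
    have Fc: "?F \<subseteq> carrier T" using F(1) fr_closed S_one by auto
    have "A \<subseteq> Idl\<^bsub>T\<^esub> ?F"
    proof
      fix x assume x: "x \<in> A"
      obtain a s where a: "a \<in> carrier R" "s \<in> S" "x = fr a s" using frE T.idl_carr[OF A x] by metis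
      have "\<one> \<otimes> a \<in> Idl F" using mem_contraction[OF A a(1,2)] x a F(3) by simp
      thus "x \<in> Idl\<^bsub>T\<^esub> ?F" unfolding a(3)
        using ideal_fr_generators[OF F(1) S_one a(1) _ T.genideal_ideal[OF Fc] T.genideal_self[OF Fc] a(2)] by blast
    qed
    hence "A = Idl\<^bsub>T\<^esub> ?F" using T.genideal_minimal[OF A sub] by blast
    thus "\<exists>F\<subseteq>carrier T. finite F \<and> A = Idl\<^bsub>T\<^esub> F" using Fc F(2) by blast
  qed
qed

end

section \<open>Localization at a prime ideal\<close>

locale localization_at_prime = cring +
  fixes P assumes prime_P: "primeideal P R"

sublocale localization_at_prime \<subseteq> multiplicative_set R "carrier R - P"
  by unfold_locales (use prime_one[OF prime_P] prime_complD[OF prime_P] in auto)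

context localization_at_prime begin

lemma local_at_eq: "local_at R P = T" by (simp add: local_at_def)

lemma local_at_max_eq: "local_at_max R P = extension P"
  by (simp add: local_at_max_def extension_def)

lemma P_disj: "P \<inter> (carrier R - P) = {}" by blast

lemma max_prime: "primeideal (extension P) T"
  using extension_prime[OF prime_P P_disj] .

lemma proper_ideal_in_max:
  assumes "ideal A T" "\<one>\<^bsub>T\<^esub> \<notin> A" shows "A \<subseteq> extension P"
proof
  interpret T: cring T using localization_cring .
  fix x assume x: "x \<in> A"
  obtain a s where a: "a \<in> carrier R" "s \<in> carrier R - P" "x = fr a s" using frE T.idl_carr[OF assms(1) x] by metis
  have "a \<in> P"
  proof (rule ccontr)
    assume "a \<notin> P"
    hence aS: "a \<in> carrier R - P" using a by blast
    have "a \<in> contraction A" using mem_contraction[OF assms(1) a(1,2)] x a by simp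
    hence "fr a a \<in> A" using mem_contraction[OF assms(1) a(1) aS] by blast
    moreover have "fr a a = \<one>\<^bsub>T\<^esub>" unfolding fr_one using aS S_one by (intro fr_eqI) auto
    ultimately show False using assms(2) by simp
  qed
  thus "x \<in> extension P" using a by (auto simp: extension_def)
qed

lemma local_at_noetherian_local:
  assumes "noetherian_ring R" shows "noetherian_local_ring T (extension P)"
proof -
  interpret T: cring T using localization_cring .
  have E: "ideal (extension P) T" "\<one>\<^bsub>T\<^esub> \<notin> extension P" using T.prime_ideal T.prime_one max_prime by blast+
  have max: "A = extension P \<or> A = carrier T" if A: "ideal A T" "extension P \<subseteq> A" for A
  proof (cases "\<one>\<^bsub>T\<^esub> \<in> A")
    case True thus ?thesis using ideal.one_imp_carrier[OF A(1)] by blast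
  next
    case False thus ?thesis using proper_ideal_in_max A by blast
  qed
  have "maximalideal (extension P) T"
    by (rule maximalidealI[OF E(1)]) (use E(2) max T.one_closed in blast)+
  moreover have "n = extension P" if n: "maximalideal n T" for n
  proof -
    have ni: "ideal n T" using n by (simp add: maximalideal_def)
    have "\<one>\<^bsub>T\<^esub> \<notin> n" using maximalideal.I_notcarr[OF n] ideal.one_imp_carrier[OF ni] by blast
    hence "n \<subseteq> extension P" using proper_ideal_in_max ni by blast
    thus ?thesis using maximalideal.I_maximal[OF n E(1)] E T.idl_sub T.one_closed by blast
  qed
  ultimately show ?thesis
    unfolding noetherian_local_ring_def using localization_cring localization_noetherian[OF assms] by blast
qed

lemma krull_dim_le_height: "krull_dim T \<le> ideal_height R P"
  unfolding krull_dim_def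
proof (rule SUP_least)
  interpret T: cring T using localization_cring .
  fix A assume "A \<in> {A. primeideal A T}"
  show "ideal_height T A \<le> ideal_height R P"
    unfolding ideal_height_def[of T]
  proof (rule Sup_least)
    fix x assume "x \<in> {enat n |n. \<exists>c. (\<forall>i\<le>n. primeideal (c i) T) \<and> (\<forall>i<n. c i \<subset> c (Suc i)) \<and> c n = A}"
    then obtain n c where x: "x = enat n" and c: "\<forall>i\<le>n. primeideal (c i) T" "\<forall>i<n. c i \<subset> c (Suc i)" by auto
    \<comment> \<open>The top prime is replaced by \<open>P\<close>, since the chains in
      \<open>ideal_height\<close> must end exactly there. Strictness survives because all the
      contractions lie in \<open>P\<close>.\<close>
    define d where "d i = (if i = n then P else contraction (c i))" for i
    have sub: "contraction (c i) \<subseteq> P" if "i \<le> n" for i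
      using contraction_prime[of "c i"] that c(1) idl_sub[OF contraction_ideal] T.prime_ideal by blast
    have 1: "\<forall>i\<le>n. primeideal (d i) R"
      using c(1) contraction_prime prime_P by (auto simp: d_def)
    have "d i \<subset> d (Suc i)" if i: "i < n" for i
    proof -
      have "ideal (c i) T" "ideal (c (Suc i)) T" using i c(1) T.prime_ideal by auto
      hence "contraction (c i) \<subset> contraction (c (Suc i))"
        by (rule contraction_strict) (use i c(2) in blast)
      thus ?thesis using i sub[of "Suc i"] by (auto simp: d_def)
    qed
    hence "\<exists>c. (\<forall>i\<le>n. primeideal (c i) R) \<and> (\<forall>i<n. c i \<subset> c (Suc i)) \<and> c n = P"
      using 1 by (intro exI[of _ d]) (auto simp: d_def)
    thus "x \<le> ideal_height R P" unfolding x ideal_height_def by (intro Sup_upper) blast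
  qed
qed

lemma height_le_krull_dim: "ideal_height R P \<le> krull_dim T"
  unfolding ideal_height_def[of R]
proof (rule Sup_least)
  fix x assume "x \<in> {enat n |n. \<exists>c. (\<forall>i\<le>n. primeideal (c i) R) \<and> (\<forall>i<n. c i \<subset> c (Suc i)) \<and> c n = P}"
  then obtain n c where x: "x = enat n" and c: "\<forall>i\<le>n. primeideal (c i) R" "\<forall>i<n. c i \<subset> c (Suc i)" "c n = P" by auto
  have sub: "c i \<subseteq> P" if "i \<le> n" for i
    using that
  proof (induction rule: inc_induct)
    case (step k) thus ?case using c(2) by blast
  qed (simp add: c(3))
  have disj: "c i \<inter> (carrier R - P) = {}" if "i \<le> n" for i using sub[OF that] by blast
  have 1: "\<forall>i\<le>n. primeideal (extension (c i)) T" using extension_prime c(1) disj by blast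
  have 2: "extension (c i) \<subset> extension (c (Suc i))" if i: "i < n" for i
  proof -
    obtain a where a: "a \<in> c (Suc i)" "a \<notin> c i" using i c(2) by blast
    have ac: "a \<in> carrier R" using idl_carr[OF prime_ideal a(1)] c(1) i by simp
    have "fr a \<one> \<in> extension (c (Suc i))" "fr a \<one> \<notin> extension (c i)"
      using mem_extension[of "c (Suc i)" a \<one>] mem_extension[of "c i" a \<one>] a ac S_one i c(1) disj by auto
    moreover have "extension (c i) \<subseteq> extension (c (Suc i))" using i c(2) by (auto simp: extension_def)
    ultimately show ?thesis by blast
  qed
  have "\<exists>d. (\<forall>i\<le>n. primeideal (d i) T) \<and> (\<forall>i<n. d i \<subset> d (Suc i)) \<and> d n = extension P"
    using 1 2 c(3) by (intro exI[of _ "\<lambda>i. extension (c i)"]) simp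
  hence "x \<le> ideal_height T (extension P)"
    unfolding x ideal_height_def by (intro Sup_upper) blast
  also have "\<dots> \<le> krull_dim T" unfolding krull_dim_def by (rule SUP_upper) (use max_prime in blast)
  finally show "x \<le> krull_dim T" .
qed

text \<open>Read backwards, this expresses nonregularity inside \<open>R\<close>: for no
  \<open>r\<close> outside \<open>P\<close> does \<open>r P\<close> lie in an ideal generated by as
  many elements of \<open>P\<close> as its height.\<close>

lemma local_at_regularI:
  assumes "noetherian_ring R" "ideal_height R P = enat (length zs)"
    and zs: "set zs \<subseteq> P" and r: "r \<in> carrier R - P" "\<And>c. c \<in> P \<Longrightarrow> r \<otimes> c \<in> Idl (set zs)"
  shows "regular_local_ring (local_at R P) (local_at_max R P)"
proof -
  interpret T: cring T using localization_cring .
  have Pi: "ideal P R" using prime_P prime_ideal by blast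
  have zc: "set zs \<subseteq> carrier R" using zs idl_sub[OF Pi] by blast
  let ?ys = "map (\<lambda>a. fr a \<one>) zs"
  have E: "ideal (extension P) T" using T.prime_ideal max_prime by blast
  have ysE: "set ?ys \<subseteq> extension P" using zs S_one by (auto simp: extension_def)
  have yc: "set ?ys \<subseteq> carrier T" using ysE T.idl_sub[OF E] by blast
  have "extension P \<subseteq> Idl\<^bsub>T\<^esub> (set ?ys)"
  proof
    fix x assume "x \<in> extension P"
    then obtain a s where a: "a \<in> P" "s \<in> carrier R - P" "x = fr a s" by (auto simp: extension_def)
    show "x \<in> Idl\<^bsub>T\<^esub> (set ?ys)" unfolding a(3)
      by (rule ideal_fr_generators[OF zc r(1) idl_carr[OF Pi a(1)] r(2)[OF a(1)] T.genideal_ideal[OF yc] _ a(2)])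
        (use T.genideal_self[OF yc] in auto)
  qed
  hence "Idl\<^bsub>T\<^esub> (set ?ys) = extension P" using T.genideal_minimal[OF E ysE] by blast
  moreover have "enat (length ?ys) = krull_dim T"
    using assms(2) krull_dim_le_height height_le_krull_dim by simp
  ultimately show ?thesis unfolding regular_local_ring_def local_at_eq local_at_max_eq
    using local_at_noetherian_local[OF assms(1)] yc by blast
qed

text \<open>The annihilator of \<open>a\<close> only has to vanish after localization;
  \<open>fr a \<one>\<close> is then a regular sequence of length one.\<close>

lemma depth_ge_one:
  assumes a: "a \<in> P" and nz: "\<And>b. b \<in> carrier R \<Longrightarrow> b \<otimes> a = \<zero> \<Longrightarrow> \<exists>s\<in>carrier R - P. s \<otimes> b = \<zero>"
  shows "enat 1 \<le> depth (local_at R P) (local_at_max R P)"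
proof -
  interpret T: cring T using localization_cring .
  have Pi: "ideal P R" using prime_P prime_ideal by blast
  have ac: "a \<in> carrier R" using idl_carr[OF Pi a] .
  have E: "ideal (extension P) T" "\<one>\<^bsub>T\<^esub> \<notin> extension P" using T.prime_ideal T.prime_one max_prime by blast+
  let ?x = "fr a \<one>"
  have x: "?x \<in> extension P" using a S_one by (auto simp: extension_def)
  have xc: "?x \<in> carrier T" using T.idl_carr[OF E(1) x] .
  have "regular_sequence T [?x]"
    unfolding regular_sequence_def
  proof (intro conjI allI impI ballI)
    show "set [?x] \<subseteq> carrier T" using xc by simp
    show "Idl\<^bsub>T\<^esub> (set [?x]) \<noteq> carrier T"
      using T.genideal_minimal[OF E(1), of "set [?x]"] x E(2) T.one_closed by auto
    fix i y assume i: "i < length [?x]" and y: "y \<in> carrier T"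
      "y \<otimes>\<^bsub>T\<^esub> [?x] ! i \<in> Idl\<^bsub>T\<^esub> (set (take i [?x]))"
    obtain b s where b: "b \<in> carrier R" "s \<in> carrier R - P" "y = fr b s" using frE[OF y(1)] by blast
    have "y \<otimes>\<^bsub>T\<^esub> ?x = \<zero>\<^bsub>T\<^esub>" using y(2) i by (simp add: T.Idl_empty)
    hence "fr (b \<otimes> a) s = \<zero>\<^bsub>T\<^esub>" using fr_mult[OF b(1,2) ac S_one] b by simp
    then obtain u where u: "u \<in> carrier R - P" "u \<otimes> (b \<otimes> a) = \<zero>" using fr_eq_zero[of "b \<otimes> a" s] b ac by auto
    have "(u \<otimes> b) \<otimes> a = \<zero>" using u b ac by (simp add: m_assoc)
    then obtain v where v: "v \<in> carrier R - P" "v \<otimes> (u \<otimes> b) = \<zero>" using nz[of "u \<otimes> b"] u b by auto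
    have "(v \<otimes> u) \<otimes> b = \<zero>" using v u b by (simp add: m_assoc)
    hence "y = \<zero>\<^bsub>T\<^esub>" unfolding b(3) using fr_eq_zero[OF b(1,2)] S_mult v u by blast
    thus "y \<in> Idl\<^bsub>T\<^esub> (set (take i [?x]))" using i by (simp add: T.Idl_empty)
  qed
  thus ?thesis unfolding depth_def local_at_eq local_at_max_eq
    using x by (intro Sup_upper CollectI exI[of _ "[?x]"]) (auto simp: one_enat_def)
qed

lemma height_zero:
  assumes "\<And>Q. primeideal Q R \<Longrightarrow> Q \<subseteq> P \<Longrightarrow> Q = P"
  shows "krull_dim (local_at R P) = 0"
proof -
  have "ideal_height R P \<le> 0" unfolding ideal_height_def
  proof (rule Sup_least)
    fix x assume "x \<in> {enat n |n. \<exists>c. (\<forall>i\<le>n. primeideal (c i) R) \<and> (\<forall>i<n. c i \<subset> c (Suc i)) \<and> c n = P}"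
    then obtain n c where x: "x = enat n" and c: "\<forall>i\<le>n. primeideal (c i) R" "\<forall>i<n. c i \<subset> c (Suc i)" "c n = P" by auto
    have "n = 0"
    proof (cases n)
      case (Suc k)
      hence "primeideal (c k) R" "c k \<subset> P" using c by auto
      thus ?thesis using assms by blast
    qed
    thus "x \<le> 0" unfolding x by (simp add: zero_enat_def)
  qed
  thus ?thesis unfolding local_at_eq using krull_dim_le_height by simp
qed

end

section \<open>The associated graded ring\<close>

declare ideal_power.simps(2) [simp del]

section \<open>Rees algebras inside the polynomial ring\<close>

context cring begin

definition mon :: "'a \<Rightarrow> nat \<Rightarrow> nat \<Rightarrow> 'a" where
  "mon c k = (\<lambda>n. if n = k then c else \<zero>)"

lemma UP_is_cring: "cring (UP R)"
  by (rule UP_cring.UP_cring) (simp add: UP_cring_def is_cring)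

lemma UP_mult: "f \<in> up R \<Longrightarrow> h \<in> up R \<Longrightarrow> f \<otimes>\<^bsub>UP R\<^esub> h = conv f h"
  by (simp add: UP_def conv_def fun_eq_iff)

lemma UP_add: "f \<in> up R \<Longrightarrow> h \<in> up R \<Longrightarrow> f \<oplus>\<^bsub>UP R\<^esub> h = (\<lambda>n. f n \<oplus> h n)"
  by (simp add: UP_def)

lemma UP_zero: "\<zero>\<^bsub>UP R\<^esub> = (\<lambda>n. \<zero>)" and UP_one: "\<one>\<^bsub>UP R\<^esub> = mon \<one> 0" and UP_carrier: "carrier (UP R) = up R"
  by (simp_all add: UP_def mon_def)

lemma UP_uminus: "f \<in> up R \<Longrightarrow> \<ominus>\<^bsub>UP R\<^esub> f = (\<lambda>n. \<ominus> f n)"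
proof -
  interpret U: cring "UP R" using UP_is_cring .
  assume f: "f \<in> up R"
  hence n: "(\<lambda>n. \<ominus> f n) \<in> up R" by (rule up_a_inv_closed)
  have "(\<lambda>n. \<ominus> f n) \<oplus>\<^bsub>UP R\<^esub> f = \<zero>\<^bsub>UP R\<^esub>"
    unfolding UP_add[OF n f] UP_zero using mem_upD[OF f] by (simp add: l_neg)
  thus ?thesis using U.minus_equality f n by (simp add: UP_carrier)
qed

lemma mon_up: "c \<in> carrier R \<Longrightarrow> mon c k \<in> up R"
  by (intro mem_upI exI[of _ k]) (auto simp: mon_def)

lemma conv_up: "f \<in> up R \<Longrightarrow> h \<in> up R \<Longrightarrow> conv f h \<in> up R"
  using up_mult_closed unfolding conv_def by blast

lemma conv_mon:
  assumes "c \<in> carrier R" "\<And>n. h n \<in> carrier R"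
  shows "conv (mon c k) h n = (if k \<le> n then c \<otimes> h (n - k) else \<zero>)"
proof (cases "k \<le> n")
  case True
  have "conv (mon c k) h n = (\<Oplus>i\<in>{..n}. if k = i then c \<otimes> h (n - i) else \<zero>)"
    unfolding conv_def mon_def using assms by (intro finsum_cong') auto
  also have "\<dots> = c \<otimes> h (n - k)" using True assms by (intro finsum_singleton) auto
  finally show ?thesis using True by simp
next
  case False
  have "conv (mon c k) h n = (\<Oplus>i\<in>{..n}. \<zero>)"
    unfolding conv_def mon_def using assms False by (intro finsum_cong') auto
  thus ?thesis using False by simp
qed

lemma conv_comm: "f \<in> up R \<Longrightarrow> h \<in> up R \<Longrightarrow> conv f h = conv h f"
proof -
  interpret U: cring "UP R" using UP_is_cring .
  show "f \<in> up R \<Longrightarrow> h \<in> up R \<Longrightarrow> conv f h = conv h f"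
    using U.m_comm[of f h] by (simp add: UP_carrier UP_mult)
qed

text \<open>The Rees algebra R[JT]. That of \<open>I\<close> maps onto the associated graded ring;
  the image of that of \<open>J\<close> is the subring over which the graded ring will be
  finite.\<close>

definition rees :: "'a set \<Rightarrow> (nat \<Rightarrow> 'a) set" where
  "rees J = {f \<in> up R. \<forall>n. f n \<in> pw J n}"

lemma reesD: "f \<in> rees J \<Longrightarrow> f \<in> up R" "f \<in> rees J \<Longrightarrow> f n \<in> pw J n" "f \<in> rees J \<Longrightarrow> f n \<in> carrier R"
  by (auto simp: rees_def)

lemma reesI: "f \<in> up R \<Longrightarrow> (\<And>n. f n \<in> pw J n) \<Longrightarrow> f \<in> rees J"
  by (simp add: rees_def)

lemma mon_rees: "ideal J R \<Longrightarrow> c \<in> pw J k \<Longrightarrow> mon c k \<in> rees J"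
  using idl_carr[OF pw_ideal, of J c k] idl_zero[OF pw_ideal]
  by (intro reesI mon_up) (auto simp: mon_def)

lemma conv_pw:
  assumes "ideal J R" "\<And>n. f n \<in> pw J n" "\<And>n. h n \<in> pw J n" shows "conv f h n \<in> pw J n"
  unfolding conv_def
proof (rule idl_finsum[OF pw_ideal[OF assms(1)]])
  fix i assume "i \<in> {..n}"
  thus "f i \<otimes> h (n - i) \<in> pw J n" using pw_mult[OF assms(1) assms(2,3), of i "n - i"] by simp
qed simp

lemma conv_rees: "ideal J R \<Longrightarrow> f \<in> rees J \<Longrightarrow> h \<in> rees J \<Longrightarrow> conv f h \<in> rees J"
  using conv_pw[of J f h] by (intro reesI conv_up) (auto dest: reesD)

lemma add_rees: "ideal J R \<Longrightarrow> f \<in> rees J \<Longrightarrow> h \<in> rees J \<Longrightarrow> (\<lambda>n. f n \<oplus> h n) \<in> rees J"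
  by (intro reesI up_add_closed idl_add[OF pw_ideal]) (auto dest: reesD)

lemma neg_rees: "ideal J R \<Longrightarrow> f \<in> rees J \<Longrightarrow> (\<lambda>n. \<ominus> f n) \<in> rees J"
  using idl_neg[OF pw_ideal] by (intro reesI up_a_inv_closed) (auto dest: reesD)

lemma rees_subring: "ideal J R \<Longrightarrow> subring (rees J) (UP R)"
proof -
  interpret U: cring "UP R" using UP_is_cring .
  assume J: "ideal J R"
  show ?thesis
  proof (rule U.subringI)
    show "rees J \<subseteq> carrier (UP R)" by (auto simp: UP_carrier dest: reesD)
    show "\<one>\<^bsub>UP R\<^esub> \<in> rees J" unfolding UP_one using J by (intro mon_rees) auto
  qed (use J in \<open>auto simp: UP_uminus UP_mult UP_add reesD neg_rees conv_rees add_rees\<close>)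
qed

lemma rees_mono: "I \<subseteq> J \<Longrightarrow> rees I \<subseteq> rees J"
  using pw_mono[of I J] unfolding rees_def by blast

end

section \<open>The associated graded ring as a quotient of the Rees algebra\<close>

locale graded = cring +
  fixes I assumes I_ideal: "ideal I R"
begin

abbreviation "G \<equiv> assoc_graded_ring R I"
abbreviation "RI \<equiv> (UP R)\<lparr>carrier := rees I\<rparr>"

text \<open>The quotient map from the Rees algebra of \<open>I\<close>. Its kernel consists of the
  \<open>f\<close> with each \<open>f n\<close> in \<open>I^(n+1)\<close>, and computations in
  \<open>G\<close> are made on lifts along it.\<close>

definition ini :: "(nat \<Rightarrow> 'a) \<Rightarrow> nat \<Rightarrow> 'a set" where
  "ini f = (\<lambda>n. pw I (Suc n) +> f n)"

lemma powI: "ideal (pw I n) R" using pw_ideal[OF I_ideal] .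

lemma RI_cring: "cring RI"
proof -
  interpret U: cring "UP R" using UP_is_cring .
  have "subcring (rees I) (UP R)" using U.subcringI' rees_subring[OF I_ideal] by blast
  thus ?thesis using U.subcring_iff[OF subringE(1)[OF rees_subring[OF I_ideal]]] by blast
qed

lemma coset_eq:
  "a \<in> carrier R \<Longrightarrow> b \<in> carrier R \<Longrightarrow> pw I n +> a = pw I n +> b \<longleftrightarrow> a \<ominus> b \<in> pw I n"
  using quotient_eq_iff_same_a_r_cos[OF powI] by blast

lemma coset_zero: "a \<in> carrier R \<Longrightarrow> pw I n +> a = pw I n \<longleftrightarrow> a \<in> pw I n"
  using coset_eq[of a \<zero>] a_rcos_zero[OF powI, of \<zero>] idl_zero[OF powI] by (simp add: a_minus_def)

lemma coset_self: "a \<in> carrier R \<Longrightarrow> a \<in> pw I n +> a"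
  using idl_zero[OF powI, of n] unfolding a_r_coset_def' by force

text \<open>Changing the representatives alters the product by \<open>k (l + h) + f l\<close>, and
  each of the two terms gains one power of \<open>I\<close>.\<close>

lemma rcoset_mult_graded:
  assumes f: "f \<in> pw I i" and h: "h \<in> pw I j" and ij: "i + j = n"
  shows "rcoset_mult R (pw I (Suc n)) (pw I (Suc i) +> f) (pw I (Suc j) +> h) = pw I (Suc n) +> (f \<otimes> h)"
proof -
  have c: "f \<in> carrier R" "h \<in> carrier R" using idl_carr[OF powI f] idl_carr[OF powI h] .
  have "pw I (Suc n) +> (a \<otimes> b) = pw I (Suc n) +> (f \<otimes> h)"
    if ab: "a \<in> pw I (Suc i) +> f" "b \<in> pw I (Suc j) +> h" for a b
  proof -
    obtain k l where kl: "k \<in> pw I (Suc i)" "a = k \<oplus> f" "l \<in> pw I (Suc j)" "b = l \<oplus> h"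
      using ab unfolding a_r_coset_def' by blast
    have cc: "k \<in> carrier R" "l \<in> carrier R" using idl_carr[OF powI kl(1)] idl_carr[OF powI kl(3)] .
    have "l \<in> pw I j" using kl(3) prod_sub_right[OF I_ideal powI] by (auto simp: ideal_power.simps(2))
    hence "l \<oplus> h \<in> pw I j" using h idl_add[OF powI] by blast
    hence "k \<otimes> (l \<oplus> h) \<in> pw I (Suc i + j)" using pw_mult[OF I_ideal kl(1)] by blast
    moreover have "f \<otimes> l \<in> pw I (i + Suc j)" using pw_mult[OF I_ideal f kl(3)] .
    ultimately have "k \<otimes> (l \<oplus> h) \<oplus> f \<otimes> l \<in> pw I (Suc n)" using idl_add[OF powI] ij by auto
    moreover have "k \<otimes> (l \<oplus> h) \<oplus> f \<otimes> l = a \<otimes> b \<ominus> f \<otimes> h" unfolding kl(2,4) using c cc by algebra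
    ultimately show ?thesis using coset_eq[of "a \<otimes> b" "f \<otimes> h" "Suc n"] c cc kl(2,4) by simp
  qed
  moreover have "pw I (Suc i) +> f \<noteq> {}" "pw I (Suc j) +> h \<noteq> {}" using coset_self c by blast+
  ultimately show ?thesis unfolding rcoset_mult_def by auto
qed

lemma ini_closed: "f \<in> rees I \<Longrightarrow> ini f \<in> carrier G"
proof -
  assume f: "f \<in> rees I"
  then obtain N where N: "bound \<zero> N f" using reesD(1) by blast
  have "{n. ini f n \<noteq> pw I (Suc n)} \<subseteq> {..N}"
  proof
    fix n assume n: "n \<in> {n. ini f n \<noteq> pw I (Suc n)}"
    show "n \<in> {..N}"
    proof (rule ccontr)
      assume "n \<notin> {..N}"
      hence "f n = \<zero>" using bound.bound[OF N] by simp
      hence "ini f n = pw I (Suc n)" unfolding ini_def using coset_zero[of \<zero> "Suc n"] idl_zero[OF powI] by simp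
      thus False using n by simp
    qed
  qed
  hence "finite {n. ini f n \<noteq> pw I (Suc n)}" by (rule finite_subset) simp
  moreover have "ini f n \<in> graded_piece R I n" for n
    unfolding graded_piece_def ini_def using reesD(2)[OF f] by blast
  ultimately show ?thesis by (simp add: assoc_graded_ring_def)
qed

lemma ini_surj:
  assumes "F \<in> carrier G" obtains f where "f \<in> rees I" "ini f = F"
proof -
  have F: "\<And>n. F n \<in> graded_piece R I n" "finite {n. F n \<noteq> pw I (Suc n)}"
    using assms by (simp_all add: assoc_graded_ring_def)
  have "\<forall>n. \<exists>a\<in>pw I n. F n = pw I (Suc n) +> a" using F(1) by (auto simp: graded_piece_def)
  then obtain a where a: "\<And>n. a n \<in> pw I n" "\<And>n. F n = pw I (Suc n) +> a n" by metis
  define f where "f n = (if F n = pw I (Suc n) then \<zero> else a n)" for n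
  obtain N where N: "\<And>n. F n \<noteq> pw I (Suc n) \<Longrightarrow> n \<le> N" using F(2) finite_nat_set_iff_bounded_le by auto
  have fI: "f n \<in> pw I n" for n using a(1) idl_zero[OF powI] by (simp add: f_def)
  have "f \<in> up R"
  proof (rule mem_upI)
    show "f n \<in> carrier R" for n using idl_carr[OF powI fI] .
    have "f k = \<zero>" if "N < k" for k
    proof -
      have "F k = pw I (Suc k)" using N[of k] that by (meson not_le)
      thus ?thesis by (simp add: f_def)
    qed
    hence "bound \<zero> N f" by blast
    thus "\<exists>n. bound \<zero> n f" by blast
  qed
  moreover have "ini f = F"
    using a(2) coset_zero[of \<zero>] idl_zero[OF powI] by (auto simp: ini_def f_def fun_eq_iff)
  ultimately show ?thesis using that fI reesI by blast
qed

lemma ini_add: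
  assumes "f \<in> rees I" "h \<in> rees I" shows "ini f \<oplus>\<^bsub>G\<^esub> ini h = ini (\<lambda>n. f n \<oplus> h n)"
  using ideal.a_rcos_sum[OF powI] reesD(3)[OF assms(1)] reesD(3)[OF assms(2)]
  by (simp add: assoc_graded_ring_def ini_def)

lemma ini_mult:
  assumes f: "f \<in> rees I" and h: "h \<in> rees I" shows "ini f \<otimes>\<^bsub>G\<^esub> ini h = ini (conv f h)"
proof
  fix n
  let ?K = "pw I (Suc n)"
  interpret h: ring_hom_ring R "R Quot ?K" "(+>) ?K" using ideal.rcos_ring_hom_ring[OF powI] .
  have c: "\<And>n. f n \<in> carrier R" "\<And>n. h n \<in> carrier R" using reesD f h by blast+
  have "(ini f \<otimes>\<^bsub>G\<^esub> ini h) n = finsum (R Quot ?K) (\<lambda>i. rcoset_mult R ?K (ini f i) (ini h (n - i))) {..n}"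
    by (simp add: assoc_graded_ring_def)
  also have "\<dots> = finsum (R Quot ?K) (\<lambda>i. ?K +> (f i \<otimes> h (n - i))) {..n}"
  proof (rule h.S.finsum_cong')
    show "(\<lambda>i. ?K +> (f i \<otimes> h (n - i))) \<in> {..n} \<rightarrow> carrier (R Quot ?K)" using c h.hom_closed by auto
    fix i assume i: "i \<in> {..n}"
    show "rcoset_mult R ?K (ini f i) (ini h (n - i)) = ?K +> (f i \<otimes> h (n - i))"
      unfolding ini_def by (rule rcoset_mult_graded[OF reesD(2)[OF f] reesD(2)[OF h]]) (use i in simp)
  qed simp
  also have "\<dots> = ?K +> (\<Oplus>i\<in>{..n}. f i \<otimes> h (n - i))"
    using h.hom_finsum[of "\<lambda>i. f i \<otimes> h (n - i)" "{..n}"] c by (simp add: o_def)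
  finally show "(ini f \<otimes>\<^bsub>G\<^esub> ini h) n = ini (conv f h) n" by (simp add: ini_def conv_def)
qed

lemma ini_one: "\<one>\<^bsub>G\<^esub> = ini (mon \<one> 0)"
  by (simp add: assoc_graded_ring_def ini_def mon_def)

lemma ini_eq_zero: "f \<in> rees I \<Longrightarrow> ini f = \<zero>\<^bsub>G\<^esub> \<longleftrightarrow> (\<forall>n. f n \<in> pw I (Suc n))"
proof -
  assume f: "f \<in> rees I"
  have "ini f = \<zero>\<^bsub>G\<^esub> \<longleftrightarrow> (\<forall>n. pw I (Suc n) +> f n = pw I (Suc n))"
    by (simp only: assoc_graded_ring_def ini_def fun_eq_iff ring.simps)
  thus ?thesis using coset_zero[OF reesD(3)[OF f]] by blast
qed

lemma ini_hom: "ini \<in> ring_hom RI G"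
  by (rule ring_hom_memI) (simp_all add: ini_closed UP_mult UP_add UP_one ini_add ini_mult ini_one reesD)

lemma zero_rees: "(\<lambda>n. \<zero>) \<in> rees I"
  using subringE(2)[OF rees_subring[OF I_ideal]] by (simp add: UP_zero)

text \<open>As \<open>ini\<close> respects the operations and is onto, the ring axioms are inherited
  from the Rees algebra.\<close>

lemma G_cring: "cring G"
proof -
  interpret RI: cring RI using RI_cring .
  have im: "ini ` carrier RI = carrier G"
  proof
    show "ini ` carrier RI \<subseteq> carrier G" using ini_closed by auto
    show "carrier G \<subseteq> ini ` carrier RI"
    proof
      fix F assume "F \<in> carrier G"
      then obtain f where "f \<in> rees I" "ini f = F" by (rule ini_surj)
      thus "F \<in> ini ` carrier RI" by auto
    qed
  qed
  have z: "ini \<zero>\<^bsub>RI\<^esub> = \<zero>\<^bsub>G\<^esub>"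
    using ini_eq_zero[OF zero_rees] idl_zero[OF powI] by (simp add: UP_zero)
  have "ring (G\<lparr>carrier := ini ` carrier RI, zero := ini \<zero>\<^bsub>RI\<^esub>\<rparr>)"
    using RI.ring_hom_imp_img_ring[OF ini_hom] .
  hence "ring G" unfolding im z by simp
  then interpret G: ring G .
  show ?thesis
  proof (rule cring.intro[OF G.ring_axioms], rule G.monoid_comm_monoidI)
    fix x y assume "x \<in> carrier G" "y \<in> carrier G"
    then obtain f h where "f \<in> rees I" "ini f = x" "h \<in> rees I" "ini h = y" by (metis ini_surj)
    thus "x \<otimes>\<^bsub>G\<^esub> y = y \<otimes>\<^bsub>G\<^esub> x" using ini_mult conv_comm reesD(1) by metis
  qed
qed

lemma ini_ring_hom: "ring_hom_ring RI G ini"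
  using ring_hom_ringI2[OF cring.axioms(1)[OF RI_cring] cring.axioms(1)[OF G_cring] ini_hom] .

end

text \<open>The link reduced to what the graded ring sees: \<open>pwI\<close> is the reduction
  number, \<open>nzd_I\<close> reflects that R/I embeds into a power of R/J, and
  \<open>unmixed\<close> says that primes above \<open>J\<close> made of zero divisors modulo
  \<open>J\<close> are minimal over \<open>J\<close>.\<close>

locale reduced_graded = graded + noetherian_cring +
  fixes J g
  assumes J: "reg_ideal g J" "J \<subseteq> I" and pwI: "\<And>n. pw I (Suc n) = pw J n \<cdot> I"
    and nzd_I: "\<And>a. nzd J a \<Longrightarrow> nzd I a"
    and unmixed: "\<And>q Q. primeideal q R \<Longrightarrow> J \<subseteq> q \<Longrightarrow> (\<And>a. a \<in> q \<Longrightarrow> \<not> nzd J a) \<Longrightarrow>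
      primeideal Q R \<Longrightarrow> J \<subseteq> Q \<Longrightarrow> Q \<subseteq> q \<Longrightarrow> Q = q"
begin

lemma J_ideal: "ideal J R" using reg_ideal_ideal[OF J(1)] .

lemma powJ: "ideal (pw J n) R" using pw_ideal[OF J_ideal] .

lemma J_compat: "colon_compat J" using reg_ideal_colon_compat[OF J(1)] .

lemma pwI_sub_pwJ: "pw I (Suc n) \<subseteq> pw J n"
  unfolding pwI using prod_sub_left[OF powJ I_ideal] .

text \<open>As \<open>I^(n+1) = J^n I\<close>, cancelling \<open>a\<close> modulo \<open>J^n\<close>
  puts \<open>u\<close> into \<open>J^n\<close>, and the colon property with \<open>K = I\<close>
  then uses \<open>I : a = I\<close>.\<close>

lemma nzd_graded:
  assumes a: "nzd J a" and u: "u \<in> carrier R" "a \<otimes> u \<in> pw I (Suc n)" shows "u \<in> pw I (Suc n)"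
proof -
  have ac: "a \<in> carrier R" using a by (simp add: nzd_def)
  have "a \<otimes> u \<in> pw J n" using u pwI_sub_pwJ by blast
  hence uJ: "u \<in> pw J n" using nzdD'[OF colon_compat_nzd_pw[OF J_ideal J_compat a] u(1)] by blast
  have "u \<in> pw J n \<cdot> colon_ideal R I {a}"
    using u ac by (intro colon_compatD[OF J_compat I_ideal J(2) _ uJ]) (auto simp: pwI)
  thus ?thesis using colon_nzd[OF nzd_I[OF a] I_ideal] by (simp add: pwI)
qed

lemma mon0_rees: "a \<in> carrier R \<Longrightarrow> mon a 0 \<in> rees I"
  by (intro mon_rees I_ideal) (simp add: ideal_power.simps)

lemma conv_mon0: "a \<in> carrier R \<Longrightarrow> f \<in> rees I \<Longrightarrow> conv (mon a 0) f = (\<lambda>n. a \<otimes> f n)"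
  using conv_mon[of a f 0] reesD(3) by (auto simp: fun_eq_iff)

lemma conv_mon0_mon:
  assumes "a \<in> carrier R" "b \<in> carrier R" shows "conv (mon a 0) (mon b n) = mon (a \<otimes> b) n"
proof -
  have "mon b n k \<in> carrier R" for k using assms by (simp add: mon_def)
  thus ?thesis using assms conv_mon[of a "mon b n" 0] by (auto simp: fun_eq_iff) (simp_all add: mon_def)
qed

lemma ini_zero: "ini (\<lambda>_. \<zero>) = \<zero>\<^bsub>G\<^esub>"
  using ini_eq_zero[OF zero_rees] idl_zero[OF powI] by simp

definition deg0 :: "(nat \<Rightarrow> 'a set) set \<Rightarrow> 'a set" where
  "deg0 P = {a \<in> carrier R. ini (mon a 0) \<in> P}"

lemma deg0_prime:
  assumes "primeideal P G" shows "primeideal (deg0 P) R" "I \<subseteq> deg0 P"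
proof -
  interpret G: cring G using G_cring .
  have "(\<lambda>a. ini (mon a 0)) \<in> ring_hom R G"
  proof (rule ring_hom_memI)
    fix a b assume ab: "a \<in> carrier R" "b \<in> carrier R"
    show "ini (mon a 0) \<in> carrier G" using ini_closed mon0_rees ab by blast
    show "ini (mon (a \<otimes> b) 0) = ini (mon a 0) \<otimes>\<^bsub>G\<^esub> ini (mon b 0)"
      using ini_mult[OF mon0_rees[OF ab(1)] mon0_rees[OF ab(2)]] conv_mon0_mon[OF ab] by simp
    have "(\<lambda>n. mon a 0 n \<oplus> mon b 0 n) = mon (a \<oplus> b) 0" by (auto simp: mon_def fun_eq_iff)
    thus "ini (mon (a \<oplus> b) 0) = ini (mon a 0) \<oplus>\<^bsub>G\<^esub> ini (mon b 0)"
      using ini_add[OF mon0_rees[OF ab(1)] mon0_rees[OF ab(2)]] by simp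
  qed (simp add: ini_one)
  then interpret h: ring_hom_ring R G "\<lambda>a. ini (mon a 0)"
    by (rule ring_hom_ringI2[OF ring_axioms G.ring_axioms])
  have P: "ideal P G" "\<one>\<^bsub>G\<^esub> \<notin> P" using G.prime_ideal G.prime_one assms by blast+
  show "primeideal (deg0 P) R"
  proof (rule primeI)
    show "ideal (deg0 P) R" unfolding deg0_def using h.ideal_vimage[OF P(1)] .
    show "\<one> \<notin> deg0 P" using P(2) unfolding ini_one deg0_def by blast
    fix a b assume ab: "a \<in> carrier R" "b \<in> carrier R" "a \<otimes> b \<in> deg0 P"
    hence "ini (mon a 0) \<otimes>\<^bsub>G\<^esub> ini (mon b 0) \<in> P" using h.hom_mult[of a b] by (simp add: deg0_def)
    thus "a \<in> deg0 P \<or> b \<in> deg0 P"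
      using G.prime_multD[OF assms] ini_closed mon0_rees ab by (auto simp: deg0_def)
  qed
  show "I \<subseteq> deg0 P"
  proof
    fix a assume a: "a \<in> I"
    have ac: "a \<in> carrier R" using idl_carr[OF I_ideal a] .
    have "ini (mon a 0) = \<zero>\<^bsub>G\<^esub>" using ini_eq_zero[OF mon0_rees[OF ac]] a idl_zero[OF powI]
      by (auto simp: mon_def pw_one[OF I_ideal])
    thus "a \<in> deg0 P" using ac G.idl_zero[OF P(1)] by (simp add: deg0_def)
  qed
qed

lemma ini_mem_if_coeffs:
  assumes Q: "ideal Q G" and f: "f \<in> rees I" "\<And>n. ini (mon (f n) n) \<in> Q"
  shows "ini f \<in> Q"
proof -
  interpret G: cring G using G_cring .
  have "ini f \<in> Q" if "f \<in> rees I" "\<And>n. ini (mon (f n) n) \<in> Q" "\<And>k. N \<le> k \<Longrightarrow> f k = \<zero>" for N f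
    using that
  proof (induction N arbitrary: f)
    case 0
    hence "f = (\<lambda>_. \<zero>)" by auto
    hence "ini f = \<zero>\<^bsub>G\<^esub>" using ini_zero by metis
    thus ?case using G.idl_zero[OF Q] by simp
  next
    case (Suc N)
    let ?f = "f(N := \<zero>)"
    have m: "mon (f N) N \<in> rees I" using mon_rees[OF I_ideal reesD(2)[OF Suc.prems(1)]] .
    have fu: "?f \<in> rees I"
    proof (rule reesI)
      show "?f \<in> up R"
      proof (rule mem_upI)
        show "?f n \<in> carrier R" for n using reesD(3)[OF Suc.prems(1)] by simp
        obtain k where "bound \<zero> k f" using reesD(1)[OF Suc.prems(1)] by blast
        hence "bound \<zero> k ?f" by (auto simp: bound_def)
        thus "\<exists>n. bound \<zero> n ?f" by blast
      qed
      show "?f n \<in> pw I n" for n using reesD(2)[OF Suc.prems(1)] idl_zero[OF powI] by simp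
    qed
    have z: "mon \<zero> n = (\<lambda>_. \<zero>)" for n by (auto simp: mon_def)
    have "ini (mon (?f n) n) \<in> Q" for n using Suc.prems(2)[of n] G.idl_zero[OF Q] by (simp add: z ini_zero)
    moreover have "?f k = \<zero>" if "N \<le> k" for k using Suc.prems(3)[of k] that by (cases "k = N") auto
    ultimately have "ini ?f \<in> Q" using Suc.IH[OF fu] by blast
    moreover have "(\<lambda>n. ?f n \<oplus> mon (f N) N n) = f"
      using reesD(3)[OF Suc.prems(1)] by (auto simp: mon_def fun_eq_iff)
    hence "ini f = ini ?f \<oplus>\<^bsub>G\<^esub> ini (mon (f N) N)" using ini_add[OF fu m] by simp
    ultimately show ?case using G.idl_add[OF Q] Suc.prems(2)[of N] by simp
  qed
  moreover obtain N where "bound \<zero> N f" using reesD(1)[OF f(1)] by blast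
  hence "f k = \<zero>" if "Suc N \<le> k" for k using that by (intro bound.bound) auto
  ultimately show ?thesis using f by blast
qed

text \<open>The constants of \<open>Q\<close> generate an ideal inside \<open>Q\<close>, whether or
  not \<open>Q\<close> is homogeneous. Read backwards, an \<open>f\<close> with \<open>ini f\<close>
  outside \<open>Q\<close> has a coefficient outside \<open>J^n deg0 Q\<close>.\<close>

lemma ini_mem_if_coeffs_deg0:
  assumes Q: "primeideal Q G" and f: "f \<in> rees J" "\<And>n. f n \<in> pw J n \<cdot> deg0 Q"
  shows "ini f \<in> Q"
proof -
  interpret G: cring G using G_cring .
  have Qi: "ideal Q G" using Q G.prime_ideal by blast
  have fI: "f \<in> rees I" using f(1) rees_mono[OF J(2)] by blast
  have dq: "ideal (deg0 Q) R" using deg0_prime(1)[OF Q] prime_ideal by blast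
  have "ini (mon w n) \<in> Q" if "w \<in> pw J n \<cdot> deg0 Q" for w n
    using that
  proof (induction w rule: ideal_prod.induct)
    case (prod i a)
    have a: "a \<in> carrier R" "ini (mon a 0) \<in> Q" using prod(2) by (auto simp: deg0_def)
    have i: "i \<in> carrier R" using idl_carr[OF powJ prod(1)] .
    have "mon i n \<in> rees J" using mon_rees[OF J_ideal prod(1)] .
    hence m: "mon i n \<in> rees I" using rees_mono[OF J(2)] by blast
    have "conv (mon a 0) (mon i n) = mon (i \<otimes> a) n"
      using conv_mon0_mon[OF a(1) i] m_comm[OF a(1) i] by simp
    hence "ini (mon (i \<otimes> a) n) = ini (mon a 0) \<otimes>\<^bsub>G\<^esub> ini (mon i n)" using ini_mult[OF mon0_rees[OF a(1)] m] by simp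
    thus ?case using G.idl_r[OF Qi a(2) ini_closed[OF m]] by simp
  next
    case (sum s t)
    have st: "s \<in> pw J n" "t \<in> pw J n" using sum(1,2) prod_sub_left[OF powJ dq] by blast+
    have c: "s \<in> carrier R" "t \<in> carrier R" using idl_carr[OF powJ st(1)] idl_carr[OF powJ st(2)] .
    have m: "mon s n \<in> rees I" "mon t n \<in> rees I"
      using mon_rees[OF J_ideal] st rees_mono[OF J(2)] by blast+
    have "(\<lambda>k. mon s n k \<oplus> mon t n k) = mon (s \<oplus> t) n" by (auto simp: mon_def fun_eq_iff)
    hence "ini (mon (s \<oplus> t) n) = ini (mon s n) \<oplus>\<^bsub>G\<^esub> ini (mon t n)" using ini_add[OF m] by simp
    thus ?case using G.idl_add[OF Qi sum(3,4)] by simp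
  qed
  thus ?thesis using ini_mem_if_coeffs[OF Qi fI] f(2) by blast
qed

text \<open>Since \<open>I^(n+1) = J^n I\<close>, generators of \<open>I\<close> placed in degree
  one generate the part of positive degree over the image of \<open>rees J\<close>. They are split
  off one after the other.\<close>

lemma rees_span:
  assumes Q: "ideal Q G"
  shows "set E \<subseteq> I \<Longrightarrow> f \<in> rees I \<Longrightarrow> f 0 = \<zero> \<Longrightarrow> (\<And>n. f (Suc n) \<in> pw J n \<cdot> (Idl (set E))) \<Longrightarrow>
    cring.in_span G (ini ` rees J) Q (map (\<lambda>e. ini (mon e 1)) E) (ini f)"
proof (induction E arbitrary: f)
  interpret G: cring G using G_cring .
  {
    case Nil
    have "f n = \<zero>" for n
    proof (cases n)
      case (Suc k)
      have "f n \<in> pw J k \<cdot> {\<zero>}" using Nil.prems(4)[of k] Suc by (simp add: Idl_empty)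
      thus ?thesis using ideal_prod_zero[OF powJ] by simp
    qed (use Nil.prems in simp)
    hence "f = (\<lambda>_. \<zero>)" by auto
    hence "ini f = \<zero>\<^bsub>G\<^esub>" using ini_zero by metis
    thus ?case using G.idl_zero[OF Q] by simp
  next
    case (Cons e E)
    have e: "e \<in> I" "e \<in> carrier R" using Cons.prems(1) idl_carr[OF I_ideal] by auto
    have Ec: "set (e # E) \<subseteq> carrier R" using Cons.prems(1) idl_sub[OF I_ideal] by blast
    hence K: "ideal (Idl (set E)) R" by (intro genideal_ideal) auto
    have KI: "Idl (set E) \<subseteq> I" using genideal_minimal[OF I_ideal] Cons.prems(1) by auto
    \<comment> \<open>Demanding \<open>v = \<zero>\<close> where \<open>f\<close> vanishes keeps the
      support of the coefficient sequence finite, so that it belongs to the Rees algebra.\<close>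
    have dec: "\<exists>k\<in>pw J n \<cdot> (Idl (set E)). \<exists>v\<in>pw J n. f (Suc n) = k \<oplus> e \<otimes> v \<and> (f (Suc n) = \<zero> \<longrightarrow> v = \<zero>)" for n
    proof (cases "f (Suc n) = \<zero>")
      case True
      have "\<zero> \<in> pw J n \<cdot> (Idl (set E))" "\<zero> \<in> pw J n"
        using idl_zero[OF ideal_prod_is_ideal[OF powJ K]] idl_zero[OF powJ] .
      thus ?thesis using True e(2) by (intro bexI[of _ \<zero>]) auto
    next
      case False
      thus ?thesis using prod_adj_decomp[OF powJ K e(2)] Cons.prems(4)[of n] unfolding Idl_Cons[OF Ec] by blast
    qed
    then obtain k v where kv: "\<And>n. k n \<in> pw J n \<cdot> (Idl (set E))" "\<And>n. v n \<in> pw J n"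
      "\<And>n. f (Suc n) = k n \<oplus> e \<otimes> v n" "\<And>n. f (Suc n) = \<zero> \<Longrightarrow> v n = \<zero>" by metis
    have c: "k n \<in> carrier R" "v n \<in> carrier R" for n
      using idl_carr[OF ideal_prod_is_ideal[OF powJ K] kv(1)] idl_carr[OF powJ kv(2)] .
    obtain N where N: "bound \<zero> N f" using reesD(1)[OF Cons.prems(2)] by blast
    have "bound \<zero> N v"
    proof (rule bound.intro)
      fix m assume "N < m"
      hence "f (Suc m) = \<zero>" using bound.bound[OF N, of "Suc m"] by simp
      thus "v m = \<zero>" using kv(4) by blast
    qed
    hence "v \<in> up R" using c by (intro mem_upI) blast+
    hence vJ: "v \<in> rees J" using kv(2) by (rule reesI)
    hence vI: "v \<in> rees I" using rees_mono[OF J(2)] by blast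
    have me: "mon e 1 \<in> rees I" using e by (intro mon_rees I_ideal) (simp add: pw_one[OF I_ideal])
    let ?h = "\<lambda>n. f n \<oplus> (\<ominus> conv (mon e 1) v n)"
    have cme: "conv (mon e 1) v n = (if 1 \<le> n then e \<otimes> v (n - 1) else \<zero>)" for n
      using conv_mon[OF e(2) c(2)] .
    have h: "?h \<in> rees I"
      using add_rees[OF I_ideal Cons.prems(2) neg_rees[OF I_ideal conv_rees[OF I_ideal me vI]]] .
    have "?h (Suc n) = k n" for n
    proof -
      have "?h (Suc n) = (k n \<oplus> e \<otimes> v n) \<ominus> e \<otimes> v n" unfolding cme kv(3) a_minus_def by simp
      also have "\<dots> = k n" using c e(2) by algebra
      finally show ?thesis .
    qed
    moreover have "?h 0 = \<zero>" unfolding cme Cons.prems(3) by simp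
    ultimately have "G.in_span (ini ` rees J) Q (map (\<lambda>e. ini (mon e 1)) E) (ini ?h)"
      using Cons.IH[OF _ h] Cons.prems(1) kv(1) by simp
    moreover have "ini ?h = ini f \<ominus>\<^bsub>G\<^esub> ini v \<otimes>\<^bsub>G\<^esub> ini (mon e 1)"
    proof -
      let ?w = "conv (mon e 1) v"
      have w: "?w \<in> rees I" using conv_rees[OF I_ideal me vI] .
      have "(\<lambda>n. ?h n \<oplus> ?w n) = f"
        using reesD(3)[OF w] reesD(3)[OF Cons.prems(2)] by (simp add: a_assoc l_neg)
      hence "ini f = ini ?h \<oplus>\<^bsub>G\<^esub> ini ?w" using ini_add[OF h w] by simp
      moreover have "ini ?w = ini v \<otimes>\<^bsub>G\<^esub> ini (mon e 1)"
        using ini_mult[OF vI me] conv_comm[OF reesD(1)[OF vI] reesD(1)[OF me]] by simp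
      ultimately show ?thesis
        using ini_closed[OF h] ini_closed[OF w] by (simp add: a_minus_def G.a_assoc G.r_neg G.minus_eq)
    qed
    ultimately show ?case using vJ by auto
  }
qed

text \<open>Two cancellations follow the two layers of the filtration: modulo \<open>J\<close> on
  the coefficients of positive degree, which yields \<open>s h n\<close> in \<open>J^n\<close>, and
  then modulo \<open>I\<close>.\<close>

lemma graded_cancel:
  assumes q: "primeideal q R" "J \<subseteq> q" and min: "\<And>Q. primeideal Q R \<Longrightarrow> J \<subseteq> Q \<Longrightarrow> Q \<subseteq> q \<Longrightarrow> Q = q"
    and f: "f \<in> rees J" "\<exists>n. f n \<notin> pw J n \<cdot> q" and h: "h \<in> rees I"
    and fh: "\<And>n. conv f h n \<in> pw I (Suc n)"
  shows "\<exists>s\<in>carrier R - q. \<forall>n. s \<otimes> h n \<in> pw I (Suc n)"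
proof -
  have c: "f n \<in> carrier R" "h n \<in> carrier R" for n using reesD(3) f h by blast+
  have fJ: "\<And>n. f n \<in> pw J n" using reesD(2)[OF f(1)] .
  have hJ: "h (Suc n) \<in> pw J n" for n using reesD(2)[OF h, of "Suc n"] pwI_sub_pwJ by blast
  \<comment> \<open>\<open>I^(n+1)\<close> lies in \<open>J^n\<close>, so the tail of
    \<open>h\<close> is measured against the powers of \<open>J\<close> after a shift by one. The
    constant term contributes only \<open>f (Suc n) h 0\<close>, already in
    \<open>J^(n+1)\<close>.\<close>
  have "conv f (\<lambda>n. h (Suc n)) n \<in> pw J n \<cdot> J" for n
  proof -
    have "conv f h (Suc n) = (\<Oplus>i\<in>{..n}. f i \<otimes> h (Suc n - i)) \<oplus> f (Suc n) \<otimes> h 0"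
      unfolding conv_def using c by (subst finsum_Suc) (auto simp: a_comm)
    also have "(\<Oplus>i\<in>{..n}. f i \<otimes> h (Suc n - i)) = conv f (\<lambda>n. h (Suc n)) n"
      unfolding conv_def using c by (intro finsum_cong') (auto simp: Suc_diff_le)
    finally have e: "conv f h (Suc n) = conv f (\<lambda>n. h (Suc n)) n \<oplus> f (Suc n) \<otimes> h 0" .
    have "conv f h (Suc n) \<in> pw J (Suc n)" using fh[of "Suc n"] pwI_sub_pwJ by blast
    moreover have "f (Suc n) \<otimes> h 0 \<in> pw J (Suc n)" using idl_r[OF powJ fJ c(2)] .
    moreover have "conv f (\<lambda>n. h (Suc n)) n \<in> carrier R" unfolding conv_def using c by auto
    ultimately have "conv f (\<lambda>n. h (Suc n)) n \<in> pw J (Suc n)" unfolding e using idl_add_cancel'[OF powJ] by blast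
    thus ?thesis unfolding pw_Suc_right[OF J_ideal] .
  qed
  then obtain s where s: "s \<in> carrier R - q" "\<And>n. s \<otimes> h (Suc n) \<in> pw J n \<cdot> J"
    using conv_cancel[OF J(1) q min fJ f(2) hJ J_ideal order_refl] by blast
  have sc: "s \<in> carrier R" using s by blast
  have sh: "s \<otimes> h n \<in> pw J n" for n
  proof (cases n)
    case 0 thus ?thesis using sc c by (simp add: ideal_power.simps)
  next
    case (Suc k) thus ?thesis using s(2)[of k] pw_Suc_right[OF J_ideal] by simp
  qed
  have "conv f (\<lambda>n. s \<otimes> h n) n \<in> pw J n \<cdot> I" for n
  proof -
    have "conv f (\<lambda>n. s \<otimes> h n) n = (\<Oplus>i\<in>{..n}. s \<otimes> (f i \<otimes> h (n - i)))"
      unfolding conv_def using c sc by (intro finsum_cong') (auto simp: m_lcomm)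
    also have "\<dots> = s \<otimes> conv f h n" unfolding conv_def using c sc by (intro finsum_rdistr[symmetric]) auto
    also have "\<dots> \<in> pw I (Suc n)" using idl_l[OF powI fh sc] .
    finally show ?thesis unfolding pwI .
  qed
  then obtain t where t: "t \<in> carrier R - q" "\<And>n. t \<otimes> (s \<otimes> h n) \<in> pw J n \<cdot> I"
    using conv_cancel[OF J(1) q min fJ f(2) sh I_ideal J(2)] by blast
  have "t \<otimes> s \<otimes> h n \<in> pw I (Suc n)" for n
    using t(2)[of n] t(1) sc c unfolding pwI by (simp add: m_assoc)
  thus ?thesis using prime_complD[OF q(1) t(1) s(1)] by blast
qed

theorem graded_serre_1: "serre_condition G 1"
  unfolding serre_condition_def
proof (intro allI impI)
  fix P assume P: "primeideal P G"
  interpret G: cring G using G_cring .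
  interpret L: localization_at_prime G P
    by (intro localization_at_prime.intro localization_at_prime_axioms.intro G_cring P)
  have Pi: "ideal P G" using P G.prime_ideal by blast
  let ?q = "deg0 P"
  have q: "primeideal ?q R" "J \<subseteq> ?q" using deg0_prime[OF P] J(2) by auto
  show "min (enat 1) (krull_dim (local_at G P)) \<le> depth (local_at G P) (local_at_max G P)"
  proof (cases "\<exists>a\<in>?q. nzd J a")
    case True
    then obtain a where a: "a \<in> carrier R" "ini (mon a 0) \<in> P" "nzd J a" by (auto simp: deg0_def)
    have "enat 1 \<le> depth (local_at G P) (local_at_max G P)"
    proof (rule L.depth_ge_one[OF a(2)])
      fix H assume H: "H \<in> carrier G" "H \<otimes>\<^bsub>G\<^esub> ini (mon a 0) = \<zero>\<^bsub>G\<^esub>"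
      obtain h where h: "h \<in> rees I" "ini h = H" using ini_surj[OF H(1)] .
      have "ini (conv (mon a 0) h) = \<zero>\<^bsub>G\<^esub>"
        using H h ini_mult[OF mon0_rees[OF a(1)] h(1)] ini_closed[OF mon0_rees[OF a(1)]] G.m_comm by simp
      hence "a \<otimes> h n \<in> pw I (Suc n)" for n
        using ini_eq_zero[OF conv_rees[OF I_ideal mon0_rees[OF a(1)] h(1)]] conv_mon0[OF a(1) h(1)] by simp
      hence "h n \<in> pw I (Suc n)" for n using nzd_graded[OF a(3) reesD(3)[OF h(1)]] by blast
      hence "H = \<zero>\<^bsub>G\<^esub>" using ini_eq_zero[OF h(1)] h(2) by blast
      thus "\<exists>s\<in>carrier G - P. s \<otimes>\<^bsub>G\<^esub> H = \<zero>\<^bsub>G\<^esub>" using L.S_one by (intro bexI[of _ "\<one>\<^bsub>G\<^esub>"]) auto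
    qed
    thus ?thesis by (simp add: min.coboundedI1)
  next
    case False
    \<comment> \<open>All of \<open>?q\<close> consists of zero divisors modulo \<open>J\<close>, so
      no constant can serve as the nonzerodivisor, but now \<open>?q\<close> is minimal over
      \<open>J\<close>.\<close>
    have min: "\<And>Q. primeideal Q R \<Longrightarrow> J \<subseteq> Q \<Longrightarrow> Q \<subseteq> ?q \<Longrightarrow> Q = ?q"
      using unmixed[OF q] False by blast
    show ?thesis
    proof (cases "\<exists>Q. primeideal Q G \<and> Q \<subset> P")
      case False
      hence "krull_dim (local_at G P) = 0" by (intro L.height_zero) blast
      thus ?thesis by simp
    next
      case True
      then obtain Q where Q: "primeideal Q G" "Q \<subset> P" by blast
      have Qi: "ideal Q G" using Q G.prime_ideal by blast
      have "deg0 Q \<subseteq> ?q" using Q by (auto simp: deg0_def)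
      \<comment> \<open>No constant separates \<open>Q\<close> from \<open>P\<close>;
        incomparability over the image of \<open>rees J\<close> has to supply the separating
        element.\<close>
      hence qQ: "deg0 Q = ?q" using min deg0_prime[OF Q(1)] J(2) by blast
      obtain A where A: "A \<subseteq> carrier R" "finite A" "I = Idl A" using finetely_gen[OF I_ideal] by blast
      obtain E where E: "set E = A" using finite_list[OF A(2)] by blast
      have EI: "set E \<subseteq> I" using genideal_self[OF A(1)] A(3) E by simp
      have B: "subring (ini ` rees J) G"
      proof -
        interpret U: cring "UP R" using UP_is_cring .
        have "subring (rees J) RI"
        proof -
          have "subring (rees J) (UP R)" using rees_subring[OF J_ideal] .
          hence "ring ((UP R)\<lparr>carrier := rees J\<rparr>)" by (rule U.subring_is_ring)
          moreover have "rees J \<subseteq> rees I" using rees_mono[OF J(2)] .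
          ultimately show ?thesis
            using ring.ring_incl_imp_subring[OF cring.axioms(1)[OF RI_cring], of "rees J"] by simp
        qed
        thus ?thesis using ring_hom_ring.img_is_subring[OF ini_ring_hom] by blast
      qed
      \<comment> \<open>The unit accounts for degree zero, and generators of \<open>I\<close> placed
        in degree one account for all higher degrees.\<close>
      let ?es = "\<one>\<^bsub>G\<^esub> # map (\<lambda>e. ini (mon e 1)) E"
      have m1: "mon e 1 \<in> rees I" if "e \<in> I" for e
        using that by (intro mon_rees I_ideal) (simp add: pw_one[OF I_ideal])
      have es: "set ?es \<subseteq> carrier G" using ini_closed[OF m1] EI by auto
      have span: "G.in_span (ini ` rees J) Q ?es F" if F: "F \<in> carrier G" for F
      proof -
        obtain h where h: "h \<in> rees I" "ini h = F" using ini_surj[OF F] .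
        let ?m = "mon (h 0) 0"
        have h0: "h 0 \<in> carrier R" using reesD(3)[OF h(1)] .
        have mJ: "?m \<in> rees J" using h0 by (intro mon_rees J_ideal) (simp add: ideal_power.simps)
        have mI: "?m \<in> rees I" using mon0_rees[OF h0] .
        let ?h = "\<lambda>n. h n \<oplus> (\<ominus> ?m n)"
        have hI: "?h \<in> rees I" using add_rees[OF I_ideal h(1) neg_rees[OF I_ideal mI]] .
        have "?h 0 = \<zero>" using h0 by (simp add: mon_def r_neg)
        moreover have "?h (Suc n) \<in> pw J n \<cdot> (Idl (set E))" for n
          using reesD(2)[OF h(1), of "Suc n"] reesD(3)[OF h(1)] pwI A(3) E by (simp add: mon_def)
        ultimately have "G.in_span (ini ` rees J) Q (map (\<lambda>e. ini (mon e 1)) E) (ini ?h)"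
          by (intro rees_span[OF Qi EI hI])
        moreover have "(\<lambda>n. ?h n \<oplus> ?m n) = h"
          using reesD(3)[OF h(1)] reesD(3)[OF mI] by (simp add: a_assoc l_neg)
        hence "F = ini ?h \<oplus>\<^bsub>G\<^esub> ini ?m" using ini_add[OF hI mI] h(2) by simp
        hence "ini ?h = F \<ominus>\<^bsub>G\<^esub> ini ?m \<otimes>\<^bsub>G\<^esub> \<one>\<^bsub>G\<^esub>"
          using ini_closed[OF hI] ini_closed[OF mI] by (simp add: G.minus_eq G.a_assoc G.r_neg)
        ultimately show ?thesis using mJ by auto
      qed
      obtain F where "F \<in> ini ` rees J" "F \<in> P" "F \<notin> Q"
        using G.finite_extension_incomparable[OF P Q B es span] by blast
      then obtain f where f: "f \<in> rees J" "ini f \<in> P" "ini f \<notin> Q" by blast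
      have fI: "f \<in> rees I" using f(1) rees_mono[OF J(2)] by blast
      \<comment> \<open>Being outside \<open>Q\<close>, \<open>f\<close> cannot have all its
        coefficients in the ideal generated by the common contraction \<open>?q\<close>. It can
        therefore be cancelled up to a constant outside \<open>?q\<close>, which is a unit at
        \<open>P\<close>.\<close>
      have fq: "\<exists>n. f n \<notin> pw J n \<cdot> ?q" using ini_mem_if_coeffs_deg0[OF Q(1) f(1)] f(3) qQ by auto
      have "enat 1 \<le> depth (local_at G P) (local_at_max G P)"
      proof (rule L.depth_ge_one[OF f(2)])
        fix H assume H: "H \<in> carrier G" "H \<otimes>\<^bsub>G\<^esub> ini f = \<zero>\<^bsub>G\<^esub>"
        obtain h where h: "h \<in> rees I" "ini h = H" using ini_surj[OF H(1)] .
        have "ini (conv f h) = \<zero>\<^bsub>G\<^esub>" using H h ini_mult[OF fI h(1)] ini_closed[OF fI] G.m_comm by simp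
        hence "conv f h n \<in> pw I (Suc n)" for n using ini_eq_zero[OF conv_rees[OF I_ideal fI h(1)]] by blast
        then obtain s where s: "s \<in> carrier R" "s \<notin> ?q" "\<And>n. s \<otimes> h n \<in> pw I (Suc n)"
          using graded_cancel[OF q min f(1) fq h(1)] by blast
        have ms: "mon s 0 \<in> rees I" using mon0_rees[OF s(1)] .
        have "ini (mon s 0) \<otimes>\<^bsub>G\<^esub> H = ini (conv (mon s 0) h)" using ini_mult[OF ms h(1)] h(2) by simp
        also have "\<dots> = \<zero>\<^bsub>G\<^esub>"
          using ini_eq_zero[OF conv_rees[OF I_ideal ms h(1)]] s(3) conv_mon0[OF s(1) h(1)] by simp
        finally show "\<exists>s\<in>carrier G - P. s \<otimes>\<^bsub>G\<^esub> H = \<zero>\<^bsub>G\<^esub>"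
          using s ini_closed[OF ms] by (auto simp: deg0_def)
      qed
      thus ?thesis by (simp add: min.coboundedI1)
    qed
  qed
qed

end

section \<open>Links in a Cohen-Macaulay local ring\<close>

context noetherian_local begin

theorem link_graded_serre_1:
  assumes cm: "depth R m = krull_dim R"
    and p: "primeideal p R" "ideal_height R p = enat g"
      "\<not> regular_local_ring (local_at R p) (local_at_max R p)"
    and xs: "regular_sequence R xs" "length xs = g" "J = Idl (set xs)" "J \<subseteq> p"
    and I_def: "I = colon_ideal R J p"
  shows "serre_condition (assoc_graded_ring R I) 1"
proof -
  interpret L: localization_at_prime R p
    by (intro localization_at_prime.intro localization_at_prime_axioms.intro is_cring p(1))
  have reg: "reg_ideal g J" using regular_sequence_reg_ideal[OF xs(1)] xs(2,3) by simp
  have Ji: "ideal J R" using reg_ideal_ideal[OF reg] .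
  have pi: "ideal p R" using p(1) prime_ideal by blast
  have pc: "p \<subseteq> carrier R" using idl_sub[OF pi] .
  have I: "ideal I R" "J \<subseteq> I"
    unfolding I_def using colon_ideal_ideal[OF Ji pc] colon_supset[OF Ji pc] .
  have not_reg: "\<exists>c\<in>p. r \<otimes> c \<notin> Idl (set zs)"
    if "set zs \<subseteq> p" "length zs = g" "r \<in> carrier R - p" for zs r
  proof (rule ccontr)
    assume "\<not> ?thesis"
    hence "regular_local_ring (local_at R p) (local_at_max R p)"
      using that p(2) noetherian_ring_axioms by (intro L.local_at_regularI[of zs r]) auto
    thus False using p(3) by simp
  qed
  have II: "I \<cdot> I \<subseteq> J \<cdot> I"
    using link_reduction(2)[OF reg xs(4) p(1) not_reg] unfolding I_def .
  have "reduced_graded R I J g"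
  proof (intro reduced_graded.intro graded.intro graded_axioms.intro reduced_graded_axioms.intro
      noetherian_cring_axioms is_cring I reg)
    show "pw I (Suc n) = pw J n \<cdot> I" for n using reduction_powers[OF Ji I II] .
    \<comment> \<open>Multiplication by the elements of \<open>p\<close> embeds R/I into a power of
      R/J; concretely, \<open>a\<close> is cancelled modulo \<open>J\<close> from
      \<open>(r b) a\<close> for each \<open>b\<close> in \<open>p\<close>.\<close>
    show "nzd I a" if a: "nzd J a" for a
    proof -
      have ac: "a \<in> carrier R" using a by (simp add: nzd_def)
      have "r \<otimes> b \<in> J" if r: "r \<in> carrier R" "r \<otimes> a \<in> I" and b: "b \<in> p" for r b
      proof -
        have bc: "b \<in> carrier R" using b pc by blast
        have "(r \<otimes> a) \<otimes> b \<in> J" using r b unfolding I_def by (simp add: mem_colon)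
        moreover have "(r \<otimes> a) \<otimes> b = (r \<otimes> b) \<otimes> a" using r ac bc by algebra
        ultimately show ?thesis using nzdD[OF a, of "r \<otimes> b"] r bc by simp
      qed
      hence "r \<in> I" if "r \<in> carrier R" "r \<otimes> a \<in> I" for r
        using that unfolding I_def mem_colon by blast
      thus ?thesis using ac by (simp add: nzd_def)
    qed
    fix q Q
    assume q: "primeideal q R" "J \<subseteq> q" "\<And>a. a \<in> q \<Longrightarrow> \<not> nzd J a" and Q: "primeideal Q R" "J \<subseteq> Q" "Q \<subseteq> q"
    \<comment> \<open>Consisting of zero divisors, \<open>q\<close> lies in an associated prime
      \<open>Q'\<close> of \<open>J\<close>, and unmixedness collapses the chain \<open>Q\<close>,
      \<open>q\<close>, \<open>Q'\<close>.\<close>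
    obtain Q' where Q': "assoc_prime J Q'" "q \<subseteq> Q'"
      using zero_divisors_in_assoc[OF Ji prime_ideal[OF q(1)]] q(3) by blast
    have "q = Q'" "Q = Q'"
      using cohen_macaulay_unmixed[OF cm xs(1)] Q' q Q xs(3) by blast+
    thus "Q = q" by simp
  qed
  thus ?thesis by (rule reduced_graded.graded_serre_1)
qed

end

theorem corollary3p20:
  fixes R :: "('a, 'b) ring_scheme"
    and m p J I :: "'a set"
    and xs :: "'a list"
    and g :: nat
  assumes "cohen_macaulay_local_ring R m"
    and "primeideal p R"
    and "ideal_height R p = enat g"
    and "\<not> regular_local_ring (local_at R p) (local_at_max R p)"
    and "regular_sequence R xs"
    and "length xs = g"
    and "J = genideal R (set xs)"
    and "J \<subseteq> p"
    and "I = colon_ideal R J p"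
  shows "serre_condition (assoc_graded_ring R I) 1"
proof -
  have "noetherian_local R m" "depth R m = krull_dim R"
    using assms(1) by (simp_all add: cohen_macaulay_local_ring_def noetherian_local_ring_def
        noetherian_local_def noetherian_cring_def noetherian_local_axioms_def)
  thus ?thesis by (rule noetherian_local.link_graded_serre_1[OF _ _ assms(2-9)])
qed

end
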